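(* Let $G$ be a connected reductive linear algebraic group over $k$ with Lie algebra $\mathfrak{g}$. There exists a positive integer $m$ such that for every regular $G$-connection $A$ the pull-back connection $m^*(A)$ is gauge equivalent to a connection in standard form, i.e. to $X\,d\log z$ for some $X\in\mathfrak{g}$.
   Context: $k$ is an algebraically closed field of characteristic zero and $K=k((z))$. For a linear algebraic group $G$ over $k$ with Lie algebra $\mathfrak{g}$, put $\mathfrak{g}(K)=\mathfrak{g}\otimes_k K=\mathfrak{g}((z))$. A ($G$-)connection is an element of $\mathfrak{g}(K)\otimes_K\Omega=\mathfrak{g}(K)\,d\log z$, where $\Omega=K\,dz$ and $d\log z=z^{-1}dz$. The gauge group $G(K)$ acts on connections by $g[A\,d\log z]=\big(\mathrm{Ad}(g)(A)+\widehat{z\partial_z}(g)g^{-1}\big)\,d\log z$. Here $\widehat{z\partial_z}:G(K)\to G(K[\varepsilon])$ ($\varepsilon^2=0$) is induced by the $k$-algebra map $K\to K[\varepsilon]$, $f\mapsto f+z\frac{\partial f}{\partial z}\varepsilon$, and $\mathfrak{g}(K)$ is identified with $\ker(G(K[\varepsilon])\to G(K),\ \varepsilon\mapsto 0)$. For a closed subgroup $G\subset \mathrm{GL}_n$ this reads $g[A\,d\log z]=(gAg^{-1}+z\partial_z(g)g^{-1})\,d\log z$ with $z\partial_z$ applied entrywise. Two connections are gauge equivalent if they lie in the same $G(K)$-orbit. A connection is regular if it is gauge equivalent to an element of $\mathfrak{g}[[z]]\,d\log z$, where $\mathfrak g[[z]]=\mathfrak g\otimes_k k[[z]]$. For a positive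 integer $m$, the pull-back of connections is $m^*(A(z)\,d\log z)=m\,A(z^m)\,d\log z$. *)

theory Defs
  imports
    "HOL-Computational_Algebra.Formal_Laurent_Series"
    "HOL-Library.Poly_Mapping"
    "HOL-Algebra.Coset"
    "HOL-Analysis.Abstract_Topology"
    "Jordan_Normal_Form.Matrix"
begin

section \<open>Dual numbers\<close>

text \<open>\<open>Dual a b\<close> is $a + b\varepsilon$ in $R[\varepsilon]$, $\varepsilon^2 = 0$.\<close>

datatype 'r dual_num = Dual (dual_re: 'r) (dual_eps: 'r)

instantiation dual_num :: (comm_ring_1) comm_ring_1
begin

definition "0 = Dual 0 0"
definition "1 = Dual 1 0"
definition "x + y = Dual (dual_re x + dual_re y) (dual_eps x + dual_eps y)"
definition "x - y = Dual (dual_re x - dual_re y) (dual_eps x - dual_eps y)"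
definition "- x = Dual (- dual_re x) (- dual_eps x)"
definition "x * y = Dual (dual_re x * dual_re y) (dual_re x * dual_eps y + dual_eps x * dual_re y)"

instance
  by standard
    (auto simp: zero_dual_num_def one_dual_num_def plus_dual_num_def minus_dual_num_def
      uminus_dual_num_def times_dual_num_def algebra_simps dual_num.expand)

end


section \<open>Polynomials in the entries of an n by n matrix\<close>

text \<open>An element of \<open>'k mat_poly\<close> is a finitely supported function from monomials to
  coefficients, a monomial being a finitely supported function from index pairs to exponents.
  The type has infinitely many variables; \<open>mat_polys n\<close> keeps those with indices below \<open>n\<close>.\<close>

type_synonym 'k mat_poly = "((nat \<times> nat) \<Rightarrow>\<^sub>0 nat) \<Rightarrow>\<^sub>0 'k"

definition mat_polys :: "nat \<Rightarrow> 'k::zero mat_poly set" where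
  "mat_polys n = {p. \<forall>t \<in> Poly_Mapping.keys p. Poly_Mapping.keys t \<subseteq> {..<n} \<times> {..<n}}"

text \<open>Evaluation at a matrix over \<open>'r\<close>, a \<open>'k\<close>-algebra with structure map \<open>\<phi>\<close>.\<close>

definition eval_mat_poly ::
    "('k::zero \<Rightarrow> 'r::comm_ring_1) \<Rightarrow> 'k mat_poly \<Rightarrow> 'r mat \<Rightarrow> 'r" where
  "eval_mat_poly \<phi> p M =
     (\<Sum>t \<in> Poly_Mapping.keys p. \<phi> (Poly_Mapping.lookup p t) *
        (\<Prod>ij \<in> Poly_Mapping.keys t. (M $$ ij) ^ Poly_Mapping.lookup t ij))"


section \<open>Linear algebraic groups as Zariski closed subgroups of the general linear group\<close>

definition GL :: "nat \<Rightarrow> 'r::comm_ring_1 mat monoid" where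
  "GL n = units_of (ring_mat TYPE('r) n ())"

text \<open>The principal open sets form a basis, so the closed sets are the common zero sets
  of families of polynomials.\<close>

definition zariski :: "nat \<Rightarrow> 'k::field mat topology" where
  "zariski n = topology_generated_by
     {{M \<in> carrier_mat n n. eval_mat_poly id p M \<noteq> 0} | p. p \<in> mat_polys n}"

definition linear_algebraic_group :: "nat \<Rightarrow> 'k::field mat set \<Rightarrow> bool" where
  "linear_algebraic_group n G \<longleftrightarrow>
     subgroup G (GL n) \<and> closedin (subtopology (zariski n) (carrier (GL n))) G"

definition unipotent_mat :: "nat \<Rightarrow> 'k::field mat \<Rightarrow> bool" where
  "unipotent_mat n g \<longleftrightarrow> (\<exists>j. (g - 1\<^sub>m n) ^\<^sub>m j = 0\<^sub>m n n)"

text \<open>The unipotent radical is the largest closed connected normal unipotent subgroup;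
  being the largest, it is the union of all such subgroups.\<close>

definition unipotent_radical :: "nat \<Rightarrow> 'k::field mat set \<Rightarrow> 'k mat set" where
  "unipotent_radical n G =
     \<Union>{U. linear_algebraic_group n U \<and> U \<lhd> (GL n)\<lparr>carrier := G\<rparr> \<and>
          connectedin (zariski n) U \<and> (\<forall>g\<in>U. unipotent_mat n g)}"

definition connected_reductive :: "nat \<Rightarrow> 'k::field mat set \<Rightarrow> bool" where
  "connected_reductive n G \<longleftrightarrow>
     linear_algebraic_group n G \<and> connectedin (zariski n) G \<and> unipotent_radical n G = {1\<^sub>m n}"


section \<open>Points over an algebra and the Lie algebra\<close>

definition vanishing_ideal :: "nat \<Rightarrow> 'k::field mat set \<Rightarrow> 'k mat_poly set" where
  "vanishing_ideal n G = {p \<in> mat_polys n. \<forall>g\<in>G. eval_mat_poly id p g = 0}"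

text \<open>\<open>points \<phi> n G\<close> is $G(R)$ for the algebra $R$ with structure map \<open>\<phi>\<close>.  Inverting the determinant
  adds no further equations: every element of the ideal of $G$ in the coordinate ring of
  $\mathrm{GL}_n$ is a polynomial in \<open>vanishing_ideal n G\<close> divided by a power of the determinant.\<close>

definition points ::
    "('k::field \<Rightarrow> 'r::comm_ring_1) \<Rightarrow> nat \<Rightarrow> 'k mat set \<Rightarrow> 'r mat set" where
  "points \<phi> n G =
     {g \<in> carrier (GL n). \<forall>p \<in> vanishing_ideal n G. eval_mat_poly \<phi> p g = 0}"

text \<open>The kernel of $G(k[\varepsilon]) \to G(k)$, written as $1 + \varepsilon X$.\<close>

definition lie_algebra :: "nat \<Rightarrow> 'k::field mat set \<Rightarrow> 'k mat set" where
  "lie_algebra n G =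
     {X \<in> carrier_mat n n. 1\<^sub>m n + map_mat (Dual 0) X \<in> points (\<lambda>c. Dual c 0) n G}"


section \<open>Connections\<close>

text \<open>The field $K = k((z))$ is \<open>'k fls\<close>, with $z$ being \<open>fls_X\<close>.  A connection $A\,d\log z$ is
  represented by the matrix $A$.  As the Lie algebra is finite-dimensional, its tensor product
  with $K$ consists of the matrices all of whose coefficient matrices lie in it.\<close>

abbreviation loop_group :: "nat \<Rightarrow> 'k::field mat set \<Rightarrow> 'k fls mat set" where
  "loop_group \<equiv> points fls_const"

definition connections :: "nat \<Rightarrow> 'k::field mat set \<Rightarrow> 'k fls mat set" where
  "connections n G =
     {A \<in> carrier_mat n n. \<forall>i. map_mat (\<lambda>f. fls_nth f i) A \<in> lie_algebra n G}"

text \<open>The connections in $\mathfrak{g}[[z]]\,d\log z$.\<close>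

definition power_series_connections :: "nat \<Rightarrow> 'k::field mat set \<Rightarrow> 'k fls mat set" where
  "power_series_connections n G =
     {A \<in> connections n G. \<forall>i<0. map_mat (\<lambda>f. fls_nth f i) A = 0\<^sub>m n n}"

definition gauge :: "nat \<Rightarrow> 'k::field fls mat \<Rightarrow> 'k fls mat \<Rightarrow> 'k fls mat" where
  "gauge n g A =
     g * A * inv\<^bsub>GL n\<^esub> g + map_mat (\<lambda>f. fls_X * fls_deriv f) g * inv\<^bsub>GL n\<^esub> g"

definition gauge_equivalent ::
    "nat \<Rightarrow> 'k::field mat set \<Rightarrow> 'k fls mat \<Rightarrow> 'k fls mat \<Rightarrow> bool" where
  "gauge_equivalent n G A B \<longleftrightarrow>
     A \<in> connections n G \<and> B \<in> connections n G \<and> (\<exists>g \<in> loop_group n G. B = gauge n g A)"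

definition regular_connection :: "nat \<Rightarrow> 'k::field mat set \<Rightarrow> 'k fls mat \<Rightarrow> bool" where
  "regular_connection n G A \<longleftrightarrow> (\<exists>B \<in> power_series_connections n G. gauge_equivalent n G A B)"

text \<open>The pull-back $m\,A(z^m)\,d\log z$ along $z \mapsto z^m$.\<close>

definition pullback :: "nat \<Rightarrow> 'k::field fls mat \<Rightarrow> 'k fls mat" where
  "pullback m A = map_mat (\<lambda>f. of_nat m * fls_compose_power f m) A"

end

theory Submission
  imports Defs "Jordan_Normal_Form.Jordan_Normal_Form_Existence" "HOL-Library.Function_Algebras"
begin

text \<open>The connections considered have values in the Lie algebra \<open>\<gg>\<close> of a group \<open>G\<close> of matrices, and
  \<open>I\<close> is the ideal of the polynomials in the matrix entries that vanish on \<open>G\<close>.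

  A regular connection may be taken to be \<open>A = A\<^sub>0 + A\<^sub>1 z + \<dots>\<close> with coefficients in \<open>\<gg>\<close>.  Choose a
  basis in which \<open>J = A\<^sub>0\<close> is upper triangular with diagonal \<open>s\<close> and has no entry joining different
  eigenvalues.  A gauge transformation congruent to 1 modulo \<open>z\<close> removes from \<open>A\<^sub>j\<close>, for \<open>j \<ge> 1\<close>, whatever
  lies in the image of \<open>ad J - j\<close> on \<open>\<gg>\<close>; what survives is resonant: it has entries only at the
  positions \<open>(a, b)\<close> with \<open>s a - s b = j\<close> (\<open>resonant_normal_form\<close>).  After the pull-back by \<open>m\<close> such an
  entry carries \<open>z\<close> to the power \<open>m j\<close>.  Conjugation by \<open>diag (z^(-l 0), z^(-l 1), \<dots>)\<close>
  multiplies it by \<open>z\<close> to the power \<open>l b - l a\<close>.  Hence an integer vector \<open>l\<close> with \<open>l a - l b = m (s a - s b)\<close> whenever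
  \<open>s a - s b\<close> is a natural number makes the connection constant
  (\<open>resonant_pullback_constant\<close>).  What has to be shown is that \<open>l\<close> can be chosen as a cocharacter of \<open>G\<close>,
  for one \<open>m\<close> that serves all connections.

  The link between \<open>G\<close> and linear algebra is that the derivation \<open>lder X\<close> of the polynomial ring given
  by \<open>X\<close> in \<open>\<gg>\<close> maps \<open>I\<close> to itself (\<open>lder_vanishing\<close>).  In the basis above, monomials are generalised
  eigenvectors of \<open>lder J\<close>; the eigenvalue is the weight \<open>wt s\<close>, that is, the row degrees of the
  monomial paired with \<open>s\<close>.  A subspace stable under an operator contains the generalised
  eigencomponents of its elements, so \<open>I\<close> contains the weight components of its elements
  (\<open>component_vanishing\<close>).  This takes the place of the Jordan decomposition inside \<open>\<gg>\<close> and is used twice.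
  If \<open>l\<close> satisfies every linear relation that \<open>s\<close> satisfies between row degrees of monomials of degree
  at most \<open>d\<close>, where \<open>d\<close> is such that the polynomials in \<open>I\<close> of degree at most \<open>d\<close> cut out \<open>\<gg>\<close>, then
  \<open>diag l\<close> lies in \<open>\<gg>\<close> (\<open>diagonal_in_lie\<close>).  If moreover \<open>l\<close> is integral, then the diagonal matrix of
  the powers of \<open>z\<close> lies in \<open>G(K)\<close> (\<open>cocharacter_in_loop_group\<close>).

  The number \<open>d\<close> exists because \<open>\<gg>\<close> has finite dimension, and a change of basis does not affect it.  So
  all conditions on \<open>l\<close> concern linear forms with integer coefficients from one finite set: some of
  these forms are integral at \<open>s\<close>, and \<open>l\<close> has to be an integral point where they take \<open>m\<close> times
  these values.  As only finitely many sets of forms occur, there is an \<open>m\<close> for which such an \<open>l\<close> always exists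
  (\<open>integral_point\<close>).

  Elements of \<open>G(K)\<close> congruent to 1 modulo \<open>z\<close> are produced as solutions of \<open>z g' = Y g\<close> with \<open>Y\<close> in
  \<open>z \<gg>[[z]]\<close>.  For \<open>p\<close> in \<open>I\<close> the operator \<open>z d/dz\<close> takes \<open>p(g)\<close> to \<open>\<Sum> z\<^sup>i (lder Y\<^sub>i p)(g)\<close>, so that the
  coefficients of \<open>p(g)\<close> vanish one after the other (\<open>flow_in_group\<close>); the same argument shows that such \<open>g\<close>
  preserve \<open>\<gg>[[z]]\<close> under conjugation (\<open>flow_adjoint\<close>).\<close>

section \<open>Evaluation of polynomials and partial derivatives\<close>

abbreviation "keys \<equiv> Poly_Mapping.keys"

abbreviation "lookup \<equiv> Poly_Mapping.lookup"

abbreviation "single \<equiv> Poly_Mapping.single"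

abbreviation idx :: "nat \<Rightarrow> (nat \<times> nat) set" where
  "idx n \<equiv> {..<n} \<times> {..<n}"

definition monval :: "(nat \<times> nat \<Rightarrow> 'r::comm_ring_1) \<Rightarrow> ((nat \<times> nat) \<Rightarrow>\<^sub>0 nat) \<Rightarrow> 'r" where
  "monval v t = (\<Prod>ij \<in> keys t. v ij ^ lookup t ij)"

text \<open>Evaluation for an arbitrary assignment of values to the variables instead of a matrix, so that it is
  a ring homomorphism without side conditions on indices.\<close>

definition ev :: "('k::zero \<Rightarrow> 'r::comm_ring_1) \<Rightarrow> (nat \<times> nat \<Rightarrow> 'r) \<Rightarrow> 'k mat_poly \<Rightarrow> 'r" where
  "ev \<phi> v p = (\<Sum>t \<in> keys p. \<phi> (lookup p t) * monval v t)"

lemma eval_mat_poly_conv_ev: "eval_mat_poly \<phi> p M = ev \<phi> (\<lambda>ij. M $$ ij) p"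
  unfolding eval_mat_poly_def ev_def monval_def ..

abbreviation cst :: "'k::zero \<Rightarrow> 'k mat_poly" where
  "cst c \<equiv> single 0 c"

definition var :: "nat \<times> nat \<Rightarrow> 'k::zero_neq_one mat_poly" where
  "var ij = single (single ij 1) 1"

abbreviation ev_one :: "nat \<Rightarrow> 'k::comm_ring_1 mat_poly \<Rightarrow> 'k" where
  "ev_one n \<equiv> ev id (\<lambda>ij. 1\<^sub>m n $$ ij)"

lemma monval_superset:
  assumes "finite S" "keys t \<subseteq> S"
  shows "monval v t = (\<Prod>ij\<in>S. v ij ^ lookup t ij)"
  unfolding monval_def
  by (rule prod.mono_neutral_left) (use assms in \<open>auto simp: in_keys_iff\<close>)

lemma monval_add: "monval v (s + t) = monval v s * monval v t"
proof -
  let ?S = "keys s \<union> keys t"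
  have "monval v (s + t) = (\<Prod>ij\<in>?S. v ij ^ lookup (s + t) ij)"
    by (rule monval_superset) (use keys_add[of s t] in auto)
  also have "\<dots> = (\<Prod>ij\<in>?S. v ij ^ lookup s ij) * (\<Prod>ij\<in>?S. v ij ^ lookup t ij)"
    by (simp add: lookup_add power_add prod.distrib)
  also have "\<dots> = monval v s * monval v t"
    by (simp add: monval_superset[of ?S])
  finally show ?thesis .
qed

lemma monval_0 [simp]: "monval v 0 = 1"
  by (simp add: monval_def)

lemma monval_single [simp]: "monval v (single ij e) = v ij ^ e"
  by (cases "e = 0") (simp_all add: monval_def)

lemma cst_comm_ring_hom: "comm_ring_hom (cst :: 'k::comm_ring_1 \<Rightarrow> 'k mat_poly)"
  by unfold_locales (simp_all add: single_add mult_single)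

context comm_ring_hom
begin

lemma ev_superset:
  assumes "finite S" "keys p \<subseteq> S"
  shows "ev hom v p = (\<Sum>t\<in>S. hom (lookup p t) * monval v t)"
  unfolding ev_def
  by (rule sum.mono_neutral_left) (use assms in \<open>auto simp: in_keys_iff\<close>)

lemma ev_add: "ev hom v (p + q) = ev hom v p + ev hom v q"
proof -
  let ?S = "keys p \<union> keys q"
  have "ev hom v (p + q) = (\<Sum>t\<in>?S. hom (lookup (p + q) t) * monval v t)"
    by (rule ev_superset) (use keys_add[of p q] in auto)
  also have "\<dots> = ev hom v p + ev hom v q"
    by (simp add: lookup_add hom_add distrib_right sum.distrib ev_superset[of ?S])
  finally show ?thesis .
qed

lemma ev_single [simp]: "ev hom v (single t c) = hom c * monval v t"
  by (cases "c = 0") (simp_all add: ev_def)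

lemma ev_cst [simp]: "ev hom v (cst c) = hom c"
  by simp

lemma ev_var [simp]: "ev hom v (var ij) = v ij"
  unfolding var_def ev_single monval_single by simp

lemma ev_0 [simp]: "ev hom v 0 = 0"
  by (simp add: ev_def)

lemma ev_sum: "ev hom v (sum f S) = (\<Sum>x\<in>S. ev hom v (f x))"
  by (induction S rule: infinite_finite_induct) (simp_all add: ev_add ev_0)

end

lemma mat_poly_sum_monomials:
  "(p :: 'a \<Rightarrow>\<^sub>0 'k::comm_monoid_add) =
     (\<Sum>t\<in>keys p. single t (lookup p t))"
proof (rule poly_mapping_eqI)
  fix s
  show "lookup p s =
    lookup (\<Sum>t\<in>keys p. single t (lookup p t)) s"
    by (simp add: lookup_sum lookup_single when_def in_keys_iff)
qed

context comm_ring_hom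
begin

lemma ev_mult: "ev hom v (p * q) = ev hom v p * ev hom v q"
proof -
  let ?P = "keys p" and ?Q = "keys q"
  let ?a = "lookup p" and ?b = "lookup q"
  have "p * q = (\<Sum>t\<in>?P. single t (?a t)) * (\<Sum>t\<in>?Q. single t (?b t))"
    by (subst (1) mat_poly_sum_monomials[of p], subst (1) mat_poly_sum_monomials[of q]) (rule refl)
  also have "\<dots> = (\<Sum>s\<in>?P. \<Sum>t\<in>?Q. single (s + t) (?a s * ?b t))"
    by (simp add: sum_product mult_single)
  finally show ?thesis
    by (simp add: ev_sum ev_def[of _ _ p] ev_def[of _ _ q] sum_product hom_mult monval_add mult_ac)
qed

lemma ev_comm_ring_hom: "comm_ring_hom (ev hom v)"
  by unfold_locales (simp_all add: ev_add ev_mult, simp add: ev_def)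

lemma ev_1 [simp]: "ev hom v 1 = 1"
  by (simp add: ev_def)

text \<open>Naturality.  Identities between values of polynomials over \<open>k\<close> are carried in this way to \<open>K\<close>, to dual
  numbers and to polynomial rings.\<close>

lemma hom_ev: "hom (ev \<phi> v p) = ev (\<lambda>c. hom (\<phi> c)) (\<lambda>ij. hom (v ij)) p"
  by (simp add: ev_def monval_def hom_sum hom_mult hom_prod hom_power)

end

lemma ev_cong:
  assumes "p \<in> mat_polys n" "\<And>ij. ij \<in> idx n \<Longrightarrow> v ij = w ij"
  shows "ev \<phi> v p = ev \<phi> w p"
  unfolding ev_def monval_def using assms
  by (intro sum.cong prod.cong arg_cong2[of _ _ _ _ "(*)"] refl arg_cong2[of _ _ _ _ "(^)"])
     (auto simp: mat_polys_def subset_iff)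

lemma ev_var_cst [simp]: "ev cst var (p :: 'k::comm_ring_1 mat_poly) = p"
proof -
  have monomial_eq_prod_var: "monval var t = (single t 1 :: 'k mat_poly)" for t
  proof -
    have "monval var t = (\<Prod>ij\<in>keys t. (single (single ij (lookup t ij)) 1 :: 'k mat_poly))"
    proof -
      have pow: "(var ij :: 'k mat_poly) ^ e = single (single ij e) 1" for ij e
        by (induction e) (simp_all add: var_def mult_single flip: single_add)
      show ?thesis
        by (simp add: monval_def pow del: single_one)
    qed
    also have "\<dots> = single (\<Sum>ij\<in>keys t. single ij (lookup t ij)) 1"
    proof -
      have "(\<Prod>ij\<in>S. (single (f ij) 1 :: 'k mat_poly)) = single (\<Sum>ij\<in>S. f ij) 1" for S :: "(nat \<times> nat) set" and f
        by (induction S rule: infinite_finite_induct) (simp_all add: mult_single)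
      thus ?thesis .
    qed
    also have "(\<Sum>ij\<in>keys t. single ij (lookup t ij)) = t"
      by (rule mat_poly_sum_monomials[symmetric])
    finally show ?thesis .
  qed
  have "ev cst var p = (\<Sum>t\<in>keys p. single t (lookup p t))"
    by (simp add: ev_def monomial_eq_prod_var mult_single)
  thus ?thesis
    by (simp flip: mat_poly_sum_monomials)
qed

lemma ev_in_closed:
  assumes p: "p \<in> mat_polys n"
    and P0: "P 0" and P1: "P 1" and Pc: "\<And>c. P (\<phi> c)"
    and Pv: "\<And>ij. ij \<in> idx n \<Longrightarrow> P (v ij)"
    and Pa: "\<And>x y. P x \<Longrightarrow> P y \<Longrightarrow> P (x + y)" and Pm: "\<And>x y. P x \<Longrightarrow> P y \<Longrightarrow> P (x * y)"
  shows "P (ev \<phi> v p)"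
proof -
  have pow: "P (x ^ e)" if "P x" for x e using that by (induction e) (auto intro: P1 Pm)
  have prd: "(\<And>x. x \<in> S \<Longrightarrow> P (f x)) \<Longrightarrow> P (prod f S)" for S :: "(nat \<times> nat) set" and f
    by (induction S rule: infinite_finite_induct) (auto intro: P1 Pm)
  have sm: "(\<And>x. x \<in> S \<Longrightarrow> P (f x)) \<Longrightarrow> P (sum f S)" for S :: "(nat \<times> nat \<Rightarrow>\<^sub>0 nat) set" and f
    by (induction S rule: infinite_finite_induct) (auto intro: P0 Pa)
  show ?thesis
    unfolding ev_def monval_def using p
    by (intro sm Pm Pc prd pow Pv) (auto simp: mat_polys_def subset_iff)
qed

text \<open>Two additive maps that satisfy the same product rule agree as soon as they agree on constants and
  variables.\<close>

lemma mat_polys_induct [consumes 1, case_names cst var add mult]: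
  fixes p :: "'k::comm_ring_1 mat_poly"
  assumes p: "p \<in> mat_polys n"
    and "\<And>c. P (cst c)" "\<And>ij. ij \<in> idx n \<Longrightarrow> P (var ij)"
    and "\<And>x y. P x \<Longrightarrow> P y \<Longrightarrow> P (x + y)" "\<And>x y. P x \<Longrightarrow> P y \<Longrightarrow> P (x * y)"
  shows "P p"
proof -
  have "P (ev cst var p)"
    by (rule ev_in_closed[OF p]) (use assms(2)[of 0] assms(2)[of 1] assms in auto)
  thus ?thesis by simp
qed

lemma mat_polys_closed [intro]:
  fixes p q :: "'k::comm_ring_1 mat_poly"
  shows "0 \<in> mat_polys n" "1 \<in> mat_polys n" "cst c \<in> mat_polys n"
    "ij \<in> idx n \<Longrightarrow> (var ij :: 'k mat_poly) \<in> mat_polys n"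
    "p \<in> mat_polys n \<Longrightarrow> q \<in> mat_polys n \<Longrightarrow> p + q \<in> mat_polys n"
    "p \<in> mat_polys n \<Longrightarrow> q \<in> mat_polys n \<Longrightarrow> p * q \<in> mat_polys n"
proof -
  show "0 \<in> mat_polys n" "1 \<in> mat_polys n" "cst c \<in> mat_polys n"
    "ij \<in> idx n \<Longrightarrow> (var ij :: 'k mat_poly) \<in> mat_polys n"
    by (auto simp: mat_polys_def var_def)
  assume p: "p \<in> mat_polys n" and q: "q \<in> mat_polys n"
  thus "p + q \<in> mat_polys n"
    using keys_add[of p q] by (auto simp: mat_polys_def)
  show "p * q \<in> mat_polys n"
  proof -
    have "keys (s + t) \<subseteq> idx n"
      if "s \<in> keys p" "t \<in> keys q" for s t
      using that p q keys_add[of s t] by (fastforce simp: mat_polys_def)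
    thus ?thesis
      using keys_mult[of p q] unfolding mat_polys_def by blast
  qed
qed

lemma mat_polys_sum [intro]:
  fixes f :: "'a \<Rightarrow> 'k::comm_ring_1 mat_poly"
  shows "(\<And>x. x \<in> S \<Longrightarrow> f x \<in> mat_polys n) \<Longrightarrow> sum f S \<in> mat_polys n"
  by (induction S rule: infinite_finite_induct) auto

lemma ev_in_mat_polys:
  fixes p :: "'k::comm_ring_1 mat_poly" and v :: "nat \<times> nat \<Rightarrow> 'k mat_poly"
  assumes "p \<in> mat_polys n" "\<And>ij. ij \<in> idx n \<Longrightarrow> v ij \<in> mat_polys n"
  shows "ev cst v p \<in> mat_polys n"
  by (rule ev_in_closed[OF assms(1)]) (use assms in auto)

lemmas dual_num_simps = zero_dual_num_def one_dual_num_def plus_dual_num_def minus_dual_num_def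
  uminus_dual_num_def times_dual_num_def

lemma (in comm_ring_hom) Dual_comm_ring_hom: "comm_ring_hom (\<lambda>c. Dual (hom c) 0)"
  by unfold_locales (simp_all add: dual_num_simps hom_add hom_mult)

lemma dual_re_comm_ring_hom: "comm_ring_hom dual_re"
  by unfold_locales (auto simp: dual_num_simps)

text \<open>The partial derivative, read off from evaluation at \<open>x\<^sub>k\<^sub>l + \<epsilon>\<close> over the polynomial ring: the sum and
  product rules come from evaluation being a homomorphism.\<close>

definition pd :: "nat \<times> nat \<Rightarrow> 'k::comm_ring_1 mat_poly \<Rightarrow> 'k mat_poly" where
  "pd ij p = dual_eps (ev (\<lambda>c. Dual (cst c) 0) (\<lambda>kl. Dual (var kl) (if kl = ij then 1 else 0)) p)"

lemma dual_re_ev: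
  "dual_re (ev (\<lambda>c. Dual (\<phi> c) 0) v p) = ev \<phi> (\<lambda>ij. dual_re (v ij)) p"
proof -
  interpret comm_ring_hom dual_re by (rule dual_re_comm_ring_hom)
  show ?thesis by (simp add: hom_ev)
qed

lemma pd_add: "pd ij (p + q) = pd ij p + pd ij q"
proof -
  interpret comm_ring_hom "\<lambda>c. Dual (cst c :: 'a mat_poly) 0"
    by (rule comm_ring_hom.Dual_comm_ring_hom[OF cst_comm_ring_hom])
  show ?thesis by (simp add: pd_def ev_add dual_num_simps)
qed

lemma pd_mult: "pd ij (p * q) = p * pd ij q + pd ij p * q"
proof -
  interpret comm_ring_hom "\<lambda>c. Dual (cst c :: 'a mat_poly) 0"
    by (rule comm_ring_hom.Dual_comm_ring_hom[OF cst_comm_ring_hom])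
  show ?thesis by (simp add: pd_def ev_mult dual_num_simps dual_re_ev)
qed

lemma pd_cst [simp]: "pd ij (cst c) = 0"
proof -
  interpret comm_ring_hom "\<lambda>c. Dual (cst c :: 'a mat_poly) 0"
    by (rule comm_ring_hom.Dual_comm_ring_hom[OF cst_comm_ring_hom])
  show ?thesis by (simp add: pd_def dual_num_simps)
qed

lemma pd_var [simp]: "pd ij (var kl) = (if kl = ij then 1 else 0)"
proof -
  interpret comm_ring_hom "\<lambda>c. Dual (cst c :: 'a mat_poly) 0"
    by (rule comm_ring_hom.Dual_comm_ring_hom[OF cst_comm_ring_hom])
  show ?thesis by (simp add: pd_def)
qed

text \<open>Taylor's formula modulo \<open>\<epsilon>\<^sup>2\<close>; in particular the coefficient of \<open>\<epsilon>\<close> is linear in the displacement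
  \<open>w\<close>.\<close>

lemma (in comm_ring_hom) dual_eps_ev:
  fixes p :: "'a mat_poly"
  assumes "p \<in> mat_polys n"
  shows "dual_eps (ev (\<lambda>c. Dual (hom c) 0) (\<lambda>ij. Dual (u ij) (w ij)) p) =
    (\<Sum>ij\<in>idx n. w ij * ev hom u (pd ij p))"
  using assms
proof (induction p rule: mat_polys_induct)
  interpret D: comm_ring_hom "\<lambda>c. Dual (hom c) 0" by (rule Dual_comm_ring_hom)
  {
    case (cst c)
    show ?case by (simp add: dual_num_simps ev_0 )
  next
    case (var kl)
    have "(\<Sum>ij\<in>idx n. w ij * ev hom u (pd ij (var kl))) =
        (\<Sum>ij\<in>idx n. if kl = ij then w ij else 0)"
      by (intro sum.cong) auto
    with var show ?case by (simp add: sum.delta)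
  next
    case (add p q)
    thus ?case by (simp add: D.ev_add dual_num_simps pd_add ev_add distrib_left sum.distrib)
  next
    case (mult p q)
    thus ?case
      by (simp add: D.ev_mult dual_num_simps(6) dual_re_ev pd_mult ev_add ev_mult distrib_left sum.distrib
        sum_distrib_left sum_distrib_right mult_ac)
  }
qed

lemma pd_in_mat_polys [intro]:
  assumes "p \<in> mat_polys n" "ij \<in> idx n" shows "pd ij p \<in> mat_polys n"
proof -
  interpret D: comm_ring_hom "\<lambda>c. Dual (cst c :: 'a mat_poly) 0"
    by (rule comm_ring_hom.Dual_comm_ring_hom[OF cst_comm_ring_hom])
  define P where "P = (\<lambda>x::'a mat_poly dual_num. dual_re x \<in> mat_polys n \<and> dual_eps x \<in> mat_polys n)"
  have "P (ev (\<lambda>c. Dual (cst c) 0) (\<lambda>kl. Dual (var kl) (if kl = ij then 1 else 0)) p)"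
    by (rule ev_in_closed[OF assms(1)]) (auto simp: P_def dual_num_simps)
  thus ?thesis by (simp add: P_def pd_def)
qed

section \<open>Invertible matrices and linear substitutions\<close>

lemma carrier_GL:
  "g \<in> carrier (GL n :: 'r::comm_ring_1 mat monoid) \<longleftrightarrow>
     g \<in> carrier_mat n n \<and> (\<exists>h\<in>carrier_mat n n. g * h = 1\<^sub>m n \<and> h * g = 1\<^sub>m n)"
  by (auto simp: GL_def units_of_def Units_def ring_mat_def)

lemma GL_simps [simp]: "mult (GL n) = (*)" "one (GL n) = 1\<^sub>m n"
  by (auto simp: GL_def units_of_def ring_mat_def)

lemma inv_GL:
  assumes "g \<in> carrier_mat n n" "h \<in> carrier_mat n n" "g * h = 1\<^sub>m n" "h * g = 1\<^sub>m n"
  shows "inv\<^bsub>GL n\<^esub> g = (h :: 'r::comm_ring_1 mat)"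
proof -
  have M: "monoid (ring_mat TYPE('r) n ())"
    by (rule ring.is_monoid[OF ring_mat])
  interpret group "GL n :: 'r mat monoid"
    unfolding GL_def by (rule monoid.units_group[OF M])
  show ?thesis
    by (rule inv_equality) (use assms in \<open>auto simp: carrier_GL\<close>)
qed

lemma GL_inv_closed:
  assumes "g \<in> carrier (GL n :: 'r::comm_ring_1 mat monoid)"
  shows "inv\<^bsub>GL n\<^esub> g \<in> carrier_mat n n" "g * inv\<^bsub>GL n\<^esub> g = 1\<^sub>m n" "inv\<^bsub>GL n\<^esub> g * g = 1\<^sub>m n"
proof -
  from assms obtain h where h: "g \<in> carrier_mat n n" "h \<in> carrier_mat n n" "g * h = 1\<^sub>m n" "h * g = 1\<^sub>m n"
    unfolding carrier_GL by blast
  from inv_GL[OF this] h show "inv\<^bsub>GL n\<^esub> g \<in> carrier_mat n n" "g * inv\<^bsub>GL n\<^esub> g = 1\<^sub>m n" "inv\<^bsub>GL n\<^esub> g * g = 1\<^sub>m n"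
    by simp_all
qed

lemma GL_mult_closed:
  assumes "g \<in> carrier (GL n :: 'r::comm_ring_1 mat monoid)" "h \<in> carrier (GL n)"
  shows "g * h \<in> carrier (GL n)"
proof -
  have M: "monoid (ring_mat TYPE('r) n ())"
    by (rule ring.is_monoid[OF ring_mat])
  interpret group "GL n :: 'r mat monoid"
    unfolding GL_def by (rule monoid.units_group[OF M])
  show ?thesis using m_closed[OF assms] by simp
qed

lemma (in comm_ring_hom) GL_map_mat:
  assumes "g \<in> carrier (GL n)" shows "map_mat hom g \<in> carrier (GL n)"
proof -
  from assms obtain h where h: "g \<in> carrier_mat n n" "h \<in> carrier_mat n n" "g * h = 1\<^sub>m n" "h * g = 1\<^sub>m n"
    unfolding carrier_GL by blast
  have "map_mat hom g * map_mat hom h = 1\<^sub>m n" "map_mat hom h * map_mat hom g = 1\<^sub>m n"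
    using h mat_hom_mult[of g n n h n] mat_hom_mult[of h n n g n] by (simp_all add: mat_hom_one)
  with h show ?thesis by (auto simp: carrier_GL intro!: bexI[of _ "map_mat hom h"])
qed

lemma sum_square: "(\<Sum>ij\<in>{..<n}\<times>{..<m}. f ij) = (\<Sum>i<n. \<Sum>j<m. f (i, j))"
  by (simp add: sum.cartesian_product)

lemma eq_mat_square:
  "A \<in> carrier_mat n n \<Longrightarrow> B \<in> carrier_mat n n \<Longrightarrow>
     (\<And>i j. i < n \<Longrightarrow> j < n \<Longrightarrow> A $$ (i, j) = B $$ (i, j)) \<Longrightarrow> A = B"
  by (rule eq_matI) auto

lemma index_mult_mat_sum:
  assumes "A \<in> carrier_mat n m" "B \<in> carrier_mat m l" "i < n" "j < l"
  shows "(A * B) $$ (i, j) = (\<Sum>c<m. A $$ (i, c) * B $$ (c, j))"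
  using assms by (simp add: scalar_prod_def lessThan_atLeast0)

text \<open>The polynomial function \<open>x \<mapsto> p (a x b)\<close>; it serves for translations and for conjugation.\<close>

definition tr :: "nat \<Rightarrow> 'k::comm_ring_1 mat \<Rightarrow> 'k mat \<Rightarrow> 'k mat_poly \<Rightarrow> 'k mat_poly" where
  "tr n a b p = ev cst (\<lambda>ij. \<Sum>c<n. \<Sum>d<n. cst (a $$ (fst ij, c)) * var (c, d) * cst (b $$ (d, snd ij))) p"

lemma tr_in_mat_polys [intro]: "p \<in> mat_polys n \<Longrightarrow> tr n a b p \<in> mat_polys n"
  unfolding tr_def by (rule ev_in_mat_polys) (auto intro!: mat_polys_sum mat_polys_closed)

lemma (in comm_ring_hom) ev_tr:
  assumes "p \<in> mat_polys n" "a \<in> carrier_mat n n" "b \<in> carrier_mat n n" "M \<in> carrier_mat n n"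
  shows "ev hom (\<lambda>ij. M $$ ij) (tr n a b p) = ev hom (\<lambda>ij. (map_mat hom a * M * map_mat hom b) $$ ij) p"
proof -
  interpret E: comm_ring_hom "ev hom (\<lambda>ij. M $$ ij)" by (rule ev_comm_ring_hom)
  have "ev hom (\<lambda>ij. M $$ ij) (tr n a b p) =
     ev hom (\<lambda>ij. \<Sum>c<n. \<Sum>d<n. hom (a $$ (fst ij, c)) * M $$ (c, d) * hom (b $$ (d, snd ij))) p"
    unfolding tr_def E.hom_ev by (simp add: E.hom_sum E.hom_mult)
  also have "\<dots> = ev hom (\<lambda>ij. (map_mat hom a * M * map_mat hom b) $$ ij) p"
  proof (rule ev_cong[OF assms(1)])
    fix ij :: "nat \<times> nat" assume ij: "ij \<in> idx n"
    then obtain i j where [simp]: "ij = (i, j)" "i < n" "j < n" by auto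
    have "(map_mat hom a * M * map_mat hom b) $$ (i, j) =
      (\<Sum>d<n. (\<Sum>c<n. hom (a $$ (i, c)) * M $$ (c, d)) * hom (b $$ (d, j)))"
      using assms
      by (subst index_mult_mat_sum[of _ n n _ n])
         (auto intro!: sum.cong simp: index_mult_mat_sum[of _ n n M n] simp del: index_mult_mat)
    also have "\<dots> = (\<Sum>c<n. \<Sum>d<n. hom (a $$ (i, c)) * M $$ (c, d) * hom (b $$ (d, j)))"
      by (subst sum.swap) (simp add: sum_distrib_right)
    finally show "(\<Sum>c<n. \<Sum>d<n. hom (a $$ (fst ij, c)) * M $$ (c, d) * hom (b $$ (d, snd ij))) =
        (map_mat hom a * M * map_mat hom b) $$ ij" by simp
  qed
  finally show ?thesis .
qed

lemma id_hom: "comm_ring_hom id"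
  by unfold_locales auto

lemma vanishing_ideal_iff:
  "p \<in> vanishing_ideal n G \<longleftrightarrow> p \<in> mat_polys n \<and> (\<forall>g\<in>G. ev id (\<lambda>ij. g $$ ij) p = 0)"
  by (simp add: vanishing_ideal_def eval_mat_poly_conv_ev)

lemma points_iff:
  "g \<in> points \<phi> n G \<longleftrightarrow> g \<in> carrier (GL n) \<and> (\<forall>p\<in>vanishing_ideal n G. ev \<phi> (\<lambda>ij. g $$ ij) p = 0)"
  by (simp add: points_def eval_mat_poly_conv_ev)

lemma map_mat_id [simp]: "map_mat id A = A" by auto

text \<open>With \<open>H = G\<close> and \<open>a\<close> or \<open>b\<close> equal to 1 this is the invariance of the ideal under translations by
  elements of \<open>G\<close>; with \<open>a\<close> inverse to \<open>b\<close> it is transport of structure along a conjugation.\<close>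

lemma tr_vanishing:
  assumes "p \<in> vanishing_ideal n G" "a \<in> carrier_mat n n" "b \<in> carrier_mat n n"
    and "\<And>g. g \<in> H \<Longrightarrow> g \<in> carrier_mat n n \<and> a * g * b \<in> G"
  shows "tr n a b p \<in> vanishing_ideal n H"
proof -
  interpret comm_ring_hom "id :: 'a \<Rightarrow> 'a" by (rule id_hom)
  show ?thesis
    using assms by (auto simp: vanishing_ideal_iff ev_tr)
qed

section \<open>The Lie algebra of a matrix group\<close>

locale matrix_group =
  fixes n :: nat and G :: "'k::field_char_0 mat set"
  assumes G: "subgroup G (GL n)"
begin

abbreviation "I \<equiv> vanishing_ideal n G"
abbreviation "\<gg> \<equiv> lie_algebra n G"

lemma G_carrier: "g \<in> G \<Longrightarrow> g \<in> carrier_mat n n"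
  using subgroup.subset[OF G] by (auto simp: carrier_GL)

lemma G_mult: "g \<in> G \<Longrightarrow> h \<in> G \<Longrightarrow> g * h \<in> G"
  using subgroup.m_closed[OF G] by simp

lemma G_one: "1\<^sub>m n \<in> G"
  using subgroup.one_closed[OF G] by simp

lemma I_mat_polys: "p \<in> I \<Longrightarrow> p \<in> mat_polys n"
  by (simp add: vanishing_ideal_iff)

lemma I_one: "p \<in> I \<Longrightarrow> ev_one n p = 0"
  using G_one by (simp add: vanishing_ideal_iff)

lemma one_plus_eps_GL:
  assumes "X \<in> carrier_mat n n"
  shows "1\<^sub>m n + map_mat (Dual 0) X \<in> carrier (GL n)"
proof -
  let ?D = "map_mat (Dual 0) X"
  have X: "?D \<in> carrier_mat n n" using assms by simp
  have D2: "?D * ?D = 0\<^sub>m n n"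
    by (rule eq_matI) (use assms X in \<open>auto simp: scalar_prod_def dual_num_simps intro!: sum.neutral[unfolded dual_num_simps]\<close>)
  have "(1\<^sub>m n + ?D) * (1\<^sub>m n - ?D) = (1\<^sub>m n + ?D) * 1\<^sub>m n - (1\<^sub>m n + ?D) * ?D"
    using X by (intro mult_minus_distrib_mat[of _ n n _ n]) auto
  also have "(1\<^sub>m n + ?D) * ?D = 1\<^sub>m n * ?D + ?D * ?D"
    using X by (intro add_mult_distrib_mat[of _ n n _ _ n]) auto
  also have "(1\<^sub>m n + ?D) * 1\<^sub>m n - (1\<^sub>m n * ?D + ?D * ?D) = 1\<^sub>m n"
    using X unfolding D2 by (intro eq_matI) (auto simp: right_mult_one_mat[of _ n n] left_mult_one_mat[of _ n n] simp del: index_mult_mat)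
  finally have 1: "(1\<^sub>m n + ?D) * (1\<^sub>m n - ?D) = 1\<^sub>m n" .
  have "(1\<^sub>m n - ?D) * (1\<^sub>m n + ?D) = (1\<^sub>m n - ?D) * 1\<^sub>m n + (1\<^sub>m n - ?D) * ?D"
    using X by (intro mult_add_distrib_mat[of _ n n _ n]) auto
  also have "(1\<^sub>m n - ?D) * ?D = 1\<^sub>m n * ?D - ?D * ?D"
    using X by (intro minus_mult_distrib_mat[of _ n n _ _ n]) auto
  also have "(1\<^sub>m n - ?D) * 1\<^sub>m n + (1\<^sub>m n * ?D - ?D * ?D) = 1\<^sub>m n"
    using X unfolding D2 by (intro eq_matI) (auto simp: right_mult_one_mat[of _ n n] left_mult_one_mat[of _ n n] simp del: index_mult_mat)
  finally have 2: "(1\<^sub>m n - ?D) * (1\<^sub>m n + ?D) = 1\<^sub>m n" .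
  show ?thesis using X 1 2 by (auto simp: carrier_GL intro!: bexI[of _ "1\<^sub>m n - ?D"])
qed

text \<open>The value of \<open>p\<close> at \<open>1 + \<epsilon> X\<close> is \<open>\<epsilon>\<close> times the differential of \<open>p\<close> at 1 applied to \<open>X\<close>, because \<open>p\<close>
  vanishes at 1.  So the Lie algebra is the annihilator of a set of linear functionals.\<close>

lemma lie_iff:
  "X \<in> \<gg> \<longleftrightarrow> X \<in> carrier_mat n n \<and>
     (\<forall>p\<in>I. (\<Sum>ij\<in>idx n. X $$ ij * ev_one n (pd ij p)) = 0)"
proof -
  interpret comm_ring_hom "id :: 'k \<Rightarrow> 'k" by (rule id_hom)
  have "ev (\<lambda>c. Dual c 0) (\<lambda>ij. (1\<^sub>m n + map_mat (Dual 0) X) $$ ij) p = 0 \<longleftrightarrow>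
      (\<Sum>ij\<in>idx n. X $$ ij * ev_one n (pd ij p)) = 0"
    if X: "X \<in> carrier_mat n n" and p: "p \<in> I" for p
  proof -
    have *: "ev (\<lambda>c. Dual c 0) (\<lambda>ij. (1\<^sub>m n + map_mat (Dual 0) X) $$ ij) p =
       ev (\<lambda>c. Dual (id c) 0) (\<lambda>ij. Dual (1\<^sub>m n $$ ij) (X $$ ij)) p"
      using X by (subst id_apply, intro ev_cong[OF I_mat_polys[OF p]]) (auto simp: dual_num_simps)
    show ?thesis
      unfolding * using dual_eps_ev[OF I_mat_polys[OF p], of "\<lambda>ij. 1\<^sub>m n $$ ij" "\<lambda>ij. X $$ ij"]
        dual_re_ev[of id "\<lambda>ij. Dual (1\<^sub>m n $$ ij) (X $$ ij)" p] I_one[OF p]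
      by (auto simp: dual_num.expand dual_num_simps)
  qed
  thus ?thesis
    unfolding lie_algebra_def points_iff using one_plus_eps_GL by auto
qed

lemma lie_carrier: "X \<in> \<gg> \<Longrightarrow> X \<in> carrier_mat n n"
  by (simp add: lie_iff)

lemma lie_sum:
  assumes "\<And>x. x \<in> S \<Longrightarrow> F x \<in> \<gg>"
  shows "mat n n (\<lambda>ij. \<Sum>x\<in>S. c x * F x $$ ij) \<in> \<gg>"
proof -
  have "(\<Sum>ij\<in>idx n. mat n n (\<lambda>ij. \<Sum>x\<in>S. c x * F x $$ ij) $$ ij * ev_one n (pd ij p)) = 0"
    if p: "p \<in> I" for p
  proof -
    have "(\<Sum>ij\<in>idx n. mat n n (\<lambda>ij. \<Sum>x\<in>S. c x * F x $$ ij) $$ ij * ev_one n (pd ij p)) =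
      (\<Sum>ij\<in>idx n. \<Sum>x\<in>S. c x * (F x $$ ij * ev_one n (pd ij p)))"
      by (intro sum.cong refl) (auto simp: sum_distrib_right sum_distrib_left mult_ac)
    also have "\<dots> = (\<Sum>x\<in>S. c x * (\<Sum>ij\<in>idx n. F x $$ ij * ev_one n (pd ij p)))"
      by (subst sum.swap) (simp add: sum_distrib_left)
    also have "\<dots> = 0"
      using assms p by (intro sum.neutral) (auto simp: lie_iff)
    finally show ?thesis .
  qed
  thus ?thesis by (simp add: lie_iff)
qed

end

section \<open>Right-invariant vector fields\<close>

text \<open>The derivation \<open>p \<mapsto> d/d\<epsilon> p ((1 + \<epsilon> Y) x)\<close>, that is, the right-invariant vector field with value \<open>Y\<close>
  at 1.\<close>

definition lder :: "nat \<Rightarrow> 'k::comm_ring_1 mat \<Rightarrow> 'k mat_poly \<Rightarrow> 'k mat_poly" where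
  "lder n Y p = (\<Sum>ij\<in>idx n. (\<Sum>c<n. cst (Y $$ (fst ij, c)) * var (c, snd ij)) * pd ij p)"

lemma lder_add: "lder n Y (p + q) = lder n Y p + lder n Y q"
  by (simp add: lder_def pd_add distrib_left sum.distrib)

lemma lder_mult: "lder n Y (p * q) = p * lder n Y q + lder n Y p * q"
  by (simp add: lder_def pd_mult distrib_left sum.distrib sum_distrib_left sum_distrib_right mult_ac)

lemma lder_cst [simp]: "lder n Y (cst c) = 0"
  by (simp add: lder_def)

lemma lder_0 [simp]: "lder n Y 0 = 0"
  using lder_cst[of n Y 0] by simp

lemma lder_cst_mult: "lder n Y (cst c * p) = cst c * lder n Y p"
  by (simp add: lder_mult)

lemma lder_sum: "lder n Y (sum f S) = (\<Sum>x\<in>S. lder n Y (f x))"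
  by (induction S rule: infinite_finite_induct) (simp_all add: lder_add)

lemma lder_var: "i < n \<Longrightarrow> j < n \<Longrightarrow> lder n Y (var (i, j)) = (\<Sum>c<n. cst (Y $$ (i, c)) * var (c, j))"
proof -
  assume ij: "i < n" "j < n"
  have "lder n Y (var (i, j)) = (\<Sum>kl\<in>idx n. if (i, j) = kl then (\<Sum>c<n. cst (Y $$ (i, c)) * var (c, j)) else 0)"
    unfolding lder_def by (intro sum.cong) auto
  also have "\<dots> = (\<Sum>c<n. cst (Y $$ (i, c)) * var (c, j))"
    using ij by (simp add: eq_commute[of "(i, j)"] sum.delta del: sum.cartesian_product)
  finally show ?thesis .
qed

lemma lder_in_mat_polys [intro]: "p \<in> mat_polys n \<Longrightarrow> lder n Y p \<in> mat_polys n"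
  unfolding lder_def by (intro mat_polys_sum mat_polys_closed pd_in_mat_polys) auto

lemma (in comm_ring_hom) ev_lder:
  "ev hom v (lder n Y p) = (\<Sum>ij\<in>idx n. (\<Sum>c<n. hom (Y $$ (fst ij, c)) * v (c, snd ij)) * ev hom v (pd ij p))"
  by (simp add: lder_def ev_sum ev_mult)

lemma ev_one_lder:
  fixes Y :: "'k::comm_ring_1 mat"
  assumes "Y \<in> carrier_mat n n"
  shows "ev_one n (lder n Y p) =
    (\<Sum>ij\<in>idx n. Y $$ ij * ev_one n (pd ij p))"
proof -
  interpret comm_ring_hom "id :: 'k \<Rightarrow> 'k" by (rule id_hom)
  have *: "(\<Sum>c<n. id (Y $$ (fst ij, c)) * 1\<^sub>m n $$ (c, snd ij)) = Y $$ ij"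
    if "ij \<in> idx n" for ij
    using that index_mult_mat_sum[OF assms one_carrier_mat, of "fst ij" "snd ij"] assms
    by (auto simp: right_mult_one_mat[of _ n n] simp del: index_mult_mat)
  show ?thesis
    by (rule trans[OF ev_lder], rule sum.cong) (simp_all only: *)
qed

text \<open>Both sides are the coefficient of \<open>\<epsilon>\<close> in \<open>p (P (1 + \<epsilon> X) Q)\<close>.\<close>

lemma ev_one_lder_tr:
  fixes X P Q :: "'k::comm_ring_1 mat"
  assumes p: "p \<in> mat_polys n" and X: "X \<in> carrier_mat n n" and P: "P \<in> carrier_mat n n" and Q: "Q \<in> carrier_mat n n"
  shows "ev_one n (lder n X (tr n P Q p)) =
    (\<Sum>ij\<in>idx n. (P * X * Q) $$ ij * ev id (\<lambda>ij. (P * Q) $$ ij) (pd ij p))"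
proof -
  interpret I: comm_ring_hom "id :: 'k \<Rightarrow> 'k" by (rule id_hom)
  interpret D: comm_ring_hom "\<lambda>c::'k. Dual (id c) 0" by (rule I.Dual_comm_ring_hom)
  have ds: "dual_eps (sum f S) = (\<Sum>x\<in>S. dual_eps (f x))" "dual_re (sum f S) = (\<Sum>x\<in>S. dual_re (f x))" for f :: "nat \<Rightarrow> 'k dual_num" and S
    by (induction S rule: infinite_finite_induct) (auto simp: dual_num_simps)
  define M where "M = mat n n (\<lambda>ij. Dual (1\<^sub>m n $$ ij) (X $$ ij))"
  have M: "M \<in> carrier_mat n n" by (simp add: M_def)
  have "ev_one n (lder n X (tr n P Q p)) = dual_eps (ev (\<lambda>c. Dual (id c) 0) (\<lambda>ij. Dual (1\<^sub>m n $$ ij) (X $$ ij)) (tr n P Q p))"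
    unfolding ev_one_lder[OF X] by (rule I.dual_eps_ev[symmetric, OF tr_in_mat_polys[OF p]])
  also have "ev (\<lambda>c. Dual (id c) 0) (\<lambda>ij. Dual (1\<^sub>m n $$ ij) (X $$ ij)) (tr n P Q p) = ev (\<lambda>c. Dual (id c) 0) (\<lambda>ij. M $$ ij) (tr n P Q p)"
    by (rule ev_cong[OF tr_in_mat_polys[OF p]]) (auto simp: M_def)
  also have "\<dots> = ev (\<lambda>c. Dual (id c) 0) (\<lambda>ij. (map_mat (\<lambda>c. Dual (id c) 0) P * M * map_mat (\<lambda>c. Dual (id c) 0) Q) $$ ij) p"
    by (rule D.ev_tr[OF p P Q M])
  also have "\<dots> = ev (\<lambda>c. Dual (id c) 0) (\<lambda>ij. Dual ((P * Q) $$ ij) ((P * X * Q) $$ ij)) p"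
  proof (rule ev_cong[OF p])
    fix ij :: "nat \<times> nat" assume "ij \<in> idx n"
    then obtain i j where ij[simp]: "ij = (i, j)" and ij': "i < n" "j < n" by auto
    let ?P = "map_mat (\<lambda>c. Dual (id c) 0) P" and ?Q = "map_mat (\<lambda>c. Dual (id c) 0) Q"
    have PM: "(?P * M) $$ (i, d) = Dual (P $$ (i, d)) ((P * X) $$ (i, d))" if d: "d < n" for d
    proof -
      have Pc: "?P \<in> carrier_mat n n" using P by simp
      have "(?P * M) $$ (i, d) = (\<Sum>c<n. Dual (P $$ (i, c)) 0 * Dual (1\<^sub>m n $$ (c, d)) (X $$ (c, d)))"
        unfolding index_mult_mat_sum[OF Pc M ij'(1) d] using ij' d P by (intro sum.cong refl) (auto simp: M_def)
      also have "\<dots> = Dual (\<Sum>c<n. P $$ (i, c) * 1\<^sub>m n $$ (c, d)) (\<Sum>c<n. P $$ (i, c) * X $$ (c, d))"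
        by (rule dual_num.expand) (simp add: ds dual_num_simps)
      also have "\<dots> = Dual ((P * 1\<^sub>m n) $$ (i, d)) ((P * X) $$ (i, d))"
        using index_mult_mat_sum[OF P one_carrier_mat ij'(1) d] index_mult_mat_sum[OF P X ij'(1) d] by (simp only:)
      finally show ?thesis using P by (simp add: right_mult_one_mat[of _ n n])
    qed
    have PMc: "?P * M \<in> carrier_mat n n" "?Q \<in> carrier_mat n n" "P * X \<in> carrier_mat n n" using P Q X M by auto
    have "(?P * M * ?Q) $$ (i, j) = (\<Sum>d<n. Dual (P $$ (i, d)) ((P * X) $$ (i, d)) * Dual (Q $$ (d, j)) 0)"
      unfolding index_mult_mat_sum[OF PMc(1,2) ij'] using Q ij' PM by (intro sum.cong refl) auto
    also have "\<dots> = Dual (\<Sum>d<n. P $$ (i, d) * Q $$ (d, j)) (\<Sum>d<n. (P * X) $$ (i, d) * Q $$ (d, j))"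
      by (rule dual_num.expand) (simp add: ds dual_num_simps)
    also have "\<dots> = Dual ((P * Q) $$ (i, j)) ((P * X * Q) $$ (i, j))"
      using index_mult_mat_sum[OF P Q ij'] index_mult_mat_sum[OF PMc(3) Q ij'] by (simp only:)
    finally show "(?P * M * ?Q) $$ ij = Dual ((P * Q) $$ ij) ((P * X * Q) $$ ij)"
      by (simp only: ij)
  qed
  also have "dual_eps \<dots> = (\<Sum>ij\<in>idx n. (P * X * Q) $$ ij * ev id (\<lambda>ij. (P * Q) $$ ij) (pd ij p))"
    by (rule I.dual_eps_ev[OF p])
  finally show ?thesis .
qed

lemma ev_one_lder_conjugate:
  fixes X P Q :: "'k::comm_ring_1 mat"
  assumes p: "p \<in> mat_polys n" and X: "X \<in> carrier_mat n n" and P: "P \<in> carrier_mat n n" and Q: "Q \<in> carrier_mat n n"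
    and PQ: "P * Q = 1\<^sub>m n"
  shows "ev_one n (lder n X (tr n P Q p)) = ev_one n (lder n (P * X * Q) p)"
  unfolding ev_one_lder_tr[OF p X P Q] PQ
  using P X Q by (intro ev_one_lder[symmetric] mult_carrier_mat)

text \<open>Both sides differ by a derivation, which vanishes on the variables; the order is reversed because
  \<open>lder Y\<close> multiplies the generic matrix by \<open>Y\<close> from the left.\<close>

lemma lder_commutator:
  fixes X Y :: "'k::comm_ring_1 mat"
  assumes "p \<in> mat_polys n" "X \<in> carrier_mat n n" "Y \<in> carrier_mat n n"
  shows "lder n X (lder n Y p) = lder n Y (lder n X p) + lder n (Y * X - X * Y) p"
  using assms(1)
proof (induction p rule: mat_polys_induct)
  case (var ij)
  then obtain i j where [simp]: "ij = (i, j)" "i < n" "j < n" by auto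
  have *: "(\<Sum>c<n. cst (A $$ (i, c)) * (\<Sum>d<n. cst (B $$ (c, d)) * var (d, j))) =
      (\<Sum>d<n. cst ((A * B) $$ (i, d)) * var (d, j))"
    if "A \<in> carrier_mat n n" "B \<in> carrier_mat n n" for A B :: "'k mat"
  proof -
    interpret comm_ring_hom "cst :: 'k \<Rightarrow> 'k mat_poly" by (rule cst_comm_ring_hom)
    have "(\<Sum>c<n. cst (A $$ (i, c)) * (\<Sum>d<n. cst (B $$ (c, d)) * var (d, j))) =
        (\<Sum>d<n. \<Sum>c<n. cst (A $$ (i, c)) * cst (B $$ (c, d)) * var (d, j))"
      by (subst sum.swap) (simp add: sum_distrib_left mult_ac)
    also have "\<dots> = (\<Sum>d<n. (\<Sum>c<n. cst (A $$ (i, c) * B $$ (c, d))) * var (d, j))"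
      by (simp add: mult_single sum_distrib_right)
    also have "\<dots> = (\<Sum>d<n. cst ((A * B) $$ (i, d)) * var (d, j))"
      by (intro sum.cong refl) (simp add: index_mult_mat_sum[OF that] hom_sum)
    finally show ?thesis .
  qed
  have "lder n X (lder n Y (var ij)) = (\<Sum>d<n. cst ((Y * X) $$ (i, d)) * var (d, j))"
    by (simp add: lder_var lder_sum lder_cst_mult *[OF assms(3,2)])
  moreover have "lder n Y (lder n X (var ij)) = (\<Sum>d<n. cst ((X * Y) $$ (i, d)) * var (d, j))"
    by (simp add: lder_var lder_sum lder_cst_mult *[OF assms(2,3)])
  moreover have "lder n (Y * X - X * Y) (var ij) =
      (\<Sum>d<n. cst ((Y * X) $$ (i, d)) * var (d, j)) - (\<Sum>d<n. cst ((X * Y) $$ (i, d)) * var (d, j))"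
    using assms by (simp add: lder_var single_diff left_diff_distrib sum_subtractf)
  ultimately show ?case by simp
qed (simp_all add: lder_add lder_mult algebra_simps)

context matrix_group
begin

text \<open>At a point \<open>g\<close> of \<open>G\<close>, the derivative of \<open>p\<close> in the direction \<open>Y g\<close> is the derivative at 1 in the
  direction \<open>Y\<close> of the right translate of \<open>p\<close> by \<open>g\<close>, which vanishes on \<open>G\<close> as well.\<close>

lemma lder_vanishing:
  assumes Y: "Y \<in> \<gg>" and p: "p \<in> I"
  shows "lder n Y p \<in> I"
proof -
  interpret comm_ring_hom "id :: 'k \<Rightarrow> 'k" by (rule id_hom)
  note Yc = lie_carrier[OF Y]
  have "ev id (\<lambda>ij. g $$ ij) (lder n Y p) = 0" if g: "g \<in> G" for g
  proof -
    note gc = G_carrier[OF g]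
    define q where "q = tr n (1\<^sub>m n) g p"
    have q: "q \<in> I"
      unfolding q_def by (rule tr_vanishing[OF p]) (use gc G_carrier G_mult[OF _ g] in \<open>auto simp: left_mult_one_mat[OF G_carrier]\<close>)
    have "0 = (\<Sum>ij\<in>idx n. Y $$ ij * ev_one n (pd ij q))"
      using Y q by (simp add: lie_iff)
    also have "\<dots> = ev_one n (lder n Y q)"
      by (rule ev_one_lder[OF Yc, symmetric])
    also have "\<dots> = (\<Sum>ij\<in>idx n. (1\<^sub>m n * Y * g) $$ ij * ev id (\<lambda>ij. (1\<^sub>m n * g) $$ ij) (pd ij p))"
      unfolding q_def by (rule ev_one_lder_tr[OF I_mat_polys[OF p] Yc one_carrier_mat gc])
    also have "1\<^sub>m n * Y * g = Y * g" using Yc by simp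
    also have "1\<^sub>m n * g = g" using gc by simp
    also have "(\<Sum>ij\<in>idx n. (Y * g) $$ ij * ev id (\<lambda>ij. g $$ ij) (pd ij p)) =
        (\<Sum>ij\<in>idx n. (\<Sum>c<n. id (Y $$ (fst ij, c)) * g $$ (c, snd ij)) * ev id (\<lambda>ij. g $$ ij) (pd ij p))"
      by (intro sum.cong refl) (auto simp: index_mult_mat_sum[OF Yc gc] simp del: index_mult_mat)
    also have "\<dots> = ev id (\<lambda>ij. g $$ ij) (lder n Y p)" by (rule ev_lder[symmetric])
    finally show ?thesis by (rule sym)
  qed
  with p show ?thesis by (auto simp: vanishing_ideal_iff)
qed

lemma lie_iff_lder:
  "X \<in> \<gg> \<longleftrightarrow> X \<in> carrier_mat n n \<and> (\<forall>p\<in>I. ev_one n (lder n X p) = 0)"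
  by (auto simp: lie_iff ev_one_lder)

lemma I_add: "p \<in> I \<Longrightarrow> q \<in> I \<Longrightarrow> p + q \<in> I"
  and I_mult: "p \<in> I \<Longrightarrow> r \<in> mat_polys n \<Longrightarrow> r * p \<in> I"
  and I_0: "0 \<in> I"
proof -
  interpret comm_ring_hom "id :: 'k \<Rightarrow> 'k" by (rule id_hom)
  show "p \<in> I \<Longrightarrow> q \<in> I \<Longrightarrow> p + q \<in> I" "p \<in> I \<Longrightarrow> r \<in> mat_polys n \<Longrightarrow> r * p \<in> I" "0 \<in> I"
    by (auto simp: vanishing_ideal_iff ev_add ev_mult)
qed

text \<open>Evaluate \<open>lder_commutator\<close> at 1: the double derivatives belong to the ideal.\<close>

lemma lie_bracket:
  assumes "X \<in> \<gg>" "Y \<in> \<gg>" shows "X * Y - Y * X \<in> \<gg>"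
proof -
  interpret comm_ring_hom "id :: 'k \<Rightarrow> 'k" by (rule id_hom)
  have c: "X \<in> carrier_mat n n" "Y \<in> carrier_mat n n" using assms lie_carrier by auto
  have "ev_one n (lder n (X * Y - Y * X) p) = 0" if p: "p \<in> I" for p
    using arg_cong[OF lder_commutator[OF I_mat_polys[OF p] c(2,1)], of "ev_one n"]
      assms p by (simp add: ev_add I_one lder_vanishing)
  moreover have "X * Y - Y * X \<in> carrier_mat n n" using c by (intro minus_carrier_mat mult_carrier_mat)
  ultimately show ?thesis by (simp add: lie_iff_lder)
qed

end

section \<open>Products of points over Laurent series\<close>

text \<open>The Cauchy product over any range that contains the supports; a range common to several products
  permits interchanging sums.\<close>

lemma fls_times_nth_range:
  fixes f g :: "'a::comm_ring_1 fls"
  assumes "a \<le> fls_subdegree f" "N - fls_subdegree g \<le> b"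
  shows "fls_nth (f * g) N = (\<Sum>i=a..b. fls_nth f i * fls_nth g (N - i))"
  unfolding fls_times_nth(2)
proof (rule sum.mono_neutral_left)
  show "\<forall>i\<in>{a..b} - {fls_subdegree f..N - fls_subdegree g}. fls_nth f i * fls_nth g (N - i) = 0"
  proof
    fix i assume i: "i \<in> {a..b} - {fls_subdegree f..N - fls_subdegree g}"
    show "fls_nth f i * fls_nth g (N - i) = 0"
    proof (cases "i < fls_subdegree f")
      case False
      hence "N - i < fls_subdegree g" using i by auto
      thus ?thesis by simp
    qed simp
  qed
qed (use assms in auto)

lemma fls_const_comm_ring_hom: "comm_ring_hom (fls_const :: 'a::comm_ring_1 \<Rightarrow> 'a fls)"
  by unfold_locales (simp_all add: fls_const_mult_const fls_plus_const)

lemma fls_nth_sum: "fls_nth (sum f A) i = (\<Sum>x\<in>A. fls_nth (f x) i)"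
  by (induction A rule: infinite_finite_induct) simp_all

context matrix_group
begin

text \<open>For \<open>y\<close> in \<open>G(K)\<close>, the polynomial \<open>x \<mapsto> p (x y)\<close> over \<open>K\<close> vanishes at all \<open>x\<close> in \<open>G\<close>, since \<open>p (g x)\<close> lies
  in the ideal for \<open>g\<close> in \<open>G\<close>.  Its coefficients are Laurent series; taking their coefficients of \<open>z\<^sup>i\<close>
  gives a polynomial over \<open>k\<close> that still vanishes on \<open>G\<close>, hence at the points of \<open>G(K)\<close>.  Summing
  over \<open>i\<close> gives \<open>p (x y) = 0\<close>.\<close>

lemma loop_group_mult:
  assumes x: "x \<in> loop_group n G" and y: "y \<in> loop_group n G"
  shows "x * y \<in> loop_group n G"
proof -
  interpret C: comm_ring_hom "fls_const :: 'k \<Rightarrow> 'k fls" by (rule fls_const_comm_ring_hom)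
  interpret I: comm_ring_hom "id :: 'k \<Rightarrow> 'k" by (rule id_hom)
  interpret J: comm_ring_hom "id :: 'k fls \<Rightarrow> 'k fls" by (rule id_hom)
  have xc: "x \<in> carrier_mat n n" and yc: "y \<in> carrier_mat n n"
    using x y by (auto simp: points_iff carrier_GL)
  have "ev fls_const (\<lambda>ij. (x * y) $$ ij) p = 0" if p: "p \<in> I" for p
  proof -
    define q :: "'k fls mat_poly" where
      "q = ev (\<lambda>c. cst (fls_const c)) (\<lambda>ij. \<Sum>c<n. var (fst ij, c) * cst (y $$ (c, snd ij))) p"
    have q_poly: "q \<in> mat_polys n"
      unfolding q_def by (rule ev_in_closed[OF I_mat_polys[OF p]]) (auto intro!: mat_polys_sum mat_polys_closed)
    have ev_q: "ev id (\<lambda>ij. w $$ ij) q = ev fls_const (\<lambda>ij. (w * y) $$ ij) p"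
      if w: "w \<in> carrier_mat n n" for w
    proof -
      interpret E: comm_ring_hom "ev id (\<lambda>ij. w $$ ij)" by (rule J.ev_comm_ring_hom)
      have "ev id (\<lambda>ij. w $$ ij) q = ev fls_const (\<lambda>ij. \<Sum>c<n. w $$ (fst ij, c) * y $$ (c, snd ij)) p"
        unfolding q_def E.hom_ev by (simp add: E.hom_sum E.hom_mult)
      also have "\<dots> = ev fls_const (\<lambda>ij. (w * y) $$ ij) p"
        by (rule ev_cong[OF I_mat_polys[OF p]]) (auto simp: index_mult_mat_sum[OF w yc] simp del: index_mult_mat)
      finally show ?thesis .
    qed
    \<comment> \<open>the coefficient of \<open>z\<^sup>i\<close> in \<open>x \<mapsto> p (x y)\<close>\<close>
    define qc :: "int \<Rightarrow> 'k mat_poly" where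
      "qc i = (\<Sum>t\<in>keys q. single t (fls_nth (lookup q t) i))" for i
    have qc_I: "qc i \<in> I" for i
    proof -
      have "qc i \<in> mat_polys n"
        unfolding qc_def using q_poly by (intro mat_polys_sum) (auto simp: mat_polys_def)
      moreover have "ev id (\<lambda>ij. g $$ ij) (qc i) = 0" if g: "g \<in> G" for g
      proof -
        have "monval (\<lambda>ij. fls_const (g $$ ij)) t = fls_const (monval (\<lambda>ij. g $$ ij) t)" for t
          by (simp add: monval_def C.hom_prod C.hom_power)
        hence "ev id (\<lambda>ij. fls_const (g $$ ij)) q = (\<Sum>t\<in>keys q. lookup q t * fls_const (monval (\<lambda>ij. g $$ ij) t))"
          by (simp add: ev_def)
        hence "ev id (\<lambda>ij. g $$ ij) (qc i) = fls_nth (ev id (\<lambda>ij. fls_const (g $$ ij)) q) i"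
          by (simp add: qc_def I.ev_sum fls_nth_sum)
        also have "ev id (\<lambda>ij. fls_const (g $$ ij)) q = ev id (\<lambda>ij. map_mat fls_const g $$ ij) q"
          by (rule ev_cong[OF q_poly]) (use G_carrier[OF g] in auto)
        also have "\<dots> = ev fls_const (\<lambda>ij. (map_mat fls_const g * y) $$ ij) p"
          by (rule ev_q) (use G_carrier[OF g] in auto)
        also have "\<dots> = ev fls_const (\<lambda>ij. (map_mat fls_const g * y * map_mat fls_const (1\<^sub>m n)) $$ ij) p"
          using G_carrier[OF g] yc by (simp add: C.mat_hom_one right_mult_one_mat[of _ n n])
        also have "\<dots> = ev fls_const (\<lambda>ij. y $$ ij) (tr n g (1\<^sub>m n) p)"
          by (rule C.ev_tr[symmetric, OF I_mat_polys[OF p] G_carrier[OF g] one_carrier_mat yc])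
        also have "\<dots> = 0"
        proof -
          have "tr n g (1\<^sub>m n) p \<in> I"
            by (rule tr_vanishing[OF p G_carrier[OF g] one_carrier_mat])
               (use G_carrier G_mult[OF g] in \<open>auto simp: right_mult_one_mat[of _ n n]  right_mult_one_mat[OF mult_carrier_mat[OF G_carrier[OF g]]]\<close>)
          thus ?thesis using y by (simp add: points_iff)
        qed
        finally show ?thesis by (rule trans) simp
      qed
      ultimately show ?thesis by (simp add: vanishing_ideal_iff)
    qed
    have "fls_nth (ev id (\<lambda>ij. x $$ ij) q) N = 0" for N
    proof -
      let ?K = "keys q" and ?m = "monval (\<lambda>ij. x $$ ij)"
      define a where "a = Min (insert 0 ((\<lambda>t. fls_subdegree (lookup q t)) ` ?K))"
      define b where "b = Max (insert 0 ((\<lambda>t. N - fls_subdegree (?m t)) ` ?K))"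
      have "fls_nth (ev id (\<lambda>ij. x $$ ij) q) N = (\<Sum>t\<in>?K. fls_nth (lookup q t * ?m t) N)"
        by (simp add: ev_def fls_nth_sum)
      also have "\<dots> = (\<Sum>t\<in>?K. \<Sum>i=a..b. fls_nth (lookup q t) i * fls_nth (?m t) (N - i))"
        by (intro sum.cong refl fls_times_nth_range) (auto simp: a_def b_def)
      also have "\<dots> = (\<Sum>i=a..b. fls_nth (ev fls_const (\<lambda>ij. x $$ ij) (qc i)) (N - i))"
        by (subst sum.swap) (simp add: qc_def C.ev_sum fls_nth_sum)
      also have "\<dots> = 0"
        using x qc_I by (simp add: points_iff)
      finally show ?thesis .
    qed
    hence "ev id (\<lambda>ij. x $$ ij) q = 0" by (intro fls_eqI) simp
    thus ?thesis using ev_q[OF xc] by simp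
  qed
  with x y show ?thesis by (auto simp: points_iff GL_mult_closed)
qed

end

section \<open>Formal differential equations in the group\<close>

definition theta :: "'a::comm_ring_1 fps \<Rightarrow> 'a fps" where
  "theta f = fps_X * fps_deriv f"

lemma theta_nth: "fps_nth (theta f) N = of_nat N * fps_nth f N"
  by (cases N) (simp_all add: theta_def)

lemma theta_add: "theta (f + g) = theta f + theta g"
  and theta_mult: "theta (f * g) = theta f * g + f * theta g"
  by (simp_all add: theta_def algebra_simps)

lemma fps_const_comm_ring_hom: "comm_ring_hom (fps_const :: 'a::comm_ring_1 \<Rightarrow> 'a fps)"
  by unfold_locales simp_all

lemma fps_to_fls_comm_ring_hom: "comm_ring_hom (fps_to_fls :: 'a::comm_ring_1 fps \<Rightarrow> 'a fls)"
  by unfold_locales (simp_all add: fls_times_fps_to_fls)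

lemma fps_nth_0_comm_ring_hom: "comm_ring_hom (\<lambda>f :: 'a::comm_ring_1 fps. fps_nth f 0)"
  by unfold_locales simp_all

abbreviation cf :: "nat \<Rightarrow> 'a::zero fps mat \<Rightarrow> 'a mat" where
  "cf i A \<equiv> map_mat (\<lambda>f. fps_nth f i) A"

lemma map_mat_derivation:
  fixes A B :: "'r::comm_ring_1 mat"
  assumes "A \<in> carrier_mat n n" "B \<in> carrier_mat n n"
    and d: "\<And>x y. D (x + y) = D x + D y" "\<And>x y. D (x * y) = D x * y + x * D y"
  shows "map_mat D (A * B) = map_mat D A * B + A * map_mat D B"
proof (rule eq_matI)
  have D0: "D 0 = 0" using d(1)[of 0 0] by simp
  have D_sum: "D (sum f S) = (\<Sum>x\<in>S. D (f x))" for f :: "nat \<Rightarrow> 'r" and S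
    by (induction S rule: infinite_finite_induct) (simp_all add: D0 d)
  fix i j assume ij: "i < dim_row (map_mat D A * B + A * map_mat D B)" "j < dim_col (map_mat D A * B + A * map_mat D B)"
  hence [simp]: "i < n" "j < n" using assms by auto
  have "map_mat D (A * B) $$ (i, j) = D ((A * B) $$ (i, j))"
    using assms by simp
  also have "\<dots> = (\<Sum>c<n. D (A $$ (i, c)) * B $$ (c, j)) + (\<Sum>c<n. A $$ (i, c) * D (B $$ (c, j)))"
    using assms by (simp add: index_mult_mat_sum[of _ n n _ n] D_sum d sum.distrib del: index_mult_mat)
  also have "\<dots> = (map_mat D A * B + A * map_mat D B) $$ (i, j)"
    using assms by (auto simp add: index_mult_mat_sum[of _ n n _ n] simp del: index_mult_mat(1))
  finally show "map_mat D (A * B) $$ (i, j) = (map_mat D A * B + A * map_mat D B) $$ (i, j)" .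
qed (use assms in auto)

lemma cf_mult_entry:
  assumes "A \<in> carrier_mat n n" "B \<in> carrier_mat n n" "i < n" "j < n"
  shows "fps_nth ((A * B) $$ (i, j)) N = (\<Sum>m\<le>N. (cf m A * cf (N - m) B) $$ (i, j))"
proof -
  have "fps_nth ((A * B) $$ (i, j)) N = (\<Sum>c<n. \<Sum>m\<le>N. fps_nth (A $$ (i, c)) m * fps_nth (B $$ (c, j)) (N - m))"
    using assms by (simp add: index_mult_mat_sum[of _ n n _ n] fps_sum_nth fps_mult_nth atLeast0AtMost del: index_mult_mat)
  also have "\<dots> = (\<Sum>m\<le>N. \<Sum>c<n. fps_nth (A $$ (i, c)) m * fps_nth (B $$ (c, j)) (N - m))"
    by (rule sum.swap)
  also have "\<dots> = (\<Sum>m\<le>N. (cf m A * cf (N - m) B) $$ (i, j))"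
    using assms by (intro sum.cong refl, subst index_mult_mat_sum[of _ n n _ n]) auto
  finally show ?thesis .
qed

text \<open>The determinant has constant term 1, so it is a unit and Cramer's rule applies over the power series.\<close>

lemma fps_mat_invertible:
  fixes g :: "'a::field fps mat"
  assumes g: "g \<in> carrier_mat n n" and g0: "cf 0 g = 1\<^sub>m n"
  shows "\<exists>h\<in>carrier_mat n n. g * h = 1\<^sub>m n \<and> h * g = 1\<^sub>m n \<and> cf 0 h = 1\<^sub>m n"
proof -
  interpret Z: comm_ring_hom "\<lambda>f :: 'a fps. fps_nth f 0" by (rule fps_nth_0_comm_ring_hom)
  have "fps_nth (det g) 0 = det (cf 0 g)" by (simp add: Z.hom_det)
  hence d: "fps_nth (det g) 0 = 1" using g0 by simp
  have inv: "inverse (det g) * det g = 1"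
    by (rule inverse_mult_eq_1) (use d in simp)
  define h where "h = inverse (det g) \<cdot>\<^sub>m adj_mat g"
  note adj = adj_mat[OF g]
  have h: "h \<in> carrier_mat n n" using adj by (simp add: h_def)
  have gh: "g * h = 1\<^sub>m n"
    unfolding h_def using adj g inv by (subst mult_smult_distrib[of _ n n _ n]) (auto intro!: eq_matI)
  have hg: "h * g = 1\<^sub>m n"
    unfolding h_def using adj g inv by (subst mult_smult_assoc_mat[of _ n n _ n]) (auto intro!: eq_matI)
  have "cf 0 (g * h) = cf 0 g * cf 0 h"
    by (rule Z.mat_hom_mult[OF g h])
  hence "cf 0 h = 1\<^sub>m n" using gh g0 h by (simp add: Z.mat_hom_one left_mult_one_mat[of _ n n])
  with h gh hg show ?thesis by blast
qed

text \<open>The coefficient of \<open>z\<^sup>N\<close> in the solution of \<open>theta g = Y g\<close> with \<open>g(0) = 1\<close>: for \<open>Y(0) = 0\<close> the equation reads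
  \<open>N g\<^sub>N = Y\<^sub>1 g\<^sub>N\<^sub>-\<^sub>1 + \<dots> + Y\<^sub>N g\<^sub>0\<close>, which determines \<open>g\<^sub>N\<close> in characteristic zero.\<close>

function ode_coeff :: "nat \<Rightarrow> (nat \<Rightarrow> nat \<Rightarrow> nat \<Rightarrow> 'k) \<Rightarrow> nat \<Rightarrow> nat \<Rightarrow> nat \<Rightarrow> 'k::field_char_0" where
  "ode_coeff n Y N i j = (if N = 0 then (if i = j then 1 else 0) else
     (\<Sum>m\<in>{1..N}. \<Sum>c<n. Y m i c * ode_coeff n Y (N - m) c j) / of_nat N)"
  by auto
termination by (relation "measure (\<lambda>(n, Y, N, i, j). N)") auto

declare ode_coeff.simps [simp del]

lemma ode_solution:
  fixes Y :: "'k::field_char_0 fps mat"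
  assumes Y: "Y \<in> carrier_mat n n" and Y0: "cf 0 Y = 0\<^sub>m n n"
  obtains g where "g \<in> carrier_mat n n" "cf 0 g = 1\<^sub>m n" "map_mat theta g = Y * g"
proof -
  define g where "g = mat n n (\<lambda>(i, j). Abs_fps (\<lambda>N. ode_coeff n (\<lambda>m i c. fps_nth (Y $$ (i, c)) m) N i j))"
  have g: "g \<in> carrier_mat n n" by (simp add: g_def)
  have Y0': "fps_nth (Y $$ (i, c)) 0 = 0" if "i < n" "c < n" for i c
    using arg_cong[OF Y0, of "\<lambda>M. M $$ (i, c)"] Y that by simp
  show ?thesis
  proof (rule that[OF g])
    show "cf 0 g = 1\<^sub>m n"
      by (rule eq_matI) (auto simp: g_def ode_coeff.simps)
    show "map_mat theta g = Y * g"
    proof (rule eq_mat_square)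
      fix i j assume ij: "i < n" "j < n"
      have "fps_nth (theta (g $$ (i, j))) N = fps_nth ((Y * g) $$ (i, j)) N" for N
      proof -
        have "fps_nth ((Y * g) $$ (i, j)) N =
           (\<Sum>c<n. \<Sum>m\<le>N. fps_nth (Y $$ (i, c)) m * fps_nth (g $$ (c, j)) (N - m))"
          using Y g ij by (simp add: index_mult_mat_sum[of _ n n _ n] fps_sum_nth fps_mult_nth atLeast0AtMost del: index_mult_mat)
        also have "\<dots> = (\<Sum>m\<le>N. \<Sum>c<n. fps_nth (Y $$ (i, c)) m * fps_nth (g $$ (c, j)) (N - m))"
          by (rule sum.swap)
        also have "\<dots> = (\<Sum>m\<in>{1..N}. \<Sum>c<n. fps_nth (Y $$ (i, c)) m * fps_nth (g $$ (c, j)) (N - m))"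
        proof (rule sum.mono_neutral_right)
          show "\<forall>m\<in>{..N} - {1..N}. (\<Sum>c<n. fps_nth (Y $$ (i, c)) m * fps_nth (g $$ (c, j)) (N - m)) = 0"
          proof
            fix m assume "m \<in> {..N} - {1..N}"
            hence "m = 0" by auto
            thus "(\<Sum>c<n. fps_nth (Y $$ (i, c)) m * fps_nth (g $$ (c, j)) (N - m)) = 0"
              using Y0' ij by (intro sum.neutral) auto
          qed
        qed auto
        also have "\<dots> = of_nat N * fps_nth (g $$ (i, j)) N"
          using ij by (subst (2) g_def, simp, subst ode_coeff.simps) (auto simp: g_def)
        finally show ?thesis by (simp add: theta_nth)
      qed
      thus "map_mat theta g $$ (i, j) = (Y * g) $$ (i, j)"
        using g ij by (simp add: fps_ext del: index_mult_mat)
    qed (use Y g in auto)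
  qed
qed

text \<open>This homomorphism turns the chain rule for \<open>theta (p (g))\<close> into an instance of \<open>hom_ev\<close>.\<close>

lemma Dual_theta_comm_ring_hom: "comm_ring_hom (\<lambda>f :: 'a::comm_ring_1 fps. Dual f (theta f))"
  by unfold_locales (simp_all add: dual_num_simps theta_add theta_mult, simp_all add: theta_def)

context matrix_group
begin

text \<open>\<open>Y\<close> is the logarithmic derivative of \<open>g\<close> and \<open>h\<close> is the inverse of \<open>g\<close>.  The condition \<open>Y(0) = 0\<close> makes the
  equation free of resonances, so that \<open>g\<close> is determined by \<open>Y\<close>.\<close>

definition flow :: "'k fps mat \<Rightarrow> 'k fps mat \<Rightarrow> 'k fps mat \<Rightarrow> bool" where
  "flow Y g h \<longleftrightarrow> Y \<in> carrier_mat n n \<and> g \<in> carrier_mat n n \<and> h \<in> carrier_mat n n \<and>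
     cf 0 Y = 0\<^sub>m n n \<and> (\<forall>m. cf m Y \<in> \<gg>) \<and> cf 0 g = 1\<^sub>m n \<and> cf 0 h = 1\<^sub>m n \<and>
     g * h = 1\<^sub>m n \<and> h * g = 1\<^sub>m n \<and> map_mat theta g = Y * g"

lemma flowD:
  assumes "flow Y g h"
  shows "Y \<in> carrier_mat n n" "g \<in> carrier_mat n n" "h \<in> carrier_mat n n"
    "cf 0 Y = 0\<^sub>m n n" "\<And>m. cf m Y \<in> \<gg>" "cf 0 g = 1\<^sub>m n" "cf 0 h = 1\<^sub>m n"
    "g * h = 1\<^sub>m n" "h * g = 1\<^sub>m n" "map_mat theta g = Y * g"
  using assms by (auto simp: flow_def)

lemma ex_flow:
  assumes "Y \<in> carrier_mat n n" "cf 0 Y = 0\<^sub>m n n" "\<And>m. cf m Y \<in> \<gg>"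
  shows "\<exists>g h. flow Y g h"
proof -
  from ode_solution[OF assms(1,2)] obtain g where g: "g \<in> carrier_mat n n" "cf 0 g = 1\<^sub>m n" "map_mat theta g = Y * g" .
  from fps_mat_invertible[OF g(1,2)] g assms show ?thesis unfolding flow_def by blast
qed

text \<open>By the chain rule \<open>theta (p (g)) = \<Sum> z\<^sup>m (lder Y\<^sub>m p) (g)\<close>, where \<open>m \<ge> 1\<close> and \<open>lder Y\<^sub>m p\<close> lies again in the
  ideal.  The coefficient of \<open>z\<^sup>N\<close> in \<open>p (g)\<close> is therefore a combination of lower coefficients of such
  series, and the constant term is \<open>p (1) = 0\<close>.\<close>

lemma flow_in_group:
  assumes flow: "flow Y g h" and p: "p \<in> I"
  shows "ev fps_const (\<lambda>ij. g $$ ij) p = 0"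
proof (rule fps_ext)
  interpret T: comm_ring_hom "\<lambda>f :: 'k fps. Dual f (theta f)" by (rule Dual_theta_comm_ring_hom)
  interpret C: comm_ring_hom "fps_const :: 'k \<Rightarrow> 'k fps" by (rule fps_const_comm_ring_hom)
  interpret Z: comm_ring_hom "\<lambda>f :: 'k fps. fps_nth f 0" by (rule fps_nth_0_comm_ring_hom)
  note Y = flowD(1)[OF flow] and g = flowD(2)[OF flow] and Y0 = flowD(4)[OF flow] and Ylie = flowD(5)[OF flow]
    and g0 = flowD(6)[OF flow] and ode = flowD(10)[OF flow]
  define v where "v = (\<lambda>ij. g $$ ij)"
  fix N
  show "fps_nth (ev fps_const (\<lambda>ij. g $$ ij) p) N = fps_nth 0 N"
    unfolding v_def[symmetric] using p
  proof (induction N arbitrary: p rule: less_induct)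
    case (less N)
    note pm = I_mat_polys[OF less.prems]
    show ?case
    proof (cases "N = 0")
      case True
      have "fps_nth (ev fps_const v p) 0 = ev id (\<lambda>ij. fps_nth (v ij) 0) p"
        unfolding Z.hom_ev by (simp add: id_def)
      also have "\<dots> = ev_one n p"
      proof (rule ev_cong[OF pm])
        fix ij :: "nat \<times> nat" assume "ij \<in> idx n"
        thus "fps_nth (v ij) 0 = 1\<^sub>m n $$ ij"
          using arg_cong[OF g0, of "\<lambda>M. M $$ ij"] g by (auto simp: v_def)
      qed
      also have "\<dots> = 0" using I_one[OF less.prems] .
      finally show ?thesis using True by simp
    next
      case False
      have tc: "theta (fps_const c) = 0" for c :: 'k by (simp add: theta_def)
      have "Dual (ev fps_const v p) (theta (ev fps_const v p)) =
          ev (\<lambda>c. Dual (fps_const c) 0) (\<lambda>ij. Dual (v ij) (theta (v ij))) p"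
        unfolding T.hom_ev by (simp add: tc)
      hence "theta (ev fps_const v p) = (\<Sum>ij\<in>idx n. theta (v ij) * ev fps_const v (pd ij p))"
        using C.dual_eps_ev[OF pm, of v "\<lambda>ij. theta (v ij)"] by (metis dual_num.sel(2))
      also have "\<dots> = (\<Sum>ij\<in>idx n. (\<Sum>c<n. Y $$ (fst ij, c) * v (c, snd ij)) * ev fps_const v (pd ij p))"
      proof (intro sum.cong refl arg_cong2[of _ _ _ _ "(*)"])
        fix ij assume ij: "ij \<in> idx n"
        hence "theta (v ij) = (Y * g) $$ ij"
          using arg_cong[OF ode, of "\<lambda>M. M $$ ij"] g by (auto simp: v_def simp del: index_mult_mat)
        also have "\<dots> = (\<Sum>c<n. Y $$ (fst ij, c) * v (c, snd ij))"
          using ij index_mult_mat_sum[OF Y g] by (auto simp: v_def simp del: index_mult_mat)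
        finally show "theta (v ij) = (\<Sum>c<n. Y $$ (fst ij, c) * v (c, snd ij))" .
      qed
      finally have th: "theta (ev fps_const v p) = (\<Sum>ij\<in>idx n. \<Sum>c<n. Y $$ (fst ij, c) * (v (c, snd ij) * ev fps_const v (pd ij p)))"
        by (simp add: sum_distrib_right mult.assoc)
      have "of_nat N * fps_nth (ev fps_const v p) N = fps_nth (theta (ev fps_const v p)) N"
        by (simp add: theta_nth)
      also have "\<dots> = (\<Sum>ij\<in>idx n. \<Sum>c<n. \<Sum>m\<le>N. fps_nth (Y $$ (fst ij, c)) m *
           fps_nth (v (c, snd ij) * ev fps_const v (pd ij p)) (N - m))"
        unfolding th by (simp add: fps_sum_nth fps_mult_nth[of "Y $$ _"] atLeast0AtMost)
      also have "\<dots> = (\<Sum>m\<le>N. \<Sum>ij\<in>idx n. \<Sum>c<n. fps_nth (Y $$ (fst ij, c)) m *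
           fps_nth (v (c, snd ij) * ev fps_const v (pd ij p)) (N - m))"
        by (subst (2) sum.swap, subst (3) sum.swap) (rule refl)
      also have "\<dots> = (\<Sum>m\<le>N. fps_nth (ev fps_const v (lder n (cf m Y) p)) (N - m))"
      proof (intro sum.cong refl)
        fix m
        have "fps_nth (ev fps_const v (lder n (cf m Y) p)) (N - m) =
          fps_nth (\<Sum>ij\<in>idx n. \<Sum>c<n. fps_const (cf m Y $$ (fst ij, c)) * (v (c, snd ij) * ev fps_const v (pd ij p))) (N - m)"
          by (simp only: C.ev_lder sum_distrib_right mult.assoc)
        also have "\<dots> = (\<Sum>ij\<in>idx n. \<Sum>c<n. cf m Y $$ (fst ij, c) * fps_nth (v (c, snd ij) * ev fps_const v (pd ij p)) (N - m))"
          by (simp only: fps_sum_nth fps_mult_left_const_nth)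
        also have "\<dots> = (\<Sum>ij\<in>idx n. \<Sum>c<n. fps_nth (Y $$ (fst ij, c)) m *
           fps_nth (v (c, snd ij) * ev fps_const v (pd ij p)) (N - m))"
          using Y by (intro sum.cong refl) auto
        finally show "(\<Sum>ij\<in>idx n. \<Sum>c<n. fps_nth (Y $$ (fst ij, c)) m *
           fps_nth (v (c, snd ij) * ev fps_const v (pd ij p)) (N - m)) =
           fps_nth (ev fps_const v (lder n (cf m Y) p)) (N - m)" ..
      qed
      also have "\<dots> = 0"
      proof (intro sum.neutral ballI)
        fix m assume m: "m \<in> {..N}"
        show "fps_nth (ev fps_const v (lder n (cf m Y) p)) (N - m) = 0"
        proof (cases "m = 0")
          case True
          have "lder n (0\<^sub>m n n) p = 0" unfolding lder_def by (intro sum.neutral) auto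
          thus ?thesis using True Y0 by simp
        next
          case False
          with m less.IH[of "N - m" "lder n (cf m Y) p"] lder_vanishing[OF Ylie less.prems]
          show ?thesis by simp
        qed
      qed
      finally show ?thesis using False by simp
    qed
  qed
qed

lemma lie_0: "0\<^sub>m n n \<in> \<gg>"
  by (auto simp: lie_iff intro!: sum.neutral)

text \<open>\<open>B = g A h\<close> satisfies \<open>theta B = Y B - B Y\<close> and \<open>B(0) = A\<close>, so its coefficients are obtained from \<open>A\<close> by
  brackets with the coefficients of \<open>Y\<close>.\<close>

lemma flow_adjoint:
  assumes flow: "flow Y g h" and A: "A \<in> \<gg>"
  shows "cf N (g * map_mat fps_const A * h) \<in> \<gg>"
proof -
  note Y = flowD(1)[OF flow] and g = flowD(2)[OF flow] and h = flowD(3)[OF flow] and Y0 = flowD(4)[OF flow]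
    and Ylie = flowD(5)[OF flow] and g0 = flowD(6)[OF flow] and h0 = flowD(7)[OF flow] and gh = flowD(8,9)[OF flow]
    and ode = flowD(10)[OF flow]
  interpret C: comm_ring_hom "fps_const :: 'k \<Rightarrow> 'k fps" by (rule fps_const_comm_ring_hom)
  interpret Z: comm_ring_hom "\<lambda>f :: 'k fps. fps_nth f 0" by (rule fps_nth_0_comm_ring_hom)
  define A' where "A' = map_mat fps_const A"
  have Ac: "A \<in> carrier_mat n n" and A': "A' \<in> carrier_mat n n"
    using lie_carrier[OF A] by (auto simp: A'_def)
  define B where "B = g * A' * h"
  have B: "B \<in> carrier_mat n n" unfolding B_def using g h A' by auto
  have th1: "map_mat theta (1\<^sub>m n) = (0\<^sub>m n n :: 'k fps mat)"
    by (rule eq_matI) (auto simp: theta_def)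
  have tA: "map_mat theta A' = 0\<^sub>m n n"
    using Ac by (intro eq_matI) (auto simp: theta_def A'_def)
  have der: "map_mat theta (M * M') = map_mat theta M * M' + M * map_mat theta M'"
    if "M \<in> carrier_mat n n" "M' \<in> carrier_mat n n" for M M' :: "'k fps mat"
    by (rule map_mat_derivation[OF that]) (simp_all add: theta_add theta_mult)
  have Th: "map_mat theta h \<in> carrier_mat n n" using h by simp
  \<comment> \<open>differentiating \<open>g h = 1\<close> gives \<open>theta h = - h Y\<close>\<close>
  have "Y * g * h + g * map_mat theta h = 0\<^sub>m n n"
    using der[OF g h] th1 unfolding gh ode by simp
  moreover have "Y * g * h = Y"
    using Y g h gh by (simp add: assoc_mult_mat[of _ n n _ n _ n] right_mult_one_mat[of _ n n])
  ultimately have "Y + g * map_mat theta h = 0\<^sub>m n n" by simp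
  hence "h * (Y + g * map_mat theta h) = 0\<^sub>m n n" using h by simp
  also have "h * (Y + g * map_mat theta h) = h * Y + h * (g * map_mat theta h)"
    using h Y g Th by (intro mult_add_distrib_mat[of _ n n _ n]) auto
  also have "h * (g * map_mat theta h) = map_mat theta h"
    using h g Th gh by (simp flip: assoc_mult_mat[of _ n n _ n _ n])
  finally have "h * Y + map_mat theta h = 0\<^sub>m n n" .
  hence th: "map_mat theta h = - (h * Y)"
    using h Y Th by (intro eq_matI) (auto simp: mat_eq_iff eq_neg_iff_add_eq_0 add.commute simp del: index_mult_mat(1))
  have "map_mat theta B = map_mat theta (g * A') * h + g * A' * map_mat theta h"
    unfolding B_def using g A' h by (intro der) auto
  also have "map_mat theta (g * A') = Y * g * A'"
    using der[OF g A'] g A' Y unfolding tA ode by simp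
  also have "Y * g * A' * h = Y * B"
    unfolding B_def using Y g A' h by (simp add: assoc_mult_mat[of _ n n _ n _ n])
  also have "g * A' * map_mat theta h = - (B * Y)"
    unfolding B_def th using Y g A' h by (simp add: assoc_mult_mat[of _ n n _ n _ n])
  finally have odeB: "map_mat theta B = Y * B + - (B * Y)" .
  have B0: "cf 0 B = A"
  proof -
    have "cf 0 B = cf 0 g * cf 0 A' * cf 0 h"
      unfolding B_def using g A' h by (subst Z.mat_hom_mult[of _ n n _ n], simp, simp, subst Z.mat_hom_mult[of _ n n _ n]) auto
    also have "cf 0 A' = A" using Ac by (auto simp: A'_def)
    finally show ?thesis using Ac by (simp add: g0 h0 left_mult_one_mat[of _ n n] right_mult_one_mat[of _ n n])
  qed
  have "cf N B \<in> \<gg>"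
  proof (induction N rule: less_induct)
    case (less N)
    show ?case
    proof (cases "N = 0")
      case True
      thus ?thesis using B0 A by simp
    next
      case False
      have eq: "cf N B = mat n n (\<lambda>ij. \<Sum>m\<in>{1..N}. inverse (of_nat N) * (cf m Y * cf (N - m) B - cf (N - m) B * cf m Y) $$ ij)"
      proof (rule eq_mat_square)
        fix i j assume ij: "i < n" "j < n"
        have YB: "Y * B \<in> carrier_mat n n" "B * Y \<in> carrier_mat n n" using Y B by auto
        have "theta (B $$ (i, j)) = (Y * B) $$ (i, j) - (B * Y) $$ (i, j)"
          using arg_cong[OF odeB, of "\<lambda>M. M $$ (i, j)"] ij B YB by (auto simp del: index_mult_mat)
        hence "of_nat N * fps_nth (B $$ (i, j)) N = fps_nth ((Y * B) $$ (i, j)) N - fps_nth ((B * Y) $$ (i, j)) N"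
          by (metis theta_nth fps_sub_nth)
        also have "fps_nth ((B * Y) $$ (i, j)) N = (\<Sum>m\<le>N. (cf (N - m) B * cf m Y) $$ (i, j))"
          unfolding cf_mult_entry[OF B Y ij]
          by (rule sum.reindex_bij_witness[of _ "\<lambda>m. N - m" "\<lambda>m. N - m"]) auto
        also have "fps_nth ((Y * B) $$ (i, j)) N = (\<Sum>m\<le>N. (cf m Y * cf (N - m) B) $$ (i, j))"
          by (rule cf_mult_entry[OF Y B ij])
        also have "(\<Sum>m\<le>N. (cf m Y * cf (N - m) B) $$ (i, j)) - (\<Sum>m\<le>N. (cf (N - m) B * cf m Y) $$ (i, j)) =
            (\<Sum>m\<le>N. (cf m Y * cf (N - m) B - cf (N - m) B * cf m Y) $$ (i, j))"
          using ij Y B by (simp add: sum_subtractf del: index_mult_mat(1))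
        also have "\<dots> = (\<Sum>m\<in>{1..N}. (cf m Y * cf (N - m) B - cf (N - m) B * cf m Y) $$ (i, j))"
        proof (rule sum.mono_neutral_right)
          show "\<forall>m\<in>{..N} - {1..N}. (cf m Y * cf (N - m) B - cf (N - m) B * cf m Y) $$ (i, j) = 0"
          proof
            fix m assume "m \<in> {..N} - {1..N}"
            hence "m = 0" by auto
            moreover have "cf N B \<in> carrier_mat n n" using B by simp
            ultimately show "(cf m Y * cf (N - m) B - cf (N - m) B * cf m Y) $$ (i, j) = 0"
              using ij by (simp add: Y0 left_mult_zero_mat[of _ n n] right_mult_zero_mat[of _ n n])
          qed
        qed auto
        finally have "fps_nth (B $$ (i, j)) N = inverse (of_nat N) * (\<Sum>m\<in>{1..N}. (cf m Y * cf (N - m) B - cf (N - m) B * cf m Y) $$ (i, j))"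
          using False by (simp add: field_simps)
        thus "cf N B $$ (i, j) = mat n n (\<lambda>ij. \<Sum>m\<in>{1..N}. inverse (of_nat N) * (cf m Y * cf (N - m) B - cf (N - m) B * cf m Y) $$ ij) $$ (i, j)"
          using ij B by (simp add: sum_distrib_left)
      qed (use B in auto)
      show ?thesis
        unfolding eq by (intro lie_sum lie_bracket Ylie less.IH) auto
    qed
  qed
  thus ?thesis by (simp add: B_def A'_def)
qed

lemma flow_adjoint_series:
  assumes flow: "flow Y g h" and A: "A \<in> carrier_mat n n" "\<And>m. cf m A \<in> \<gg>"
  shows "cf N (g * A * h) \<in> \<gg>"
proof -
  note g = flowD(2)[OF flow] and h = flowD(3)[OF flow]
  have eq: "cf N (g * A * h) = mat n n (\<lambda>ij. \<Sum>m\<le>N. 1 * cf (N - m) (g * map_mat fps_const (cf m A) * h) $$ ij)"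
  proof (rule eq_mat_square)
    fix i j assume ij: "i < n" "j < n"
    have ent: "(g * M * h) $$ (i, j) = (\<Sum>d<n. \<Sum>c<n. M $$ (c, d) * (g $$ (i, c) * h $$ (d, j)))"
      if M: "M \<in> carrier_mat n n" for M
    proof -
      have "(g * M * h) $$ (i, j) = (\<Sum>d<n. (g * M) $$ (i, d) * h $$ (d, j))"
        using g M h ij by (intro index_mult_mat_sum[of _ n n _ n]) auto
      also have "\<dots> = (\<Sum>d<n. (\<Sum>c<n. g $$ (i, c) * M $$ (c, d)) * h $$ (d, j))"
        using g M ij by (intro sum.cong refl arg_cong2[of _ _ _ _ "(*)"] index_mult_mat_sum[of _ n n _ n]) auto
      finally show ?thesis by (simp add: sum_distrib_right sum_distrib_left mult_ac)
    qed
    have c: "g * A * h \<in> carrier_mat n n" "\<And>m. g * map_mat fps_const (cf m A) * h \<in> carrier_mat n n"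
      using g h A(1) by auto
    have "fps_nth ((g * A * h) $$ (i, j)) N = (\<Sum>d<n. \<Sum>c<n. \<Sum>m\<le>N. fps_nth (A $$ (c, d)) m * fps_nth (g $$ (i, c) * h $$ (d, j)) (N - m))"
      by (simp add: ent[OF A(1)] fps_sum_nth fps_mult_nth[of "A $$ _"] atLeast0AtMost)
    also have "\<dots> = (\<Sum>m\<le>N. \<Sum>d<n. \<Sum>c<n. fps_nth (A $$ (c, d)) m * fps_nth (g $$ (i, c) * h $$ (d, j)) (N - m))"
      by (subst (2) sum.swap, subst sum.swap) (rule refl)
    also have "\<dots> = (\<Sum>m\<le>N. fps_nth ((g * map_mat fps_const (cf m A) * h) $$ (i, j)) (N - m))"
    proof (intro sum.cong refl)
      fix m
      have "fps_nth ((g * map_mat fps_const (cf m A) * h) $$ (i, j)) (N - m) =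
        (\<Sum>d<n. \<Sum>c<n. fps_nth (map_mat fps_const (cf m A) $$ (c, d) * (g $$ (i, c) * h $$ (d, j))) (N - m))"
        using A by (subst ent) (auto simp: fps_sum_nth)
      also have "\<dots> = (\<Sum>d<n. \<Sum>c<n. fps_nth (A $$ (c, d)) m * fps_nth (g $$ (i, c) * h $$ (d, j)) (N - m))"
        using A(1) by (intro sum.cong refl) auto
      finally show "(\<Sum>d<n. \<Sum>c<n. fps_nth (A $$ (c, d)) m * fps_nth (g $$ (i, c) * h $$ (d, j)) (N - m)) =
        fps_nth ((g * map_mat fps_const (cf m A) * h) $$ (i, j)) (N - m)" ..
    qed
    finally show "cf N (g * A * h) $$ (i, j) = mat n n (\<lambda>ij. \<Sum>m\<le>N. 1 * cf (N - m) (g * map_mat fps_const (cf m A) * h) $$ ij) $$ (i, j)"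
      using ij c g h by (simp del: index_mult_mat(1))
  qed (use g h A in auto)
  show ?thesis
    unfolding eq by (intro lie_sum flow_adjoint[OF flow A(2)])
qed

end

section \<open>Generalised eigenspaces and stable subspaces\<close>

locale linear_operator = vector_space scale
  for scale :: "'a::field \<Rightarrow> 'b::ab_group_add \<Rightarrow> 'b" (infixr \<open>*s\<close> 75) +
  fixes L :: "'b \<Rightarrow> 'b"
  assumes L_add: "L (x + y) = L x + L y"
    and L_scale: "L (c *s x) = c *s L x"
begin

definition shift :: "'a \<Rightarrow> 'b \<Rightarrow> 'b" where
  "shift \<mu> x = L x - \<mu> *s x"

definition gen_eigenspace :: "'a \<Rightarrow> 'b set" where
  "gen_eigenspace \<mu> = {v. \<exists>k. (shift \<mu> ^^ k) v = 0}"

definition stable :: "'b set \<Rightarrow> bool" where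
  "stable S \<longleftrightarrow> subspace S \<and> (\<forall>x\<in>S. L x \<in> S)"

lemma shift_add: "shift \<mu> (x + y) = shift \<mu> x + shift \<mu> y"
  by (simp add: shift_def L_add scale_right_distrib)

lemma shift_scale: "shift \<mu> (c *s x) = c *s shift \<mu> x"
  by (simp add: shift_def L_scale scale_right_diff_distrib scale_left_commute)

lemma shift_0 [simp]: "shift \<mu> 0 = 0"
  using shift_scale[of \<mu> 0 0] by simp

lemma shift_commute: "shift \<mu> (shift \<nu> x) = shift \<nu> (shift \<mu> x)"
proof -
  have L_diff: "L (x - y) = L x - L y" for x y
    using L_add[of "x - y" y] by simp
  show ?thesis
    by (simp add: shift_def L_diff L_scale scale_right_diff_distrib scale_left_commute algebra_simps)
qed

lemma funpow_shift_add: "(shift \<mu> ^^ k) (x + y) = (shift \<mu> ^^ k) x + (shift \<mu> ^^ k) y"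
  by (induction k) (simp_all add: shift_add)

lemma funpow_shift_scale: "(shift \<mu> ^^ k) (c *s x) = c *s (shift \<mu> ^^ k) x"
  by (induction k) (simp_all add: shift_scale)

lemma funpow_shift_0 [simp]: "(shift \<mu> ^^ k) 0 = 0"
  by (induction k) simp_all

lemma funpow_shift_sum: "(shift \<mu> ^^ k) (sum f A) = (\<Sum>x\<in>A. (shift \<mu> ^^ k) (f x))"
  by (induction A rule: infinite_finite_induct) (simp_all add: funpow_shift_add)

lemma funpow_shift_commute: "(shift \<mu> ^^ k) (shift \<nu> x) = shift \<nu> ((shift \<mu> ^^ k) x)"
  by (induction k) (simp_all add: shift_commute[of \<mu> \<nu>])

lemma gen_eigenspace_mono: "(shift \<mu> ^^ k) v = 0 \<Longrightarrow> k \<le> l \<Longrightarrow> (shift \<mu> ^^ l) v = 0"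
  by (metis funpow_shift_0 funpow_add le_add_diff_inverse2 o_apply)

lemma gen_eigenspace_0 [simp]: "0 \<in> gen_eigenspace \<mu>"
  by (simp add: gen_eigenspace_def)

lemma gen_eigenspace_add:
  assumes "x \<in> gen_eigenspace \<mu>" "y \<in> gen_eigenspace \<mu>"
  shows "x + y \<in> gen_eigenspace \<mu>"
proof -
  obtain k l where "(shift \<mu> ^^ k) x = 0" "(shift \<mu> ^^ l) y = 0"
    using assms by (auto simp: gen_eigenspace_def)
  hence "(shift \<mu> ^^ max k l) (x + y) = 0"
    by (simp add: funpow_shift_add gen_eigenspace_mono[of k \<mu> x] gen_eigenspace_mono[of l \<mu> y])
  thus ?thesis by (auto simp: gen_eigenspace_def)
qed

lemma gen_eigenspace_scale: "x \<in> gen_eigenspace \<mu> \<Longrightarrow> c *s x \<in> gen_eigenspace \<mu>"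
  by (auto simp: gen_eigenspace_def funpow_shift_scale intro: exI)

lemma gen_eigenspace_sum:
  "(\<And>x. x \<in> A \<Longrightarrow> f x \<in> gen_eigenspace \<mu>) \<Longrightarrow> sum f A \<in> gen_eigenspace \<mu>"
  by (induction A rule: infinite_finite_induct) (auto intro: gen_eigenspace_add)

lemma gen_eigenspace_shiftD: "shift \<mu> x \<in> gen_eigenspace \<mu> \<Longrightarrow> x \<in> gen_eigenspace \<mu>"
  unfolding gen_eigenspace_def by (auto simp: funpow_swap1 intro: exI[of _ "Suc _"])

lemma gen_eigenspace_shift: "x \<in> gen_eigenspace \<mu> \<Longrightarrow> shift \<nu> x \<in> gen_eigenspace \<mu>"
  unfolding gen_eigenspace_def by (auto simp: funpow_shift_commute) (metis shift_0)

lemma gen_eigenspace_funpow_shift: "x \<in> gen_eigenspace \<mu> \<Longrightarrow> (shift \<nu> ^^ k) x \<in> gen_eigenspace \<mu>"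
  by (induction k) (auto intro: gen_eigenspace_shift)

lemma stable_shift: "stable S \<Longrightarrow> x \<in> S \<Longrightarrow> shift \<mu> x \<in> S"
  by (auto simp: stable_def shift_def intro: subspace_diff subspace_scale)

lemma stable_funpow_shift: "stable S \<Longrightarrow> x \<in> S \<Longrightarrow> (shift \<mu> ^^ k) x \<in> S"
  by (induction k) (auto intro: stable_shift)

text \<open>The polynomials \<open>(X - \<nu>)\<^sup>a\<close> and \<open>(X - \<mu>)\<^sup>b\<close> are coprime; the induction on \<open>a + b\<close> replaces Bezout's identity
  and starts from \<open>(\<mu> - \<nu>) w\<close> being the difference of the two shifts of \<open>w\<close>.\<close>

lemma stable_coprime:
  assumes S: "stable S" and "\<mu> \<noteq> \<nu>"
  shows "(shift \<nu> ^^ a) w \<in> S \<Longrightarrow> (shift \<mu> ^^ b) w \<in> S \<Longrightarrow> w \<in> S"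
proof (induction "a + b" arbitrary: a b w)
  case (Suc m)
  show ?case
  proof (cases "a = 0 \<or> b = 0")
    case False
    then obtain a' b' where [simp]: "a = Suc a'" "b = Suc b'" by (metis not0_implies_Suc)
    have "(shift \<nu> ^^ a') (shift \<nu> w) \<in> S" "(shift \<mu> ^^ b') (shift \<mu> w) \<in> S"
      using Suc.prems by (simp_all add: funpow_swap1)
    moreover have "(shift \<mu> ^^ b) (shift \<nu> w) \<in> S" "(shift \<nu> ^^ a) (shift \<mu> w) \<in> S"
      unfolding funpow_shift_commute using Suc.prems by (auto intro: stable_shift[OF S])
    ultimately have "shift \<nu> w \<in> S" "shift \<mu> w \<in> S"
      using Suc.hyps(1)[of a' b "shift \<nu> w"] Suc.hyps(1)[of a b' "shift \<mu> w"] Suc.hyps(2) by simp_all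
    hence "shift \<nu> w - shift \<mu> w \<in> S"
      using S by (auto simp: stable_def intro: subspace_diff)
    also have "shift \<nu> w - shift \<mu> w = (\<mu> - \<nu>) *s w"
      by (simp add: shift_def scale_left_diff_distrib)
    finally have "inverse (\<mu> - \<nu>) *s (\<mu> - \<nu>) *s w \<in> S"
      using S by (auto simp: stable_def simp del: scale_scale intro: subspace_scale)
    thus ?thesis using assms(2) by simp
  qed (use Suc.prems in auto)
qed auto

text \<open>Apply a power of \<open>L - \<nu>\<close> that kills the component at \<open>\<nu>\<close>; the other components are dealt with by
  induction and recovered by \<open>stable_coprime\<close>.\<close>

lemma stable_component:
  assumes S: "stable S" and "finite F"
  shows "(\<And>\<mu>. \<mu> \<in> F \<Longrightarrow> f \<mu> \<in> gen_eigenspace \<mu>) \<Longrightarrow> sum f F \<in> S \<Longrightarrow> \<mu> \<in> F \<Longrightarrow> f \<mu> \<in> S"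
  using assms(2)
proof (induction F arbitrary: f \<mu> rule: finite_induct)
  case (insert \<nu> F)
  from insert.prems obtain k where k: "(shift \<nu> ^^ k) (f \<nu>) = 0"
    by (auto simp: gen_eigenspace_def)
  have "(shift \<nu> ^^ k) (sum f (insert \<nu> F)) \<in> S"
    by (intro stable_funpow_shift S insert.prems)
  hence *: "(\<Sum>\<mu>\<in>F. (shift \<nu> ^^ k) (f \<mu>)) \<in> S"
    using insert.hyps k by (simp add: funpow_shift_add funpow_shift_sum)
  have F: "f \<mu> \<in> S" if \<mu>: "\<mu> \<in> F" for \<mu>
  proof -
    have 1: "(shift \<nu> ^^ k) (f \<mu>) \<in> S"
      by (rule insert.IH[OF _ * \<mu>]) (use insert.prems in \<open>auto intro: gen_eigenspace_funpow_shift\<close>)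
    from insert.prems \<mu> obtain l where "(shift \<mu> ^^ l) (f \<mu>) = 0"
      by (auto simp: gen_eigenspace_def)
    hence "(shift \<mu> ^^ l) (f \<mu>) \<in> S"
      using S by (auto simp: stable_def subspace_def)
    with 1 show ?thesis
      using stable_coprime[OF S, of \<mu> \<nu>] insert.hyps \<mu> by metis
  qed
  have "sum f (insert \<nu> F) - sum f F \<in> S"
    using S F insert.prems by (auto simp: stable_def intro!: subspace_diff subspace_sum)
  with F insert show ?case by auto
qed auto

text \<open>On the generalised eigenspace of \<open>\<mu>\<close>, the operator \<open>L - \<nu>\<close> is the nonzero scalar \<open>\<mu> - \<nu>\<close> plus a
  nilpotent operator, so it is invertible.\<close>

lemma stable_shift_surj:
  assumes S: "stable S" and "\<mu> \<noteq> \<nu>" "v \<in> S" "v \<in> gen_eigenspace \<mu>"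
  shows "\<exists>y\<in>S. shift \<nu> y = v"
proof -
  obtain k where "(shift \<mu> ^^ k) v = 0" using assms(4) by (auto simp: gen_eigenspace_def)
  thus ?thesis using assms(3)
  proof (induction k arbitrary: v)
    case 0
    thus ?case by (intro bexI[of _ 0]) auto
  next
    case (Suc k)
    have "(shift \<mu> ^^ k) (shift \<mu> v) = 0" using Suc.prems by (simp add: funpow_swap1)
    from Suc.IH[OF this stable_shift[OF S Suc.prems(2)]]
    obtain y where y: "y \<in> S" "shift \<nu> y = shift \<mu> v" by auto
    let ?c = "inverse (\<mu> - \<nu>)"
    have "shift \<nu> v = shift \<mu> v + (\<mu> - \<nu>) *s v"
      by (simp add: shift_def scale_left_diff_distrib)
    moreover have "shift \<nu> (v - y) = shift \<nu> v - shift \<nu> y"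
      using shift_add[of \<nu> "v - y" y] by simp
    ultimately have "shift \<nu> (?c *s (v - y)) = v"
      using assms(2) y by (simp add: shift_scale)
    moreover have "?c *s (v - y) \<in> S"
      using S Suc.prems y by (auto simp: stable_def intro!: subspace_scale subspace_diff)
    ultimately show ?case by blast
  qed
qed

text \<open>Fitting's decomposition for \<open>L - \<nu>\<close>: all components but the one at \<open>\<nu>\<close> lie in the image.\<close>

lemma stable_fitting:
  assumes S: "stable S" and F: "finite F" and f: "\<And>\<mu>. \<mu> \<in> F \<Longrightarrow> f \<mu> \<in> gen_eigenspace \<mu>"
    and v: "sum f F \<in> S" 
  shows "\<exists>y\<in>S. sum f F = shift \<nu> y + (if \<nu> \<in> F then f \<nu> else 0)"
proof -
  have fS: "f \<mu> \<in> S" if "\<mu> \<in> F" for \<mu>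
    using stable_component[OF S F f v that] .
  have "\<forall>\<mu>\<in>F - {\<nu>}. \<exists>y\<in>S. shift \<nu> y = f \<mu>"
    using stable_shift_surj[OF S _ fS f] by blast
  then obtain y where y: "\<And>\<mu>. \<mu> \<in> F - {\<nu>} \<Longrightarrow> y \<mu> \<in> S \<and> shift \<nu> (y \<mu>) = f \<mu>"
    by metis
  have shift_sum: "shift \<nu> (sum g A) = (\<Sum>x\<in>A. shift \<nu> (g x))" for g :: "'a \<Rightarrow> 'b" and A
    using funpow_shift_sum[of 1] by simp
  have "sum f F = sum f (F - {\<nu>}) + (if \<nu> \<in> F then f \<nu> else 0)"
    using F by (auto simp: sum.remove add.commute)
  also have "sum f (F - {\<nu>}) = shift \<nu> (sum y (F - {\<nu>}))"
    using y by (simp add: shift_sum)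
  finally show ?thesis
    using y S by (auto simp: stable_def intro!: subspace_sum bexI[of _ "sum y (F - {\<nu>})"])
qed

end

section \<open>Integral linear forms\<close>

definition dot :: "nat \<Rightarrow> (nat \<Rightarrow> int) \<Rightarrow> (nat \<Rightarrow> 'a::ring_1) \<Rightarrow> 'a" where
  "dot n c x = (\<Sum>i<n. of_int (c i) * x i)"

lemma dot_of_int: "dot n c (\<lambda>i. of_int (x i)) = of_int (dot n c x)"
  by (simp add: dot_def)

lemma dot_lin: "dot n c (\<lambda>i. a * x i + b * y i) = a * dot n c x + (b::'a::comm_ring_1) * dot n c y"
  by (simp add: dot_def sum.distrib sum_distrib_left algebra_simps)

lemma dot_lin_left: "dot n (\<lambda>i. a * c i + b * d i) x = of_int a * dot n c x + of_int b * dot n d (x :: nat \<Rightarrow> 'a::comm_ring_1)"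
  by (simp add: dot_def sum.distrib sum_distrib_left algebra_simps)

lemma dot_sum_left:
  "dot n (\<lambda>i. \<Sum>f\<in>F. a f * g f i) x = (\<Sum>f\<in>F. of_int (a f) * dot n (g f) (x :: nat \<Rightarrow> 'a::comm_ring_1))"
proof -
  have "dot n (\<lambda>i. \<Sum>f\<in>F. a f * g f i) x = (\<Sum>i<n. \<Sum>f\<in>F. of_int (a f) * (of_int (g f i) * x i))"
    by (simp add: dot_def sum_distrib_right mult.assoc)
  also have "\<dots> = (\<Sum>f\<in>F. of_int (a f) * dot n (g f) x)"
    by (subst sum.swap) (simp add: dot_def sum_distrib_left)
  finally show ?thesis .
qed

text \<open>Gaussian elimination without division: when a form \<open>f0\<close> is added, subtract from \<open>c\<close> the multiple of \<open>f0\<close>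
  that makes it vanish on the vector found before.\<close>

lemma dependent_or_separated:
  assumes "finite F"
  shows "(\<exists>N a. N \<noteq> 0 \<and> (\<forall>i<n. N * c i = (\<Sum>f\<in>F. a f * f i))) \<or>
    (\<exists>v. (\<forall>f\<in>F. dot n f v = 0) \<and> dot n c v \<noteq> (0::int))"
  using assms
proof (induction F arbitrary: c rule: finite_induct)
  case empty
  show ?case
  proof (cases "\<forall>i<n. c i = 0")
    case True
    thus ?thesis by (intro disjI1 exI[of _ 1]) auto
  next
    case False
    then obtain i where i: "i < n" "c i \<noteq> 0" by auto
    have "dot n c (\<lambda>j. if j = i then 1 else 0) = c i"
      using i by (simp add: dot_def if_distrib[of "(*) _"] cong: if_cong)
    with i show ?thesis by (intro disjI2 exI[of _ "\<lambda>j. if j = i then 1 else 0"]) auto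
  qed
next
  case (insert f0 F)
  show ?case
  proof (cases "\<exists>N a. N \<noteq> 0 \<and> (\<forall>i<n. N * c i = (\<Sum>f\<in>F. a f * f i))")
    case True
    then obtain N a where Na: "N \<noteq> 0" "\<And>i. i < n \<Longrightarrow> N * c i = (\<Sum>f\<in>F. a f * f i)" by blast
    have "N * c i = (\<Sum>f\<in>insert f0 F. (a(f0 := 0)) f * f i)" if "i < n" for i
      using Na(2)[OF that] insert.hyps by (simp, intro sum.cong) auto
    with Na show ?thesis by blast
  next
    case False
    with insert.IH[of c] obtain v where v: "\<And>f. f \<in> F \<Longrightarrow> dot n f v = 0" "dot n c v \<noteq> (0::int)" by blast
    show ?thesis
    proof (cases "dot n f0 v = 0")
      case True
      with v show ?thesis by blast
    next
      case f0: False
      \<comment> \<open>\<open>c'\<close> is the combination of \<open>c\<close> and \<open>f0\<close> that vanishes at \<open>v\<close>\<close>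
      define c' where "c' = (\<lambda>i. dot n f0 v * c i + (- dot n c v) * f0 i)"
      consider N a where "N \<noteq> 0" "\<And>i. i < n \<Longrightarrow> N * c' i = (\<Sum>f\<in>F. a f * f i)"
        | v' where "\<And>f. f \<in> F \<Longrightarrow> dot n f v' = 0" "dot n c' v' \<noteq> (0::int)"
        using insert.IH[of c'] by blast
      thus ?thesis
      proof cases
        case (1 N a)
        have "N * dot n f0 v * c i = (\<Sum>f\<in>insert f0 F. (a(f0 := N * dot n c v)) f * f i)" if "i < n" for i
        proof -
          have "(\<Sum>f\<in>F. (a(f0 := N * dot n c v)) f * f i) = (\<Sum>f\<in>F. a f * f i)"
            using insert.hyps by (intro sum.cong) auto
          thus ?thesis
            using 1(2)[OF that] insert.hyps by (simp add: c'_def algebra_simps)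
        qed
        with 1 f0 show ?thesis by (intro disjI1 exI[of _ "N * dot n f0 v"]) auto
      next
        case (2 v')
        define w where "w = (\<lambda>i. dot n f0 v * v' i + (- dot n f0 v') * v i)"
        have "dot n c w = dot n c' v'"
          unfolding w_def c'_def by (subst dot_lin, subst dot_lin_left) simp
        moreover have "dot n f w = 0" if "f \<in> insert f0 F" for f
          using that 2 v unfolding w_def by (subst dot_lin) auto
        ultimately show ?thesis using 2 by (intro disjI2 exI[of _ w]) auto
      qed
    qed
  qed
qed

text \<open>By induction on the set of forms.  A form dependent on the others takes the required value
  automatically.  Otherwise some integral vector \<open>v\<close> is killed by the others but not by the new form, and
  adding a multiple of \<open>v\<close> adjusts the value of the new form.  The bound \<open>m\<close> does not depend on \<open>s\<close>.\<close>

lemma integral_point_aux: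
  assumes "finite F"
  shows "\<exists>m>0::int. \<forall>s :: nat \<Rightarrow> 'k::field_char_0. (\<forall>f\<in>F. dot n f s \<in> \<int>) \<longrightarrow>
    (\<exists>l :: nat \<Rightarrow> int. \<forall>f\<in>F. of_int (dot n f l) = of_int m * dot n f s)"
  using assms
proof (induction F rule: finite_induct)
  case empty
  show ?case by (intro exI[of _ 1]) auto
next
  case (insert c F)
  then obtain m where m: "m > 0"
    "\<And>s :: nat \<Rightarrow> 'k. \<forall>f\<in>F. dot n f s \<in> \<int> \<Longrightarrow>
       \<exists>l :: nat \<Rightarrow> int. \<forall>f\<in>F. of_int (dot n f l) = of_int m * dot n f s" by blast
  from dependent_or_separated[OF insert.hyps(1), of n c]
  show ?case
  proof (elim disjE exE conjE)
    fix N a assume Na: "N \<noteq> 0" "\<forall>i<n. N * c i = (\<Sum>f\<in>F. a f * f i)"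
    have c: "of_int N * dot n c x = (\<Sum>f\<in>F. of_int (a f) * dot n f x)" for x :: "nat \<Rightarrow> 'b::comm_ring_1"
    proof -
      have "of_int N * dot n c x = dot n (\<lambda>i. \<Sum>f\<in>F. a f * f i) x"
        unfolding dot_def sum_distrib_left using Na(2)
        by (intro sum.cong refl) (simp flip: mult.assoc of_int_mult of_int_sum)
      thus ?thesis by (simp add: dot_sum_left)
    qed
    show ?thesis
    proof (rule exI[of _ m], intro conjI m(1) allI impI)
      fix s :: "nat \<Rightarrow> 'k" assume s: "\<forall>f\<in>insert c F. dot n f s \<in> \<int>"
      then obtain l :: "nat \<Rightarrow> int" where l: "\<forall>f\<in>F. of_int (dot n f l) = of_int m * dot n f s"
        using m(2) by (meson insertI2)
      have "of_int N * (of_int (dot n c l) :: 'k) = (\<Sum>f\<in>F. of_int (a f) * of_int (dot n f l))"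
        using c[of l] by (simp flip: of_int_mult of_int_sum)
      also have "\<dots> = of_int m * (\<Sum>f\<in>F. of_int (a f) * dot n f s)"
        using l by (simp add: sum_distrib_left mult_ac)
      also have "\<dots> = of_int N * (of_int m * dot n c s)"
        by (simp flip: c)
      finally have "of_int (dot n c l) = of_int m * dot n c s"
        using Na(1) by simp
      with l show "\<exists>l :: nat \<Rightarrow> int. \<forall>f\<in>insert c F. of_int (dot n f l) = of_int m * dot n f s" by auto
    qed
  next
    fix v assume v: "\<forall>f\<in>F. dot n f v = 0" "dot n c v \<noteq> (0::int)"
    let ?e = "dot n c v"
    show ?thesis
    \<comment> \<open>the factor \<open>?e\<close> makes the correction integral; its square is positive\<close>
    proof (rule exI[of _ "?e * ?e * m"], intro conjI allI impI)
      show "?e * ?e * m > 0" using v m(1) by (auto simp: zero_less_mult_iff)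
      fix s :: "nat \<Rightarrow> 'k" assume s: "\<forall>f\<in>insert c F. dot n f s \<in> \<int>"
      then obtain l :: "nat \<Rightarrow> int" where l: "\<forall>f\<in>F. of_int (dot n f l) = of_int m * dot n f s"
        using m(2) by (meson insertI2)
      obtain z where z: "dot n c s = of_int z" using s by (auto elim: Ints_cases)
      define w where "w = (\<lambda>i. (?e * ?e) * l i + (?e * m * z - ?e * dot n c l) * v i)"
      have "dot n c w = ?e * ?e * m * z"
        unfolding w_def dot_lin by (simp add: algebra_simps)
      moreover have "dot n f w = ?e * ?e * dot n f l" if "f \<in> F" for f
        unfolding w_def dot_lin using v(1) that by simp
      ultimately show "\<exists>l :: nat \<Rightarrow> int. \<forall>f\<in>insert c F. of_int (dot n f l) = of_int (?e * ?e * m) * dot n f s"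
        using l z by (intro exI[of _ w]) (auto simp: mult_ac)
    qed
  qed
qed

text \<open>Which forms are integral at \<open>s\<close> depends on \<open>s\<close>; the product over all subsets of the bounds from
  \<open>integral_point_aux\<close> serves every \<open>s\<close>.\<close>

lemma integral_point:
  assumes "finite C"
  obtains m :: nat where "m > 0"
    "\<And>s :: nat \<Rightarrow> 'k::field_char_0. \<exists>l :: nat \<Rightarrow> int. \<forall>c\<in>C. dot n c s \<in> \<int> \<longrightarrow>
       of_int (dot n c l) = of_nat m * dot n c s"
proof -
  define P where "P = (\<lambda>F (m::int). m > 0 \<and> (\<forall>s :: nat \<Rightarrow> 'k. (\<forall>f\<in>F. dot n f s \<in> \<int>) \<longrightarrow>
    (\<exists>l :: nat \<Rightarrow> int. \<forall>f\<in>F. of_int (dot n f l) = of_int m * dot n f s)))"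
  have "\<exists>M. \<forall>F\<in>Pow C. P F (M F)"
  proof (intro bchoice ballI)
    fix F assume "F \<in> Pow C"
    hence "finite F" using assms by (auto intro: finite_subset)
    from integral_point_aux[OF this, of n] show "\<exists>m. P F m" unfolding P_def .
  qed
  then obtain M where "\<forall>F\<in>Pow C. P F (M F)" ..
  hence M: "\<And>F. F \<in> Pow C \<Longrightarrow> M F > (0::int)"
    "\<And>F s. F \<in> Pow C \<Longrightarrow> \<forall>f\<in>F. dot n f (s :: nat \<Rightarrow> 'k) \<in> \<int> \<Longrightarrow>
       \<exists>l :: nat \<Rightarrow> int. \<forall>f\<in>F. of_int (dot n f l) = of_int (M F) * dot n f s"
    by (simp_all add: P_def)
  define m where "m = (\<Prod>F\<in>Pow C. M F)"
  have m: "m > 0" unfolding m_def using M by (intro prod_pos) auto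
  show ?thesis
  proof (rule that[of "nat m"])
    show "nat m > 0" using m by simp
    fix s :: "nat \<Rightarrow> 'k"
    define F where "F = {c\<in>C. dot n c s \<in> \<int>}"
    have F: "F \<in> Pow C" by (auto simp: F_def)
    from M(2)[OF F, of s] obtain l :: "nat \<Rightarrow> int" where l: "\<forall>f\<in>F. of_int (dot n f l) = of_int (M F) * dot n f s"
      by (auto simp: F_def)
    define r where "r = (\<Prod>F\<in>Pow C - {F}. M F)"
    have mr: "m = r * M F" unfolding m_def r_def
      using F assms by (subst prod.remove[of _ F]) (auto simp: mult.commute)
    have "dot n c (\<lambda>i. r * l i) = r * dot n c l" for c
      using dot_lin[of n c r l 0] by simp
    hence "of_int (dot n c (\<lambda>i. r * l i)) = of_nat (nat m) * dot n c s" if "c \<in> F" for c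
      using l that m by (simp add: of_nat_nat mr)
    thus "\<exists>l :: nat \<Rightarrow> int. \<forall>c\<in>C. dot n c s \<in> \<int> \<longrightarrow> of_int (dot n c l) = of_nat (nat m) * dot n c s"
      by (intro exI[of _ "\<lambda>i. r * l i"]) (auto simp: F_def)
  qed
qed

section \<open>Weights of monomials\<close>

text \<open>The row degrees of a monomial, paired with \<open>s\<close>.\<close>

definition wt :: "(nat \<Rightarrow> 'a::comm_ring_1) \<Rightarrow> ((nat \<times> nat) \<Rightarrow>\<^sub>0 nat) \<Rightarrow> 'a" where
  "wt s t = (\<Sum>ij\<in>keys t. of_nat (lookup t ij) * s (fst ij))"

definition component :: "(nat \<Rightarrow> 'a::comm_ring_1) \<Rightarrow> 'a \<Rightarrow> 'k::comm_ring_1 mat_poly \<Rightarrow> 'k mat_poly" where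
  "component s \<mu> p = (\<Sum>t\<in>{t\<in>keys p. wt s t = \<mu>}.
     single t (lookup p t))"

lemma monomial_eq_prod_var: "single t (1::'k::comm_ring_1) = (\<Prod>ij\<in>keys t. var ij ^ lookup t ij)"
  using ev_var_cst[of "single t (1::'k)"]
    comm_ring_hom.ev_single[OF cst_comm_ring_hom, of var t "1::'k"]
  by (simp add: monval_def)

text \<open>A monomial is a product of variables and its weight is the sum of theirs.\<close>

lemma weight_induct:
  fixes P :: "'a::comm_ring_1 \<Rightarrow> 'k::comm_ring_1 mat_poly \<Rightarrow> bool"
  assumes one: "P 0 1" and mult: "\<And>\<mu> \<nu> v w. P \<mu> v \<Longrightarrow> P \<nu> w \<Longrightarrow> P (\<mu> + \<nu>) (v * w)"
    and var: "\<And>a b. a < n \<Longrightarrow> b < n \<Longrightarrow> P (s a) (var (a, b))"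
    and t: "keys t \<subseteq> idx n"
  shows "P (wt s t) (single t 1)"
proof -
  have pow: "P (of_nat e * s a) (var (a, b) ^ e)" if "a < n" "b < n" for a b e
    by (induction e) (use one mult[OF var[OF that]] in \<open>simp_all add: distrib_right\<close>)
  have "finite S \<Longrightarrow> S \<subseteq> idx n \<Longrightarrow>
      P (\<Sum>ij\<in>S. of_nat (f ij) * s (fst ij)) (\<Prod>ij\<in>S. var ij ^ f ij)" for S :: "(nat \<times> nat) set" and f
    by (induction S rule: finite_induct) (auto intro!: one mult pow)
  thus ?thesis unfolding monomial_eq_prod_var wt_def using t by simp
qed

lemma sum_components:
  assumes "finite W" "wt s ` keys p \<subseteq> W"
  shows "(\<Sum>\<mu>\<in>W. component s \<mu> p) = p"
  unfolding component_def using assms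
  by (subst (2) mat_poly_sum_monomials[of p]) (rule sum.group, auto)

text \<open>The shape of a Jordan matrix that matters here: each vector of the standard basis is a generalised left
  eigenvector, with eigenvalue the diagonal entry.\<close>

definition eigen_triangular :: "nat \<Rightarrow> (nat \<Rightarrow> 'k) \<Rightarrow> 'k::comm_ring_1 mat \<Rightarrow> bool" where
  "eigen_triangular n s J \<longleftrightarrow> J \<in> carrier_mat n n \<and> (\<forall>a<n. J $$ (a, a) = s a) \<and>
     (\<forall>a<n. \<forall>c<n. a \<noteq> c \<longrightarrow> J $$ (a, c) \<noteq> 0 \<longrightarrow> a < c \<and> s a = s c)"

lemma mat_poly_vector_space: "vector_space (\<lambda>(c::'k::field) (p :: 'k mat_poly). cst c * p)"
  by unfold_locales (simp_all add: distrib_left distrib_right single_add mult_single flip: mult.assoc)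

lemma lder_linear_operator:
  "linear_operator (\<lambda>(c::'k::field) (p :: 'k mat_poly). cst c * p) (lder n J)"
  unfolding linear_operator_def linear_operator_axioms_def
  by (simp add: mat_poly_vector_space lder_add lder_cst_mult)

context matrix_group
begin

text \<open>By the product rule, a product of generalised eigenvectors of the derivation \<open>lder J\<close> is again one, and
  the eigenvalues add up.  So monomials are generalised eigenvectors with eigenvalue their weight, and the
  ideal, being stable under \<open>lder J\<close>, contains the components of its elements.\<close>

lemma component_vanishing:
  assumes J: "eigen_triangular n s J" and Jlie: "J \<in> \<gg>" and p: "p \<in> I"
  shows "component s \<mu> p \<in> I"
proof -
  interpret V: linear_operator "\<lambda>(c::'k) (p :: 'k mat_poly). cst c * p" "lder n J"
    by (rule lder_linear_operator)
  have Jd: "\<And>a. a < n \<Longrightarrow> J $$ (a, a) = s a"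
    "\<And>a c. a < n \<Longrightarrow> c < n \<Longrightarrow> a \<noteq> c \<Longrightarrow> J $$ (a, c) \<noteq> 0 \<Longrightarrow> a < c \<and> s a = s c"
    using J by (auto simp: eigen_triangular_def)
  have stable: "V.stable I"
    unfolding V.stable_def V.subspace_def
    using I_0 I_add I_mult[OF _ mat_polys_closed(3)] lder_vanishing[OF Jlie] by blast
  have mult_aux: "(V.shift \<mu> ^^ k) v = 0 \<Longrightarrow> (V.shift \<nu> ^^ l) w = 0 \<Longrightarrow> v * w \<in> V.gen_eigenspace (\<mu> + \<nu>)"
    for \<mu> \<nu> k l v w
  proof (induction "k + l" arbitrary: k l v w)
    case 0
    thus ?case by simp
  next
    case (Suc m)
    show ?case
    proof (cases "k = 0 \<or> l = 0")
      case True
      thus ?thesis using Suc.prems by auto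
    next
      case False
      then obtain k' l' where [simp]: "k = Suc k'" "l = Suc l'" by (metis not0_implies_Suc)
      have "V.shift (\<mu> + \<nu>) (v * w) = V.shift \<mu> v * w + v * V.shift \<nu> w"
        unfolding V.shift_def by (simp add: lder_mult single_add algebra_simps)
      moreover have "V.shift \<mu> v * w \<in> V.gen_eigenspace (\<mu> + \<nu>)"
        using Suc.hyps(2) Suc.prems by (intro Suc.hyps(1)[of k' l]) (auto simp: funpow_swap1)
      moreover have "v * V.shift \<nu> w \<in> V.gen_eigenspace (\<mu> + \<nu>)"
        using Suc.hyps(2) Suc.prems by (intro Suc.hyps(1)[of k l']) (auto simp: funpow_swap1)
      ultimately have "V.shift (\<mu> + \<nu>) (v * w) \<in> V.gen_eigenspace (\<mu> + \<nu>)"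
        by (simp only: V.gen_eigenspace_add)
      thus ?thesis by (rule V.gen_eigenspace_shiftD)
    qed
  qed
  have var: "var (a, b) \<in> V.gen_eigenspace (s a)" if "a < n" "b < n" for a b
    using that(1)
  proof (induction "n - a" arbitrary: a rule: less_induct)
    case less
    have "V.shift (s a) (var (a, b)) = (\<Sum>c<n. cst (J $$ (a, c)) * var (c, b)) - cst (J $$ (a, a)) * var (a, b)"
      using less.prems that Jd by (simp add: V.shift_def lder_var)
    also have "\<dots> = (\<Sum>c\<in>{..<n} - {a}. cst (J $$ (a, c)) * var (c, b))"
      using less.prems by (subst sum.remove[of _ a]) auto
    also have "\<dots> \<in> V.gen_eigenspace (s a)"
    proof (intro V.gen_eigenspace_sum)
      fix c assume c: "c \<in> {..<n} - {a}"
      show "cst (J $$ (a, c)) * var (c, b) \<in> V.gen_eigenspace (s a)"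
      proof (cases "J $$ (a, c) = 0")
        case False
        with Jd(2)[of a c] c less.prems have "a < c" "s a = s c" by auto
        with less.hyps[of c] c less.prems show ?thesis
          by (auto intro!: V.gen_eigenspace_scale)
      qed simp
    qed
    finally show ?case by (rule V.gen_eigenspace_shiftD)
  qed
  have mono: "single t 1 \<in> V.gen_eigenspace (wt s t)"
    if "keys t \<subseteq> idx n" for t
  proof (rule weight_induct[where P = "\<lambda>\<mu> v. v \<in> V.gen_eigenspace \<mu>", OF _ _ var that])
    have "V.shift 0 1 = 0" using lder_cst[of n J 1] by (simp add: V.shift_def)
    hence "(V.shift 0 ^^ 1) 1 = 0" by simp
    thus "1 \<in> V.gen_eigenspace 0" unfolding V.gen_eigenspace_def by blast
    show "v * w \<in> V.gen_eigenspace (\<mu> + \<nu>)"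
      if "v \<in> V.gen_eigenspace \<mu>" "w \<in> V.gen_eigenspace \<nu>" for \<mu> \<nu> v w
      using that mult_aux unfolding V.gen_eigenspace_def by blast
  qed
  have comp: "component s \<mu> p \<in> V.gen_eigenspace \<mu>" for \<mu>
    unfolding component_def
  proof (intro V.gen_eigenspace_sum)
    fix t assume t: "t \<in> {t\<in>keys p. wt s t = \<mu>}"
    have "cst (lookup p t) * single t 1 \<in> V.gen_eigenspace \<mu>"
      using mono[of t] t I_mat_polys[OF p] by (intro V.gen_eigenspace_scale) (auto simp: mat_polys_def)
    thus "single t (lookup p t) \<in> V.gen_eigenspace \<mu>"
      by (simp add: mult_single)
  qed
  let ?W = "insert \<mu> (wt s ` keys p)"
  have "(\<Sum>\<mu>\<in>?W. component s \<mu> p) \<in> I"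
    using p by (subst sum_components) auto
  thus ?thesis
    by (rule V.stable_component[OF stable, rotated 2]) (auto intro: comp)
qed

end

section \<open>Diagonal elements and cocharacters\<close>

definition diag_of :: "nat \<Rightarrow> (nat \<Rightarrow> 'a::zero) \<Rightarrow> 'a mat" where
  "diag_of n l = mat n n (\<lambda>(i, j). if i = j then l i else 0)"

lemma diag_of_carrier [simp]: "diag_of n l \<in> carrier_mat n n"
  by (simp add: diag_of_def)

lemma diag_of_index [simp]: "i < n \<Longrightarrow> j < n \<Longrightarrow> diag_of n l $$ (i, j) = (if i = j then l i else 0)"
  by (simp add: diag_of_def)

lemma diag_of_eigen_triangular: "eigen_triangular n l (diag_of n l)"
  by (auto simp: eigen_triangular_def)

lemma lder_diag_of_monomial:
  fixes l :: "nat \<Rightarrow> 'k::comm_ring_1"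
  assumes "keys t \<subseteq> idx n"
  shows "lder n (diag_of n l) (single t c) = cst (wt l t) * single t c"
proof -
  have "lder n (diag_of n l) (single t 1) = cst (wt l t) * single t 1"
  proof (rule weight_induct[where P = "\<lambda>\<mu> v. lder n (diag_of n l) v = cst \<mu> * v", OF _ _ _ assms])
    show "lder n (diag_of n l) 1 = cst 0 * 1" using lder_cst[of n "diag_of n l" 1] by simp
    show "lder n (diag_of n l) (v * w) = cst (\<mu> + \<nu>) * (v * w)"
      if "lder n (diag_of n l) v = cst \<mu> * v" "lder n (diag_of n l) w = cst \<nu> * w" for \<mu> \<nu> v w
      using that by (simp add: lder_mult single_add algebra_simps)
    show "lder n (diag_of n l) (var (a, b)) = cst (l a) * var (a, b)" if "a < n" "b < n" for a b
    proof -
      have "lder n (diag_of n l) (var (a, b)) = (\<Sum>d<n. if d = a then cst (l a) * var (a, b) else 0)"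
        unfolding lder_var[OF that] using that by (intro sum.cong) auto
      thus ?thesis using that by simp
    qed
  qed
  from arg_cong[OF this, of "\<lambda>v. cst c * v"] show ?thesis
    by (simp add: mult_single mult.commute flip: lder_cst_mult)
qed

text \<open>The total degree bounds all row degrees and is not raised by linear substitutions; the lists of row
  degrees that occur up to a given degree are therefore finite in number in every basis.\<close>

definition tdeg :: "((nat \<times> nat) \<Rightarrow>\<^sub>0 nat) \<Rightarrow> nat" where
  "tdeg t = (\<Sum>ij\<in>keys t. lookup t ij)"

definition deg_le :: "nat \<Rightarrow> 'k::zero mat_poly \<Rightarrow> bool" where
  "deg_le d p \<longleftrightarrow> (\<forall>t\<in>keys p. tdeg t \<le> d)"

lemma tdeg_superset: "finite S \<Longrightarrow> keys t \<subseteq> S \<Longrightarrow> tdeg t = (\<Sum>ij\<in>S. lookup t ij)"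
  unfolding tdeg_def by (rule sum.mono_neutral_left) (auto simp: in_keys_iff)

lemma tdeg_add: "tdeg (s + t) = tdeg s + tdeg t"
proof -
  let ?S = "keys s \<union> keys t"
  have "tdeg (s + t) = (\<Sum>ij\<in>?S. lookup (s + t) ij)"
    by (rule tdeg_superset) (use keys_add[of s t] in auto)
  thus ?thesis by (simp add: lookup_add sum.distrib tdeg_superset[of ?S])
qed

lemma deg_le_add: "deg_le d p \<Longrightarrow> deg_le d q \<Longrightarrow> deg_le d (p + q)"
  using keys_add[of p q] by (auto simp: deg_le_def)

lemma deg_le_mult: "deg_le d p \<Longrightarrow> deg_le e q \<Longrightarrow> deg_le (d + e) (p * q)"
  using keys_mult[of p q] by (fastforce simp: deg_le_def tdeg_add intro: add_mono)

lemma deg_le_sum: "(\<And>x. x \<in> S \<Longrightarrow> deg_le d (f x)) \<Longrightarrow> deg_le d (sum f S)"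
  by (induction S rule: infinite_finite_induct) (auto intro: deg_le_add, auto simp: deg_le_def)

lemma deg_le_cst: "deg_le 0 (cst c)"
  by (auto simp: deg_le_def tdeg_def)

lemma deg_le_var: "deg_le 1 (var ij)"
  by (auto simp: deg_le_def tdeg_def var_def)

lemma deg_le_mono: "deg_le d p \<Longrightarrow> d \<le> e \<Longrightarrow> deg_le e p"
  by (auto simp: deg_le_def)

lemma deg_le_1: "deg_le 0 (1::'k::comm_ring_1 mat_poly)"
  using deg_le_cst[of "1::'k"] by simp

lemma deg_le_ev:
  fixes p :: "'k::comm_ring_1 mat_poly"
  assumes "deg_le d p" "\<And>ij. deg_le 1 (v ij)"
  shows "deg_le d (ev cst v p)"
  unfolding ev_def
proof (rule deg_le_sum)
  fix t assume t: "t \<in> keys p"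
  have pow: "deg_le e (v ij ^ e)" for ij e
  proof (induction e)
    case (Suc e)
    show ?case using deg_le_mult[OF assms(2)[of ij] Suc.IH] by simp
  qed (simp add: deg_le_1)
  have "finite S \<Longrightarrow> deg_le (\<Sum>ij\<in>S. f ij) (\<Prod>ij\<in>S. v ij ^ f ij)" for S and f :: "nat \<times> nat \<Rightarrow> nat"
    by (induction S rule: finite_induct) (auto intro: deg_le_1 deg_le_mult pow)
  hence "deg_le (tdeg t) (monval v t)" unfolding monval_def tdeg_def by simp
  hence "deg_le (0 + tdeg t) (cst (lookup p t) * monval v t)"
    by (rule deg_le_mult[OF deg_le_cst])
  thus "deg_le d (cst (lookup p t) * monval v t)"
    by (rule deg_le_mono) (use t assms(1) in \<open>auto simp: deg_le_def\<close>)
qed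

lemma deg_le_tr:
  fixes p :: "'k::comm_ring_1 mat_poly"
  assumes "deg_le d p" shows "deg_le d (tr n a b p)"
  unfolding tr_def
proof (rule deg_le_ev[OF assms], intro deg_le_sum)
  fix ij :: "nat \<times> nat" and c e
  have "deg_le (0 + 1 + 0) (cst (a $$ (fst ij, c)) * var (c, e) * cst (b $$ (e, snd ij)))"
    by (intro deg_le_mult deg_le_cst deg_le_var)
  thus "deg_le 1 (cst (a $$ (fst ij, c)) * var (c, e) * cst (b $$ (e, snd ij)))" by simp
qed

text \<open>Elimination of one coordinate at a time.\<close>

lemma finite_functionals:
  fixes \<Lambda> :: "('a \<Rightarrow> 'k::field) set"
  assumes "finite A"
  shows "\<exists>F\<subseteq>\<Lambda>. finite F \<and> (\<forall>x. (\<forall>f\<in>F. (\<Sum>a\<in>A. x a * f a) = 0) \<longrightarrow> (\<forall>f\<in>\<Lambda>. (\<Sum>a\<in>A. x a * f a) = 0))"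
  using assms
proof (induction A arbitrary: \<Lambda> rule: finite_induct)
  case empty
  show ?case by (intro exI[of _ "{}"]) auto
next
  case (insert a A)
  show ?case
  proof (cases "\<forall>f\<in>\<Lambda>. f a = 0")
    case True
    from insert.IH[of \<Lambda>] obtain F where F: "F \<subseteq> \<Lambda>" "finite F"
      "\<And>x. \<forall>f\<in>F. (\<Sum>a\<in>A. x a * f a) = 0 \<Longrightarrow> \<forall>f\<in>\<Lambda>. (\<Sum>a\<in>A. x a * f a) = 0" by metis
    have "(\<Sum>b\<in>insert a A. x b * f b) = (\<Sum>b\<in>A. x b * f b)" if "f \<in> \<Lambda>" for x f
      using True that insert.hyps by simp
    with F show ?thesis by (intro exI[of _ F]) (auto simp: subset_iff)
  next
    case False
    then obtain f0 where f0: "f0 \<in> \<Lambda>" "f0 a \<noteq> 0" by auto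
    define r where "r = (\<lambda>f b. f b - f a / f0 a * f0 b)"
    from insert.IH[of "r ` \<Lambda>"] obtain F where F: "F \<subseteq> r ` \<Lambda>" "finite F"
      "\<And>x. \<forall>f\<in>F. (\<Sum>a\<in>A. x a * f a) = 0 \<Longrightarrow> \<forall>f\<in>r ` \<Lambda>. (\<Sum>a\<in>A. x a * f a) = 0" by metis
    from finite_subset_image[OF F(2,1)] obtain F' where F': "F' \<subseteq> \<Lambda>" "finite F'" "F = r ` F'" by blast
    have r: "(\<Sum>b\<in>A. x b * r f b) = (\<Sum>b\<in>insert a A. x b * f b) - f a / f0 a * (\<Sum>b\<in>insert a A. x b * f0 b)" for x f
    proof -
      have "r f a = 0" using f0 by (simp add: r_def)
      hence "(\<Sum>b\<in>A. x b * r f b) = (\<Sum>b\<in>insert a A. x b * r f b)"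
        using insert.hyps by simp
      also have "\<dots> = (\<Sum>b\<in>insert a A. x b * f b) - f a / f0 a * (\<Sum>b\<in>insert a A. x b * f0 b)"
        unfolding sum_distrib_left sum_subtractf[symmetric] by (intro sum.cong) (auto simp: r_def algebra_simps)
      finally show ?thesis .
    qed
    have "\<forall>f\<in>\<Lambda>. (\<Sum>b\<in>insert a A. x b * f b) = 0"
      if x: "\<forall>f\<in>insert f0 F'. (\<Sum>b\<in>insert a A. x b * f b) = 0" for x
    proof
      fix f assume f: "f \<in> \<Lambda>"
      have "\<forall>f\<in>F. (\<Sum>a\<in>A. x a * f a) = 0"
        unfolding F' using x by (auto simp only: ball_simps r insert_iff mult_zero_right diff_self)
      hence "(\<Sum>b\<in>A. x b * r f b) = 0" using F(3)[of x] f by blast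
      thus "(\<Sum>b\<in>insert a A. x b * f b) = 0" using x unfolding r by auto
    qed
    moreover have "insert f0 F' \<subseteq> \<Lambda>" "finite (insert f0 F')" using F' f0 by auto
    ultimately show ?thesis by (intro exI[of _ "insert f0 F'"] conjI allI impI)
  qed
qed

text \<open>The polynomials of degree at most \<open>d\<close> in the ideal cut out the Lie algebra.\<close>

definition lie_degree :: "nat \<Rightarrow> 'k::field mat set \<Rightarrow> nat \<Rightarrow> bool" where
  "lie_degree n G d \<longleftrightarrow> (\<forall>X\<in>carrier_mat n n.
     (\<forall>p\<in>vanishing_ideal n G. deg_le d p \<longrightarrow> ev_one n (lder n X p) = 0) \<longrightarrow> X \<in> lie_algebra n G)"

context matrix_group
begin

text \<open>The differentials at 1 of the polynomials in the ideal live in a space of finite dimension, so finitely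
  many of them suffice.\<close>

lemma ex_lie_degree: "\<exists>d. lie_degree n G d"
proof -
  define \<omega> where "\<omega> = (\<lambda>p ij. ev_one n (pd ij p) :: 'k)"
  let ?A = "idx n"
  from finite_functionals[of ?A "\<omega> ` I"] obtain F where F: "F \<subseteq> \<omega> ` I" "finite F"
    "\<And>x. \<forall>f\<in>F. (\<Sum>a\<in>?A. x a * f a) = 0 \<Longrightarrow> \<forall>f\<in>\<omega> ` I. (\<Sum>a\<in>?A. x a * f a) = 0" by auto
  from finite_subset_image[OF F(2,1)] obtain P where P: "P \<subseteq> I" "finite P" "F = \<omega> ` P" by blast
  define d where "d = Max (insert 0 (tdeg ` (\<Union>p\<in>P. keys p)))"
  have d: "deg_le d p" if "p \<in> P" for p
    unfolding deg_le_def d_def using P(2) that by (auto intro!: Max_ge)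
  have "lie_degree n G d"
    unfolding lie_degree_def
  proof (intro ballI impI)
    fix X :: "'k mat" assume X: "X \<in> carrier_mat n n"
      "\<forall>p\<in>I. deg_le d p \<longrightarrow> ev_one n (lder n X p) = 0"
    have "\<forall>f\<in>F. (\<Sum>a\<in>?A. X $$ a * f a) = 0"
      using X(2) P d unfolding ev_one_lder[OF X(1)] P(3) \<omega>_def by blast
    from F(3)[OF this] show "X \<in> \<gg>"
      using X(1) by (auto simp: lie_iff \<omega>_def)
  qed
  thus ?thesis ..
qed

text \<open>On a weight component for \<open>s\<close> of a polynomial of degree at most \<open>d\<close>, the weight for \<open>l\<close> is constant, so
  the derivation \<open>lder (diag l)\<close> acts on it as a scalar.  It therefore maps the polynomial into the
  ideal, and its value at 1 vanishes.\<close>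

lemma diagonal_in_lie:
  assumes J: "eigen_triangular n s J" "J \<in> \<gg>" and d: "lie_degree n G d"
    and l: "\<And>t t'. keys t \<subseteq> idx n \<Longrightarrow> keys t' \<subseteq> idx n \<Longrightarrow>
      tdeg t \<le> d \<Longrightarrow> tdeg t' \<le> d \<Longrightarrow> wt s t = wt s t' \<Longrightarrow> wt l t = wt l t'"
  shows "diag_of n l \<in> \<gg>"
proof -
  have "ev_one n (lder n (diag_of n l) p) = 0" if p: "p \<in> I" "deg_le d p" for p
  proof -
    let ?K = "keys p"
    have K: "keys t \<subseteq> idx n" "tdeg t \<le> d" if "t \<in> ?K" for t
      using I_mat_polys[OF p(1)] p(2) that by (auto simp: mat_polys_def deg_le_def)
    have "\<exists>c. lder n (diag_of n l) (component s \<mu> p) = cst c * component s \<mu> p" if \<mu>: "\<mu> \<in> wt s ` ?K" for \<mu>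
    proof -
      from \<mu> obtain t0 where t0: "t0 \<in> ?K" "\<mu> = wt s t0" by auto
      have "lder n (diag_of n l) (component s \<mu> p) = (\<Sum>t\<in>{t\<in>?K. wt s t = \<mu>}. cst (wt l t) * single t (lookup p t))"
        unfolding component_def lder_sum by (intro sum.cong refl lder_diag_of_monomial) (use K in auto)
      also have "\<dots> = (\<Sum>t\<in>{t\<in>?K. wt s t = \<mu>}. cst (wt l t0) * single t (lookup p t))"
      proof (intro sum.cong refl)
        fix t assume "t \<in> {t\<in>?K. wt s t = \<mu>}"
        hence "wt l t = wt l t0" using t0 by (intro l K) auto
        thus "cst (wt l t) * single t (lookup p t) = cst (wt l t0) * single t (lookup p t)" by simp
      qed
      also have "\<dots> = cst (wt l t0) * component s \<mu> p"
        by (simp add: component_def sum_distrib_left)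
      finally show ?thesis by blast
    qed
    hence *: "lder n (diag_of n l) (component s \<mu> p) \<in> I" if "\<mu> \<in> wt s ` ?K" for \<mu>
      using that component_vanishing[OF J p(1)] I_mult[OF _ mat_polys_closed(3)] by metis
    have "lder n (diag_of n l) p = (\<Sum>\<mu>\<in>wt s ` ?K. lder n (diag_of n l) (component s \<mu> p))"
      by (subst sum_components[of "wt s ` ?K" s p, symmetric]) (simp_all add: lder_sum)
    also have "\<dots> \<in> I"
    proof -
      have "finite S \<Longrightarrow> (\<And>x. x \<in> S \<Longrightarrow> f x \<in> I) \<Longrightarrow> sum f S \<in> I" for S :: "'k set" and f
        by (induction S rule: finite_induct) (auto intro: I_0 I_add)
      thus ?thesis using * by simp
    qed
    finally show ?thesis by (rule I_one)
  qed
  thus ?thesis using d unfolding lie_degree_def by auto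
qed

text \<open>A weight component \<open>p\<^sub>w\<close> satisfies \<open>p\<^sub>w (z\<^sup>l) = z\<^sup>w p\<^sub>w (1)\<close>, and \<open>p\<^sub>w (1) = 0\<close> because \<open>p\<^sub>w\<close> lies in the ideal.\<close>

lemma cocharacter_in_loop_group:
  fixes l :: "nat \<Rightarrow> int"
  assumes "diag_of n (\<lambda>i. of_int (l i)) \<in> \<gg>"
  shows "diag_of n (\<lambda>i. fls_X_intpow (l i)) \<in> loop_group n G"
proof -
  interpret C: comm_ring_hom "fls_const :: 'k \<Rightarrow> 'k fls" by (rule fls_const_comm_ring_hom)
  interpret I: comm_ring_hom "id :: 'k \<Rightarrow> 'k" by (rule id_hom)
  define x :: "'k fls mat" where "x = diag_of n (\<lambda>i. fls_X_intpow (l i))"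
  define s :: "nat \<Rightarrow> 'k" where "s = (\<lambda>i. of_int (l i))"
  \<comment> \<open>a name for the powers of \<open>z\<close> hides that \<open>fls_X_intpow\<close> abbreviates a shift, which the simplifier moves\<close>
  define z :: "int \<Rightarrow> 'k fls" where "z = (\<lambda>a. fls_X_intpow a)"
  have z_mult: "z a * z b = z (a + b)" and z_0: "z 0 = 1" for a b
    by (simp_all add: z_def fls_X_intpow_times_fls_X_intpow)
  have x_z: "x = diag_of n (\<lambda>i. z (l i))" by (simp add: x_def z_def)
  have x: "x \<in> carrier (GL n)"
  proof -
    have dgm: "diag_of n (\<lambda>i. z (f i)) * diag_of n (\<lambda>i. z (- f i)) = (1\<^sub>m n :: 'k fls mat)" for f
    proof (rule eq_mat_square)
      fix i j assume ij: "i < n" "j < n"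
      have "(diag_of n (\<lambda>i. z (f i)) * diag_of n (\<lambda>i. z (- f i))) $$ (i, j) =
         (\<Sum>c<n. if c = i then (if i = j then z (f i) * z (- f i) else 0) else (0 :: 'k fls))"
        unfolding index_mult_mat_sum[OF diag_of_carrier diag_of_carrier ij] by (intro sum.cong refl) (use ij in auto)
      also have "\<dots> = (1\<^sub>m n :: 'k fls mat) $$ (i, j)" using ij by (simp add: z_mult z_0)
      finally show "(diag_of n (\<lambda>i. z (f i)) * diag_of n (\<lambda>i. z (- f i))) $$ (i, j) = (1\<^sub>m n :: 'k fls mat) $$ (i, j)" .
    qed (auto simp: diag_of_def)
    show ?thesis unfolding carrier_GL x_z
      using dgm[of l] dgm[of "\<lambda>i. - l i"] by (auto intro!: bexI[of _ "diag_of n (\<lambda>i. z (- l i))"])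
  qed
  have "ev fls_const (\<lambda>ij. x $$ ij) p = 0" if p: "p \<in> I" for p
  proof -
    let ?K = "keys p"
    have monval_x: "monval (\<lambda>ij. x $$ ij) t = z (wt l t) * fls_const (monval (\<lambda>ij. 1\<^sub>m n $$ ij) t)"
      if t: "keys t \<subseteq> idx n" for t
    proof -
      have pw: "(z a :: 'k fls) ^ e = z (of_nat e * a)" for a e
        by (induction e) (simp_all add: z_mult z_0 distrib_right)
      have pr: "finite S \<Longrightarrow> (\<Prod>ij\<in>S. z (f ij) :: 'k fls) = z (\<Sum>ij\<in>S. f ij)" for S :: "(nat \<times> nat) set" and f
        by (induction S rule: finite_induct) (simp_all add: z_mult z_0)
      have "monval (\<lambda>ij. x $$ ij) t = (\<Prod>ij\<in>keys t. z (l (fst ij)) ^ lookup t ij * fls_const (1\<^sub>m n $$ ij) ^ lookup t ij)"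
        unfolding monval_def using t
        by (intro prod.cong refl) (auto simp: x_z subset_iff simp flip: power_mult_distrib)
      thus ?thesis
        by (simp add: prod.distrib pw pr wt_def monval_def C.hom_prod C.hom_power)
    qed
    have wt_s: "wt s t = of_int (wt l t)" for t
      by (simp add: wt_def s_def)
    have "ev fls_const (\<lambda>ij. x $$ ij) (component s \<mu> p) = 0" if \<mu>: "\<mu> \<in> wt s ` ?K" for \<mu>
    proof -
      from \<mu> obtain t0 where t0: "t0 \<in> ?K" "\<mu> = wt s t0" by auto
      have "ev fls_const (\<lambda>ij. x $$ ij) (component s \<mu> p) =
         (\<Sum>t\<in>{t\<in>?K. wt s t = \<mu>}. z (wt l t0) * fls_const (lookup p t * monval (\<lambda>ij. 1\<^sub>m n $$ ij) t))"
        unfolding component_def C.ev_sum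
      proof (intro sum.cong refl)
        fix t assume t: "t \<in> {t\<in>?K. wt s t = \<mu>}"
        hence "wt l t = wt l t0" using t0 by (simp add: wt_s)
        moreover have "keys t \<subseteq> idx n" using t I_mat_polys[OF p] by (auto simp: mat_polys_def)
        ultimately show "ev fls_const (\<lambda>ij. x $$ ij) (single t (lookup p t)) =
            z (wt l t0) * fls_const (lookup p t * monval (\<lambda>ij. 1\<^sub>m n $$ ij) t)"
          by (simp add: monval_x C.hom_mult mult_ac del: fls_const_mult_const)
      qed
      also have "\<dots> = z (wt l t0) * fls_const (ev_one n (component s \<mu> p))"
        by (simp add: component_def I.ev_sum C.hom_sum sum_distrib_left)
      also have "ev_one n (component s \<mu> p) = 0"
        using assms by (intro I_one component_vanishing[OF diag_of_eigen_triangular _ p]) (simp add: s_def)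
      finally show ?thesis by simp
    qed
    hence "ev fls_const (\<lambda>ij. x $$ ij) (\<Sum>\<mu>\<in>wt s ` ?K. component s \<mu> p) = 0"
      by (simp add: C.ev_sum)
    thus ?thesis by (subst (asm) sum_components) auto
  qed
  with x show ?thesis by (simp add: points_iff x_def)
qed

end

section \<open>Jordan form over an algebraically closed field\<close>

text \<open>If \<open>v\<close> does not vanish at \<open>k\<close>, take \<open>v\<close> and the unit vectors other than the one at \<open>k\<close>.\<close>

lemma invertible_with_first_column:
  fixes v :: "'a::field vec"
  assumes v: "v \<in> carrier_vec (Suc n)" "v \<noteq> 0\<^sub>v (Suc n)"
  obtains P Q where "P \<in> carrier_mat (Suc n) (Suc n)" "Q \<in> carrier_mat (Suc n) (Suc n)"
    "P * Q = 1\<^sub>m (Suc n)" "Q * P = 1\<^sub>m (Suc n)" "col P 0 = v"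
proof -
  let ?N = "Suc n"
  obtain k where k: "k < ?N" "v $ k \<noteq> 0" using v by (metis carrier_vecD eq_vecI index_zero_vec)
  define \<sigma> where "\<sigma> = (\<lambda>j::nat. if j = k then 0 else j)"
  define P where "P = mat ?N ?N (\<lambda>(i, j). if j = 0 then v $ i else if i = \<sigma> j then 1 else (0::'a))"
  have P: "P \<in> carrier_mat ?N ?N" by (simp add: P_def)
  have "det P \<noteq> 0"
  proof
    assume "det P = 0"
    then obtain w where w: "w \<in> carrier_vec ?N" "w \<noteq> 0\<^sub>v ?N" "P *\<^sub>v w = 0\<^sub>v ?N"
      using det_0_iff_vec_prod_zero_field[OF P] by blast
    have row: "v $ i * w $ 0 + (\<Sum>j\<in>{1..<?N}. (if i = \<sigma> j then 1 else 0) * w $ j) = 0" if i: "i < ?N" for i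
    proof -
      have "0 = (P *\<^sub>v w) $ i" using w(3) i by simp
      also have "\<dots> = (\<Sum>j\<in>{0..<?N}. P $$ (i, j) * w $ j)"
        using i P w(1) by (simp add: scalar_prod_def)
      also have "\<dots> = P $$ (i, 0) * w $ 0 + (\<Sum>j\<in>{1..<?N}. P $$ (i, j) * w $ j)"
        by (subst sum.atLeast_Suc_lessThan) auto
      also have "(\<Sum>j\<in>{1..<?N}. P $$ (i, j) * w $ j) = (\<Sum>j\<in>{1..<?N}. (if i = \<sigma> j then 1 else 0) * w $ j)"
        by (intro sum.cong refl) (use i in \<open>auto simp: P_def\<close>)
      finally show ?thesis using i by (simp add: P_def)
    qed
    have "(\<Sum>j\<in>{1..<?N}. (if k = \<sigma> j then 1 else 0) * w $ j) = 0"
      by (intro sum.neutral) (auto simp: \<sigma>_def)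
    with row[OF k(1)] k have w0: "w $ 0 = 0" by simp
    have "w $ j = 0" if j: "j < ?N" for j
    proof (cases "j = 0")
      case False
      have \<sigma>j: "\<sigma> j < ?N" using j by (auto simp: \<sigma>_def)
      have "(\<Sum>i\<in>{1..<?N}. (if \<sigma> j = \<sigma> i then 1 else 0) * w $ i) = (\<Sum>i\<in>{1..<?N}. if i = j then w $ j else 0)"
        using False by (intro sum.cong) (auto simp: \<sigma>_def)
      also have "\<dots> = w $ j" using j False by simp
      finally show ?thesis using row[OF \<sigma>j] w0 by simp
    qed (simp add: w0)
    with w show False by (metis carrier_vecD eq_vecI index_zero_vec)
  qed
  from det_non_zero_imp_unit[OF P this, where b = "()"]
  obtain Q where "Q \<in> carrier_mat ?N ?N" "Q * P = 1\<^sub>m ?N" "P * Q = 1\<^sub>m ?N"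
    by (auto simp: Units_def ring_mat_def)
  moreover have "col P 0 = v"
    using v(1) by (intro eq_vecI) (auto simp: P_def)
  ultimately show ?thesis using P that by blast
qed

lemma conj_inverse:
  fixes A :: "'r::comm_ring_1 mat"
  assumes "P \<in> carrier_mat n n" "Q \<in> carrier_mat n n" "A \<in> carrier_mat n n" "P * Q = 1\<^sub>m n"
  shows "P * (Q * A * P) * Q = A"
proof -
  have "P * (Q * A * P) = P * (Q * (A * P))"
    using assms by (simp add: assoc_mult_mat[of _ n n _ n _ n])
  also have "\<dots> = (P * Q) * (A * P)"
    using assms by (intro assoc_mult_mat[symmetric, of _ n n _ n _ n]) auto
  also have "\<dots> = A * P"
    using assms by (simp add: left_mult_one_mat[of _ n n])
  finally have "P * (Q * A * P) * Q = A * P * Q" by simp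
  also have "\<dots> = A * (P * Q)" using assms by (intro assoc_mult_mat[of _ n n _ n _ n]) auto
  finally show ?thesis using assms by (simp add: right_mult_one_mat[of _ n n])
qed

text \<open>Split off an eigenvector and treat the remaining block by induction.\<close>

lemma similar_upper_triangular:
  fixes A :: "'a::alg_closed_field mat"
  shows "A \<in> carrier_mat n n \<Longrightarrow> \<exists>B\<in>carrier_mat n n. upper_triangular B \<and> similar_mat A B"
proof (induction n arbitrary: A)
  case 0
  thus ?case using similar_mat_refl[OF 0] by (intro bexI[of _ A]) auto
next
  case (Suc n)
  note A = Suc.prems
  have "degree (char_poly A) > 0" using degree_monic_char_poly[OF A] by simp
  from alg_closed_imp_poly_has_root[OF this] obtain e where "poly (char_poly A) e = 0" by blast
  hence "eigenvalue A e" using eigenvalue_root_char_poly[OF A] by blast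
  then obtain v where v: "v \<in> carrier_vec (Suc n)" "v \<noteq> 0\<^sub>v (Suc n)" "A *\<^sub>v v = e \<cdot>\<^sub>v v"
    using A by (auto simp: eigenvalue_def eigenvector_def)
  obtain P Q where PQ: "P \<in> carrier_mat (Suc n) (Suc n)" "Q \<in> carrier_mat (Suc n) (Suc n)"
    "P * Q = 1\<^sub>m (Suc n)" "Q * P = 1\<^sub>m (Suc n)" "col P 0 = v"
    using invertible_with_first_column[OF v(1,2)] by blast
  define B where "B = Q * A * P"
  have B: "B \<in> carrier_mat (Suc n) (Suc n)" using PQ A by (auto simp: B_def)
  have col: "col B 0 = e \<cdot>\<^sub>v unit_vec (Suc n) 0"
  proof -
    have "col B 0 = (Q * A) *\<^sub>v v"
      unfolding B_def using PQ A by (subst col_mult2[of _ "Suc n" "Suc n" _ "Suc n"]) auto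
    also have "\<dots> = Q *\<^sub>v (e \<cdot>\<^sub>v v)"
      using PQ A v by (subst assoc_mult_mat_vec[of _ "Suc n" "Suc n" _ "Suc n"]) auto
    also have "\<dots> = e \<cdot>\<^sub>v (Q *\<^sub>v v)"
      using PQ v by (intro mult_mat_vec[of _ "Suc n" "Suc n"]) auto
    also have "Q *\<^sub>v v = col (Q * P) 0"
      using PQ by (subst col_mult2[of _ "Suc n" "Suc n" _ "Suc n"]) auto
    also have "\<dots> = unit_vec (Suc n) 0" using PQ by simp
    finally show ?thesis .
  qed
  obtain B1 B2 B3 B4 where sp: "split_block B 1 1 = (B1, B2, B3, B4)" by (metis prod_cases4)
  have dims: "dim_row B = 1 + n" "dim_col B = 1 + n" using B by auto
  note bl = split_block[OF sp dims]
  have B3: "B3 = 0\<^sub>m n 1"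
  proof (rule eq_matI)
    fix i j assume ij: "i < dim_row (0\<^sub>m n 1)" "j < dim_col (0\<^sub>m n 1)"
    have "B3 $$ (i, j) = B $$ (Suc i, 0)"
      using ij bl by (subst bl(5)) (auto)
    also have "\<dots> = col B 0 $ Suc i" using ij B by simp
    also have "\<dots> = 0" unfolding col using ij by simp
    finally show "B3 $$ (i, j) = 0\<^sub>m n 1 $$ (i, j)" using ij by simp
  qed (use bl in auto)
  from Suc.IH[OF bl(4)] obtain T where T: "T \<in> carrier_mat n n" "upper_triangular T" "similar_mat B4 T" by blast
  then obtain P2 Q2 where w: "similar_mat_wit B4 T P2 Q2" unfolding similar_mat_def by blast
  from similar_mat_witD2[OF bl(4) w] have P2Q2: "P2 \<in> carrier_mat n n" "Q2 \<in> carrier_mat n n" "P2 * Q2 = 1\<^sub>m n" "Q2 * P2 = 1\<^sub>m n" by auto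
  have w1: "similar_mat_wit B1 B1 (1\<^sub>m 1) (1\<^sub>m 1)"
    using bl(1) by (intro similar_mat_witI[of _ _ 1]) (auto simp: right_mult_one_mat[of _ 1 1] left_mult_one_mat[of _ 1 1])
  have "similar_mat_wit (four_block_mat B1 B2 (0\<^sub>m n 1) B4) (four_block_mat B1 (B2 * P2) (0\<^sub>m n 1) T)
     (four_block_mat (1\<^sub>m 1) (0\<^sub>m 1 n) (0\<^sub>m n 1) P2) (four_block_mat (1\<^sub>m 1) (0\<^sub>m 1 n) (0\<^sub>m n 1) Q2)"
  proof (rule similar_mat_wit_four_block[OF w1 w _ _ bl(1) bl(4)])
    have "B2 * P2 * Q2 = B2"
      using bl(2) P2Q2 by (simp add: assoc_mult_mat[of _ 1 n _ n _ n] right_mult_one_mat[of _ 1 n])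
    thus "B2 = 1\<^sub>m 1 * (B2 * P2) * Q2"
      using bl(2) P2Q2 by (simp add: left_mult_one_mat[of _ 1 n])
    show "0\<^sub>m n 1 = P2 * 0\<^sub>m n 1 * 1\<^sub>m 1"
      using P2Q2 by (simp add: right_mult_zero_mat[of _ n n])
  qed (use bl P2Q2 in auto)
  hence "similar_mat B (four_block_mat B1 (B2 * P2) (0\<^sub>m n 1) T)"
    unfolding similar_mat_def bl(5)[unfolded B3, symmetric] by blast
  moreover have "similar_mat A B"
  proof (rule similar_matI)
    show "{A, B, P, Q} \<subseteq> carrier_mat (Suc n) (Suc n)" using A B PQ by auto
    show "A = P * B * Q"
      unfolding B_def using conj_inverse[OF PQ(1,2) A PQ(3)] by simp
  qed (use PQ in auto)
  moreover have "upper_triangular (four_block_mat B1 (B2 * P2) (0\<^sub>m n 1) T)"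
    by (rule upper_triangular_four_block[OF bl(1) T(1) _ T(2)]) (use bl(1) in auto)
  moreover have "four_block_mat B1 (B2 * P2) (0\<^sub>m n 1) T \<in> carrier_mat (Suc n) (Suc n)"
    using four_block_carrier_mat[OF bl(1) T(1)] by simp
  ultimately show ?case using similar_mat_trans by blast
qed

lemma jordan_matrix_eigen_triangular:
  "eigen_triangular (sum_list (map fst n_as)) (\<lambda>a. jordan_matrix n_as $$ (a, a)) (jordan_matrix n_as :: 'a::comm_ring_1 mat)"
proof (induction n_as)
  case Nil
  show ?case by (simp add: eigen_triangular_def jordan_matrix_def)
next
  case (Cons na n_as)
  obtain m e where [simp]: "na = (m, e)" by force
  let ?N = "sum_list (map fst n_as)"
  have c: "jordan_matrix n_as \<in> carrier_mat ?N ?N" by simp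
  note IH = Cons.IH[unfolded eigen_triangular_def]
  have IH': "x < y \<and> jordan_matrix n_as $$ (x, x) = jordan_matrix n_as $$ (y, y)"
    if "x < ?N" "y < ?N" "x \<noteq> y" "jordan_matrix n_as $$ (x, y) \<noteq> 0" for x y
    using IH that by blast
  show ?case
    unfolding eigen_triangular_def
  proof (intro conjI allI impI)
    fix a c assume ac: "a < sum_list (map fst (na # n_as))" "c < sum_list (map fst (na # n_as))"
      "a \<noteq> c" "jordan_matrix (na # n_as) $$ (a, c) \<noteq> 0"
    have d: "dim_row (jordan_block m e) = m" "dim_col (jordan_block m e) = m"
      by (simp_all add: jordan_block_def)
    have J: "jordan_matrix ((m, e) # n_as) $$ (x, y) = (if x < m then if y < m then jordan_block m e $$ (x, y) else 0
        else if y < m then 0 else jordan_matrix n_as $$ (x - m, y - m))" if "x < m + ?N" "y < m + ?N" for x y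
      using that by (simp add: jordan_matrix_Cons d)
    from ac have "(a < m \<and> c < m \<and> jordan_block m e $$ (a, c) \<noteq> 0) \<or>
        (\<not> a < m \<and> \<not> c < m \<and> jordan_matrix n_as $$ (a - m, c - m) \<noteq> 0)"
      by (auto simp: J split: if_splits)
    hence "a < c \<and> jordan_matrix (na # n_as) $$ (a, a) = jordan_matrix (na # n_as) $$ (c, c)"
    proof (elim disjE conjE)
      assume "a < m" "c < m" "jordan_block m e $$ (a, c) \<noteq> 0"
      thus ?thesis using ac by (auto simp: J split: if_splits)
    next
      assume *: "\<not> a < m" "\<not> c < m" "jordan_matrix n_as $$ (a - m, c - m) \<noteq> 0"
      have "a - m < c - m \<and> jordan_matrix n_as $$ (a - m, a - m) = jordan_matrix n_as $$ (c - m, c - m)"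
        by (rule IH') (use * ac in auto)
      thus ?thesis using * ac by (auto simp: J)
    qed
    thus "a < c" "jordan_matrix (na # n_as) $$ (a, a) = jordan_matrix (na # n_as) $$ (c, c)" by auto
  qed auto
qed

text \<open>Triangularisation leads to the Jordan normal form, whose blocks each have a single eigenvalue.\<close>

lemma ex_eigen_triangular:
  fixes A :: "'a::alg_closed_field mat"
  assumes A: "A \<in> carrier_mat n n"
  obtains P Q J s where "P \<in> carrier_mat n n" "Q \<in> carrier_mat n n" "P * Q = 1\<^sub>m n" "Q * P = 1\<^sub>m n"
    "A = P * J * Q" "eigen_triangular n s J"
proof -
  from similar_upper_triangular[OF A] obtain B where B: "B \<in> carrier_mat n n" "upper_triangular B" "similar_mat A B" by blast
  have "similar_mat B (jordan_matrix (triangular_to_jnf_vector B))"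
    using triangular_to_jnf_vector[OF B(1,2)] by (simp add: jordan_nf_def)
  from similar_mat_trans[OF B(3) this] obtain P Q where
    w: "similar_mat_wit A (jordan_matrix (triangular_to_jnf_vector B)) P Q" unfolding similar_mat_def by blast
  let ?l = "triangular_to_jnf_vector B"
  note PQ = similar_mat_witD2[OF A w]
  have "sum_list (map fst ?l) = n" using PQ(5) by (metis carrier_matD(1) jordan_matrix_dim(1))
  with jordan_matrix_eigen_triangular[of ?l] PQ that[of P Q "jordan_matrix ?l"] show ?thesis by simp
qed

section \<open>Resonant normal form\<close>

lemma fun_vector_space: "vector_space (\<lambda>(c::'k::field) (f :: 'a \<Rightarrow> 'k) x. c * f x)"
  by unfold_locales (auto simp: fun_eq_iff algebra_simps)

text \<open>The commutator with \<open>J\<close> on matrices, regarded as functions so that they form a vector space.\<close>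

definition ad :: "nat \<Rightarrow> 'k::comm_ring_1 mat \<Rightarrow> (nat \<times> nat \<Rightarrow> 'k) \<Rightarrow> nat \<times> nat \<Rightarrow> 'k" where
  "ad n J f = (\<lambda>(a, b). if a < n \<and> b < n then \<Sum>c<n. J $$ (a, c) * f (c, b) - f (a, c) * J $$ (c, b) else 0)"

lemma ad_linear_operator:
  "linear_operator (\<lambda>(c::'k::field) (f :: nat \<times> nat \<Rightarrow> 'k) x. c * f x) (ad n J)"
  unfolding linear_operator_def linear_operator_axioms_def
  by (auto simp: fun_vector_space ad_def fun_eq_iff algebra_simps sum.distrib sum_subtractf sum_distrib_left)

lemma ad_mat:
  assumes "J \<in> carrier_mat n n" "C \<in> carrier_mat n n" "a < n" "b < n" "\<And>c d. c < n \<Longrightarrow> d < n \<Longrightarrow> f (c, d) = C $$ (c, d)"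
  shows "ad n J f (a, b) = (J * C - C * J) $$ (a, b)"
proof -
  have "(J * C - C * J) $$ (a, b) = (J * C) $$ (a, b) - (C * J) $$ (a, b)"
    using assms by (auto simp del: index_mult_mat(1))
  thus ?thesis
    using assms by (simp add: ad_def index_mult_mat_sum[of _ n n _ n] sum_subtractf del: index_mult_mat)
qed

text \<open>Up to the scalar \<open>s a - s b\<close>, the commutator with \<open>J\<close> takes the matrix unit at \<open>(a, b)\<close> to a combination of
  those at \<open>(c, b)\<close> with \<open>c < a\<close> and at \<open>(a, d)\<close> with \<open>d > b\<close> that belong to the same eigenvalue; hence the
  induction on \<open>a + (n - b)\<close>.\<close>

lemma matrix_unit_gen_eigenvector:
  fixes J :: "'k::field mat"
  assumes J: "eigen_triangular n s J" and ab: "a < n" "b < n"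
  shows "(\<lambda>ij. if ij = (a, b) then 1 else 0) \<in>
    linear_operator.gen_eigenspace (\<lambda>(c::'k) f x. c * f x) (ad n J) (s a - s b)"
proof -
  interpret V: linear_operator "\<lambda>(c::'k) (f :: nat \<times> nat \<Rightarrow> 'k) x. c * f x" "ad n J"
    by (rule ad_linear_operator)
  define E where "E = (\<lambda>(a::nat) (b::nat) (ij::nat\<times>nat). if ij = (a, b) then 1 else (0::'k))"
  have Jd: "\<And>a. a < n \<Longrightarrow> J $$ (a, a) = s a"
    "\<And>a c. a < n \<Longrightarrow> c < n \<Longrightarrow> a \<noteq> c \<Longrightarrow> J $$ (a, c) \<noteq> 0 \<Longrightarrow> a < c \<and> s a = s c"
    using J by (auto simp: eigen_triangular_def)
  have "E a b \<in> V.gen_eigenspace (s a - s b)"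
    using ab
  proof (induction "a + (n - b)" arbitrary: a b rule: less_induct)
    case less
    have "V.shift (s a - s b) (E a b) =
      (\<Sum>c\<in>{..<n} - {a}. (\<lambda>x. J $$ (c, a) * E c b x)) + (\<Sum>d\<in>{..<n} - {b}. (\<lambda>x. - J $$ (b, d) * E a d x))"
      (is "_ = ?R")
    proof (rule ext)
      fix x :: "nat \<times> nat"
      obtain i j where x: "x = (i, j)" by force
      have app: "(sum g A) x = (\<Sum>c\<in>A. g c x)" for g :: "nat \<Rightarrow> nat \<times> nat \<Rightarrow> 'k" and A
        by (induction A rule: infinite_finite_induct) auto
      have R: "?R x = (\<Sum>c\<in>{..<n} - {a}. if c = i then (if j = b then J $$ (i, a) else 0) else 0) +
          (\<Sum>d\<in>{..<n} - {b}. if d = j then (if i = a then - J $$ (b, j) else 0) else 0)"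
        unfolding plus_fun_apply app by (intro arg_cong2[of _ _ _ _ "(+)"] sum.cong) (auto simp: E_def x)
      show "V.shift (s a - s b) (E a b) x = ?R x"
      proof (cases "i < n \<and> j < n")
        case True
        have "ad n J (E a b) x = (\<Sum>c<n. J $$ (i, c) * E a b (c, j)) - (\<Sum>c<n. E a b (i, c) * J $$ (c, j))"
          using True by (simp add: ad_def x sum_subtractf)
        also have "(\<Sum>c<n. J $$ (i, c) * E a b (c, j)) = (\<Sum>c<n. if c = a then (if j = b then J $$ (i, a) else 0) else 0)"
          by (intro sum.cong refl) (auto simp: E_def)
        also have "(\<Sum>c<n. E a b (i, c) * J $$ (c, j)) = (\<Sum>c<n. if c = b then (if i = a then J $$ (b, j) else 0) else 0)"
          by (intro sum.cong refl) (auto simp: E_def)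
        also have "(\<Sum>c<n. if c = a then (if j = b then J $$ (i, a) else 0) else 0) -
            (\<Sum>c<n. if c = b then (if i = a then J $$ (b, j) else 0) else 0) =
          (if j = b then J $$ (i, a) else 0) - (if i = a then J $$ (b, j) else 0)"
          using less.prems by simp
        finally show ?thesis unfolding R V.shift_def
          using True less.prems Jd(1) by (auto simp: x E_def fun_diff_def)
      next
        case False
        thus ?thesis unfolding R V.shift_def using less.prems by (auto simp: ad_def x E_def)
      qed
    qed
    also have "\<dots> \<in> V.gen_eigenspace (s a - s b)"
    proof (intro V.gen_eigenspace_add V.gen_eigenspace_sum)
      fix c assume c: "c \<in> {..<n} - {a}"
      show "(\<lambda>x. J $$ (c, a) * E c b x) \<in> V.gen_eigenspace (s a - s b)"
      proof (cases "J $$ (c, a) = 0")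
        case True
        hence eq: "(\<lambda>x. J $$ (c, a) * E c b x) = 0" by (simp add: fun_eq_iff)
        show ?thesis unfolding eq by (rule V.gen_eigenspace_0)
      next
        case False
        with Jd(2)[of c a] c less.prems have "c < a" "s c = s a" by auto
        with less.hyps[of c b] c less.prems show ?thesis
          by (intro V.gen_eigenspace_scale) auto
      qed
    next
      fix d assume d: "d \<in> {..<n} - {b}"
      show "(\<lambda>x. - J $$ (b, d) * E a d x) \<in> V.gen_eigenspace (s a - s b)"
      proof (cases "J $$ (b, d) = 0")
        case True
        hence eq: "(\<lambda>x. - J $$ (b, d) * E a d x) = 0" by (simp add: fun_eq_iff)
        show ?thesis unfolding eq by (rule V.gen_eigenspace_0)
      next
        case False
        with Jd(2)[of b d] d less.prems have "b < d" "s b = s d" by auto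
        with less.hyps[of a d] d less.prems show ?thesis
          by (intro V.gen_eigenspace_scale) auto
      qed
    qed
    finally show ?case by (rule V.gen_eigenspace_shiftD)
  qed
  thus ?thesis by (simp add: E_def)
qed

context matrix_group
begin

lemma lie_add: "X \<in> \<gg> \<Longrightarrow> Y \<in> \<gg> \<Longrightarrow> X + Y \<in> \<gg>"
  and lie_smult: "X \<in> \<gg> \<Longrightarrow> c \<cdot>\<^sub>m X \<in> \<gg>"
proof -
  assume X: "X \<in> \<gg>"
  note Xc = lie_carrier[OF X]
  have "mat n n (\<lambda>ij. \<Sum>x\<in>{()}. c * X $$ ij) \<in> \<gg>" using X by (intro lie_sum)
  also have "mat n n (\<lambda>ij. \<Sum>x\<in>{()}. c * X $$ ij) = c \<cdot>\<^sub>m X"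
    using Xc by (intro eq_matI) auto
  finally show "c \<cdot>\<^sub>m X \<in> \<gg>" .
  assume Y: "Y \<in> \<gg>"
  note Yc = lie_carrier[OF Y]
  have "mat n n (\<lambda>ij. \<Sum>b\<in>{True, False}. 1 * (if b then X else Y) $$ ij) \<in> \<gg>"
    using X Y by (intro lie_sum) auto
  also have "mat n n (\<lambda>ij. \<Sum>b\<in>{True, False}. 1 * (if b then X else Y) $$ ij) = X + Y"
    using Xc Yc by (intro eq_matI) auto
  finally show "X + Y \<in> \<gg>" .
qed

text \<open>The Lie algebra is stable under \<open>ad J\<close>, and the entries of a matrix grouped by \<open>s a - s b\<close> are its
  generalised eigencomponents.\<close>

lemma lie_fitting:
  assumes J: "eigen_triangular n s J" "J \<in> \<gg>" and C: "C \<in> \<gg>"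
  obtains y where "y \<in> \<gg>" "\<And>a b. a < n \<Longrightarrow> b < n \<Longrightarrow>
     C $$ (a, b) = (J * y - y * J) $$ (a, b) - \<nu> * y $$ (a, b) + (if s a - s b = \<nu> then C $$ (a, b) else 0)"
proof -
  interpret V: linear_operator "\<lambda>(c::'k) (f :: nat \<times> nat \<Rightarrow> 'k) x. c * f x" "ad n J"
    by (rule ad_linear_operator)
  define S where "S = {f :: nat \<times> nat \<Rightarrow> 'k. mat n n f \<in> \<gg>}"
  have Jc: "J \<in> carrier_mat n n" using lie_carrier[OF J(2)] .
  have S: "V.stable S"
    unfolding V.stable_def V.subspace_def
  proof (intro conjI ballI allI)
    have "mat n n (0 :: nat \<times> nat \<Rightarrow> 'k) = 0\<^sub>m n n" by (intro eq_matI) auto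
    thus "0 \<in> S" using lie_0 by (simp add: S_def)
  next
    fix f g assume "f \<in> S" "g \<in> S"
    moreover have "mat n n (f + g) = mat n n f + mat n n g" by (intro eq_matI) auto
    ultimately show "f + g \<in> S" by (auto simp: S_def intro: lie_add)
  next
    fix f and c :: 'k assume "f \<in> S"
    moreover have "mat n n (\<lambda>x. c * f x) = c \<cdot>\<^sub>m mat n n f" by (intro eq_matI) auto
    ultimately show "(\<lambda>x. c * f x) \<in> S" by (auto simp: S_def intro: lie_smult)
  next
    fix f assume f: "f \<in> S"
    have "mat n n (ad n J f) = J * mat n n f - mat n n f * J"
    proof (rule eq_mat_square)
      fix i j assume ij: "i < n" "j < n"
      show "mat n n (ad n J f) $$ (i, j) = (J * mat n n f - mat n n f * J) $$ (i, j)"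
        using ij by (simp add: ad_mat[OF Jc _ ij, of "mat n n f"] del: index_minus_mat)
    qed (use Jc in auto)
    thus "ad n J f \<in> S" using f J(2) by (auto simp: S_def intro: lie_bracket)
  qed
  define F where "F = (\<lambda>(a, b). s a - s b) ` (idx n)"
  define f where "f = (\<lambda>\<mu> (a, b). if a < n \<and> b < n \<and> s a - s b = \<mu> then C $$ (a, b) else 0)"
  have app: "(sum g A) x = (\<Sum>c\<in>A. g c x)" for g :: "'b \<Rightarrow> nat \<times> nat \<Rightarrow> 'k" and A x
    by (induction A rule: infinite_finite_induct) auto
  have f: "f \<mu> \<in> V.gen_eigenspace \<mu>" for \<mu>
  proof -
    have "f \<mu> = (\<Sum>ab\<in>{ab\<in>idx n. s (fst ab) - s (snd ab) = \<mu>}. (\<lambda>x. C $$ ab * (if x = ab then 1 else 0)))"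
    proof (rule ext)
      fix x :: "nat \<times> nat"
      obtain a b where x: "x = (a, b)" by force
      have "(\<Sum>ab\<in>{ab\<in>idx n. s (fst ab) - s (snd ab) = \<mu>}. C $$ ab * (if x = ab then 1 else 0)) =
          (\<Sum>ab\<in>{ab\<in>idx n. s (fst ab) - s (snd ab) = \<mu>}. if ab = x then C $$ x else 0)"
        by (intro sum.cong) auto
      also have "\<dots> = f \<mu> x" by (subst sum.delta) (auto simp: f_def x)
      finally show "f \<mu> x = (\<Sum>ab\<in>{ab\<in>idx n. s (fst ab) - s (snd ab) = \<mu>}. (\<lambda>x. C $$ ab * (if x = ab then 1 else 0))) x"
        by (simp add: app)
    qed
    also have "\<dots> \<in> V.gen_eigenspace \<mu>"
      by (intro V.gen_eigenspace_sum V.gen_eigenspace_scale)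
         (use matrix_unit_gen_eigenvector[OF J(1)] in auto)
    finally show ?thesis .
  qed
  have sum_f: "(\<Sum>\<mu>\<in>F. f \<mu>) (a, b) = C $$ (a, b)" if ab: "a < n" "b < n" for a b
  proof -
    have "(\<Sum>\<mu>\<in>F. f \<mu>) (a, b) = (\<Sum>\<mu>\<in>F. if \<mu> = s a - s b then C $$ (a, b) else 0)"
      unfolding app by (intro sum.cong refl) (use ab in \<open>auto simp: f_def\<close>)
    also have "\<dots> = C $$ (a, b)" using ab by (auto simp: F_def)
    finally show ?thesis .
  qed
  have "mat n n (\<Sum>\<mu>\<in>F. f \<mu>) = C"
    using lie_carrier[OF C] by (intro eq_matI) (auto simp: sum_f)
  hence "(\<Sum>\<mu>\<in>F. f \<mu>) \<in> S" using C by (simp add: S_def)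
  from V.stable_fitting[OF S _ f this, of \<nu>]
  obtain y where y: "y \<in> S" "(\<Sum>\<mu>\<in>F. f \<mu>) = V.shift \<nu> y + (if \<nu> \<in> F then f \<nu> else 0)"
    by (auto simp: F_def)
  show ?thesis
  proof (rule that[of "mat n n y"])
    show "mat n n y \<in> \<gg>" using y by (simp add: S_def)
    fix a b assume ab: "a < n" "b < n"
    have "C $$ (a, b) = (V.shift \<nu> y + (if \<nu> \<in> F then f \<nu> else 0)) (a, b)"
      using sum_f[OF ab] y(2) by simp
    also have "\<dots> = ad n J y (a, b) - \<nu> * y (a, b) + (if \<nu> \<in> F then f \<nu> else 0) (a, b)"
      by (simp add: V.shift_def)
    also have "(if \<nu> \<in> F then f \<nu> else 0) (a, b) = (if s a - s b = \<nu> then C $$ (a, b) else 0)"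
      using ab by (auto simp: f_def F_def)
    also have "ad n J y (a, b) = (J * mat n n y - mat n n y * J) $$ (a, b)"
      by (rule ad_mat[OF Jc _ ab]) auto
    finally show "C $$ (a, b) = (J * mat n n y - mat n n y * J) $$ (a, b) - \<nu> * mat n n y $$ (a, b) +
        (if s a - s b = \<nu> then C $$ (a, b) else 0)"
      using ab by simp
  qed
qed

end

text \<open>Divisibility by \<open>z\<^sup>N\<close>; the leading coefficient of a product is then the product of leading coefficients.\<close>

definition ord_ge :: "nat \<Rightarrow> nat \<Rightarrow> 'a::zero fps mat \<Rightarrow> bool" where
  "ord_ge n N M \<longleftrightarrow> M \<in> carrier_mat n n \<and> (\<forall>m<N. cf m M = 0\<^sub>m n n)"

lemma cf_mult:
  fixes A B :: "'a::comm_ring_1 fps mat"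
  assumes "A \<in> carrier_mat n n" "B \<in> carrier_mat n n"
  shows "cf N (A * B) = mat n n (\<lambda>ij. \<Sum>m\<le>N. (cf m A * cf (N - m) B) $$ ij)"
  using assms by (intro eq_matI) (auto simp: cf_mult_entry simp del: index_mult_mat(1))

lemma ord_ge_mult:
  fixes A B :: "'a::comm_ring_1 fps mat"
  assumes A: "ord_ge n a A" and B: "ord_ge n b B"
  shows "ord_ge n (a + b) (A * B)" "cf (a + b) (A * B) = cf a A * cf b B"
proof -
  have c: "A \<in> carrier_mat n n" "B \<in> carrier_mat n n"
    using A B by (auto simp: ord_ge_def)
  have z: "(cf l A * cf m B) $$ ij = 0" if "l < a \<or> m < b" "ij \<in> idx n" for l m ij
    using that A B by (auto simp: ord_ge_def left_mult_zero_mat[of _ n n] right_mult_zero_mat[of _ n n])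
  have "cf m (A * B) = 0\<^sub>m n n" if "m < a + b" for m
    unfolding cf_mult[OF c] using that by (intro eq_matI) (auto intro!: sum.neutral z simp del: index_mult_mat(1))
  thus "ord_ge n (a + b) (A * B)" using c by (auto simp: ord_ge_def)
  show "cf (a + b) (A * B) = cf a A * cf b B"
    unfolding cf_mult[OF c]
  proof (rule eq_mat_square)
    fix i j assume ij: "i < n" "j < n"
    have "(\<Sum>m\<le>a + b. (cf m A * cf (a + b - m) B) $$ (i, j)) = (\<Sum>m\<in>{a}. (cf m A * cf (a + b - m) B) $$ (i, j))"
      by (rule sum.mono_neutral_right) (use ij in \<open>auto intro!: z simp del: index_mult_mat(1)\<close>)
    thus "mat n n (\<lambda>ij. \<Sum>m\<le>a + b. (cf m A * cf (a + b - m) B) $$ ij) $$ (i, j) = (cf a A * cf b B) $$ (i, j)"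
      using ij by simp
  qed (use c in auto)
qed

lemma ord_ge_mult_left:
  fixes M P :: "'a::comm_ring_1 fps mat"
  assumes "ord_ge n N M" "P \<in> carrier_mat n n"
  shows "ord_ge n N (M * P)" "cf N (M * P) = cf N M * cf 0 P"
  using ord_ge_mult[OF assms(1), of 0 P] assms(2) by (simp_all add: ord_ge_def)

lemma ord_ge_mult_right:
  fixes M P :: "'a::comm_ring_1 fps mat"
  assumes "ord_ge n N M" "P \<in> carrier_mat n n"
  shows "ord_ge n N (P * M)" "cf N (P * M) = cf 0 P * cf N M"
  using ord_ge_mult[OF _ assms(1), of 0 P] assms(2) by (simp_all add: ord_ge_def)

lemma ord_ge_minus:
  fixes M P :: "'a::comm_ring_1 fps mat"
  assumes "M \<in> carrier_mat n n" "P \<in> carrier_mat n n"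
  shows "ord_ge n N (M - P) \<longleftrightarrow> (\<forall>m<N. cf m M = cf m P)"
proof -
  have "cf m (M - P) = 0\<^sub>m n n \<longleftrightarrow> cf m M = cf m P" for m
    using assms by (auto simp: mat_eq_iff)
  thus ?thesis using assms by (auto simp: ord_ge_def)
qed

context matrix_group
begin

text \<open>The gauge transform of \<open>A\<close> by \<open>g\<close> is \<open>g A h + theta g h\<close>, and \<open>theta g h = Y\<close>.\<close>

definition gauged :: "'k fps mat \<Rightarrow> 'k fps mat \<Rightarrow> 'k fps mat \<Rightarrow> 'k fps mat \<Rightarrow> 'k fps mat \<Rightarrow> bool" where
  "gauged A Y g h B \<longleftrightarrow> A \<in> carrier_mat n n \<and> flow Y g h \<and> B = g * A * h + Y"

lemma ex_gauged:
  assumes "A \<in> carrier_mat n n" "Y \<in> carrier_mat n n" "cf 0 Y = 0\<^sub>m n n" "\<And>m. cf m Y \<in> \<gg>"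
  shows "\<exists>g h B. gauged A Y g h B"
  using ex_flow[OF assms(2-4)] assms(1) by (auto simp: gauged_def)

lemma gauged_lie:
  assumes "gauged A Y g h B" "\<And>m. cf m A \<in> \<gg>"
  shows "cf m B \<in> \<gg>"
proof -
  note a = assms(1)[unfolded gauged_def flow_def]
  have "cf m (g * A * h) \<in> \<gg>"
    using assms by (intro flow_adjoint_series[of Y g h A]) (auto simp: gauged_def)
  moreover have "cf m B = cf m (g * A * h) + cf m Y"
    using a by (intro eq_matI) auto
  ultimately show ?thesis using a by (auto intro: lie_add)
qed

lemma gauged_0:
  assumes "gauged A Y g h B"
  shows "cf 0 B = cf 0 A"
proof -
  interpret Z: comm_ring_hom "\<lambda>f :: 'k fps. fps_nth f 0" by (rule fps_nth_0_comm_ring_hom)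
  note a = assms[unfolded gauged_def flow_def]
  have B: "B = g * A * h + Y" and Y: "Y \<in> carrier_mat n n" and gAh: "g * A * h \<in> carrier_mat n n"
    using a by auto
  have "cf 0 B = cf 0 (g * A * h) + cf 0 Y"
  proof (rule eq_mat_square)
    fix i j assume ij: "i < n" "j < n"
    have d: "dim_row (g * A * h) = n" "dim_col (g * A * h) = n" "dim_row Y = n" "dim_col Y = n"
      using gAh Y by auto
    show "cf 0 B $$ (i, j) = (cf 0 (g * A * h) + cf 0 Y) $$ (i, j)"
      unfolding B using ij by (simp add: d del: index_mult_mat)
  qed (use Y gAh B in auto)
  also have "cf 0 (g * A * h) = cf 0 g * cf 0 A * cf 0 h"
  proof -
    have c: "g \<in> carrier_mat n n" "A \<in> carrier_mat n n" "h \<in> carrier_mat n n" using a by auto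
    show ?thesis
      using Z.mat_hom_mult[OF mult_carrier_mat[OF c(1,2)] c(3)] Z.mat_hom_mult[OF c(1,2)] by simp
  qed
  finally show ?thesis
    using a by (simp add: left_mult_one_mat[of _ n n] right_mult_one_mat[of _ n n])
qed

text \<open>A change of \<open>Y\<close> by \<open>e z\<^sup>N\<close> modulo higher order changes \<open>g\<close> by \<open>e z\<^sup>N / N\<close>, and \<open>B\<close> by
  \<open>(e + [e, J] / N) z\<^sup>N\<close> with \<open>J = A(0)\<close>.  The difference of the transforms is found from the
  equations \<open>B g = g A + theta g\<close>, which contain no inverse.\<close>

lemma gauged_agree:
  assumes 1: "gauged A Y g h B" and 2: "gauged A Y' g' h' B'" and N: "N \<ge> 1"
    and eq: "\<And>m. m < N \<Longrightarrow> cf m Y = cf m Y'"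
  shows "m < N \<Longrightarrow> cf m B = cf m B'"
    "cf N Y - cf N Y' = e \<Longrightarrow> i < n \<Longrightarrow> j < n \<Longrightarrow>
       cf N B $$ (i, j) = cf N B' $$ (i, j) + e $$ (i, j) + inverse (of_nat N) * (e * cf 0 A - cf 0 A * e) $$ (i, j)"
proof -
  note a = 1[unfolded gauged_def flow_def] and b = 2[unfolded gauged_def flow_def]
  have c: "A \<in> carrier_mat n n" "Y \<in> carrier_mat n n" "Y' \<in> carrier_mat n n" "g \<in> carrier_mat n n" "g' \<in> carrier_mat n n"
    "h \<in> carrier_mat n n" "h' \<in> carrier_mat n n" "B \<in> carrier_mat n n" "B' \<in> carrier_mat n n"
    using a b by auto
  define D where "D = g - g'"
  have D: "D \<in> carrier_mat n n" unfolding D_def using c(5) by (rule minus_carrier_mat)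
  have gD: "g = D + g'" using c by (intro eq_matI) (auto simp: D_def)
  have YY: "ord_ge n N (Y - Y')" using c eq by (subst ord_ge_minus) auto
  have thD: "map_mat theta D = (Y - Y') * g + Y' * D"
  proof -
    have "map_mat theta D = map_mat theta g - map_mat theta g'"
      using c by (intro eq_matI) (auto simp: D_def theta_def algebra_simps)
    also have "\<dots> = Y * g - Y' * g'" using a b by simp
    also have "(Y - Y') * g + Y' * D = Y * g - Y' * g'"
    proof -
      have "(Y - Y') * g = Y * g - Y' * g" using c by (intro minus_mult_distrib_mat[of _ n n _ _ n]) auto
      moreover have "Y' * D = Y' * g - Y' * g'" unfolding D_def using c by (intro mult_minus_distrib_mat[of _ n n _ n]) auto
      ultimately show ?thesis using c by (intro eq_matI) (auto simp del: index_mult_mat(1))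
    qed
    finally show ?thesis by simp
  qed
  have step: "of_nat m * fps_nth (D $$ (i, j)) m = cf m (Y - Y') $$ (i, j)"
    if m: "ord_ge n m D" "m \<le> N" and ij: "i < n" "j < n" for m i j
  proof -
    have om: "ord_ge n m (Y - Y')" using YY m(2) by (auto simp: ord_ge_def)
    have "of_nat m * fps_nth (D $$ (i, j)) m = fps_nth (map_mat theta D $$ (i, j)) m"
      using ij D by (simp add: theta_nth)
    also have "\<dots> = cf m ((Y - Y') * g) $$ (i, j) + cf m (Y' * D) $$ (i, j)"
      unfolding thD using ij c D by (auto simp del: index_mult_mat(1))
    also have "cf m ((Y - Y') * g) = cf m (Y - Y')"
      using ord_ge_mult_left[OF om c(4)] a c by (simp add: right_mult_one_mat[of _ n n])
    also have "cf m (Y' * D) = 0\<^sub>m n n"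
      using ord_ge_mult_right(2)[OF m(1) c(3)] b D by (simp add: left_mult_zero_mat[of _ n n])
    finally show ?thesis using ij by simp
  qed
  have oD: "ord_ge n m D" if "m \<le> N" for m
    using that
  proof (induction m)
    case 0
    show ?case using D by (simp add: ord_ge_def)
  next
    case (Suc m)
    hence IH: "ord_ge n m D" by simp
    have "cf m D = 0\<^sub>m n n"
    proof (cases "m = 0")
      case True
      thus ?thesis using a b c by (auto simp: D_def mat_eq_iff)
    next
      case False
      show ?thesis
      proof (rule eq_mat_square)
        fix i j assume ij: "i < n" "j < n"
        have "cf m (Y - Y') = 0\<^sub>m n n" using YY Suc.prems by (auto simp: ord_ge_def)
        hence "of_nat m * fps_nth (D $$ (i, j)) m = 0"
          using step[OF IH _ ij] Suc.prems ij by simp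
        thus "cf m D $$ (i, j) = 0\<^sub>m n n $$ (i, j)" using False ij D by simp
      qed (use D in auto)
    qed
    with IH D show ?case by (auto simp: ord_ge_def less_Suc_eq)
  qed
  \<comment> \<open>subtracting the equations for \<open>B\<close> and \<open>B'\<close> gives \<open>(B - B') g = R\<close>\<close>
  define R where "R = D * A + map_mat theta D - B' * D"
  have R: "R \<in> carrier_mat n n" using c D by (auto simp: R_def)
  have tD: "map_mat theta D \<in> carrier_mat n n" using D by simp
  have E: "B - B' = R * h"
  proof -
    have Bg: "B * g = g * A + map_mat theta g"
    proof -
      have "B * g = g * A * h * g + Y * g"
        using a c by (simp add: add_mult_distrib_mat[of _ n n _ _ n])
      also have "g * A * h * g = g * A * (h * g)"
        using c by (intro assoc_mult_mat[of _ n n _ n _ n]) auto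
      finally show ?thesis using a c by (simp add: right_mult_one_mat[of _ n n])
    qed
    have Bg': "B' * g' = g' * A + map_mat theta g'"
    proof -
      have "B' * g' = g' * A * h' * g' + Y' * g'"
        using b c by (simp add: add_mult_distrib_mat[of _ n n _ _ n])
      also have "g' * A * h' * g' = g' * A * (h' * g')"
        using c by (intro assoc_mult_mat[of _ n n _ n _ n]) auto
      finally show ?thesis using b c by (simp add: right_mult_one_mat[of _ n n])
    qed
    have "(B - B') * g = B * g - B' * g" using c by (intro minus_mult_distrib_mat[of _ n n _ _ n]) auto
    also have "B' * g = B' * D + B' * g'" unfolding gD using c D by (intro mult_add_distrib_mat[of _ n n _ n]) auto
    finally have "(B - B') * g = g * A + map_mat theta g - (B' * D + (g' * A + map_mat theta g'))"
      by (simp add: Bg Bg')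
    also have "\<dots> = R"
    proof -
      have "D * A = g * A - g' * A" unfolding D_def using c by (intro minus_mult_distrib_mat[of _ n n _ _ n]) auto
      thus ?thesis using c D
        unfolding R_def by (intro eq_matI) (auto simp: D_def theta_def algebra_simps simp del: index_mult_mat(1))
    qed
    finally have "(B - B') * g * h = R * h" by simp
    moreover have "(B - B') * g * h = (B - B') * (g * h)" using c by (intro assoc_mult_mat[of _ n n _ n _ n]) auto
    moreover have "B - B' \<in> carrier_mat n n" using c by auto
    ultimately show ?thesis using a c by (simp add: right_mult_one_mat[of _ n n])
  qed
  note oN = oD[OF order.refl]
  have oR: "ord_ge n N R"
  proof -
    have "cf m R = 0\<^sub>m n n" if m: "m < N" for m
    proof -
      have "cf m (D * A) = 0\<^sub>m n n" "cf m (B' * D) = 0\<^sub>m n n" "cf m D = 0\<^sub>m n n"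
        using ord_ge_mult_left(1)[OF oN c(1)] ord_ge_mult_right(1)[OF oN c(9)] oN m by (auto simp: ord_ge_def)
      moreover from this(3) have "cf m (map_mat theta D) = 0\<^sub>m n n"
        using D by (auto simp: mat_eq_iff theta_nth)
      moreover have "cf m R = cf m (D * A) + cf m (map_mat theta D) - cf m (B' * D)"
        unfolding R_def using c D by (intro eq_matI) (auto simp del: index_mult_mat(1))
      ultimately show ?thesis by auto
    qed
    thus ?thesis using R by (auto simp: ord_ge_def)
  qed
  have oE: "ord_ge n N (B - B')" unfolding E using ord_ge_mult_left(1)[OF oR c(6)] .
  show "m < N \<Longrightarrow> cf m B = cf m B'"
    using oE ord_ge_minus[OF c(8,9)] by blast
  assume e: "cf N Y - cf N Y' = e" and ij: "i < n" "j < n"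
  have ec: "e \<in> carrier_mat n n" using e c by auto
  have eN: "cf N D = inverse (of_nat N) \<cdot>\<^sub>m e"
  proof (rule eq_mat_square)
    fix i j assume ij: "i < n" "j < n"
    have "of_nat N * fps_nth (D $$ (i, j)) N = e $$ (i, j)"
      using step[OF oN _ ij] ij c e by auto
    thus "cf N D $$ (i, j) = (inverse (of_nat N) \<cdot>\<^sub>m e) $$ (i, j)"
      using ij D ec N by (auto simp: field_simps)
  qed (use D ec in auto)
  have "cf N (B - B') = cf N R"
    unfolding E using ord_ge_mult_left(2)[OF oR c(6)] a R by (simp add: right_mult_one_mat[of _ n n])
  moreover have "cf N (B - B') $$ (i, j) = cf N B $$ (i, j) - cf N B' $$ (i, j)"
    using c ij by auto
  moreover have "cf N R $$ (i, j) = cf N (D * A) $$ (i, j) + of_nat N * cf N D $$ (i, j) - cf N (B' * D) $$ (i, j)"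
    unfolding R_def using c D ij by (auto simp: theta_nth simp del: index_mult_mat(1))
  moreover have "cf N (D * A) = inverse (of_nat N) \<cdot>\<^sub>m (e * cf 0 A)"
    unfolding ord_ge_mult_left(2)[OF oN c(1)] eN using ec c by (intro mult_smult_assoc_mat[of _ n n _ n]) auto
  moreover have "cf N (B' * D) = inverse (of_nat N) \<cdot>\<^sub>m (cf 0 A * e)"
    unfolding ord_ge_mult_right(2)[OF oN c(9)] eN gauged_0[OF 2] using ec c by (intro mult_smult_distrib[of _ n n _ n]) auto
  ultimately have "cf N B $$ (i, j) - cf N B' $$ (i, j) = inverse (of_nat N) * (e * cf 0 A) $$ (i, j) +
      of_nat N * (inverse (of_nat N) * e $$ (i, j)) - inverse (of_nat N) * (cf 0 A * e) $$ (i, j)"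
    using ij ec c by (simp add: eN del: index_mult_mat(1))
  thus "cf N B $$ (i, j) = cf N B' $$ (i, j) + e $$ (i, j) + inverse (of_nat N) * (e * cf 0 A - cf 0 A * e) $$ (i, j)"
    using ij ec c N by (simp add: algebra_simps del: index_mult_mat(1))
qed

definition resonant :: "(nat \<Rightarrow> 'k) \<Rightarrow> nat \<Rightarrow> 'k mat \<Rightarrow> bool" where
  "resonant s m M \<longleftrightarrow> (\<forall>a<n. \<forall>b<n. M $$ (a, b) \<noteq> 0 \<longrightarrow> s a - s b = of_nat m)"

text \<open>The coefficients of \<open>Y\<close> are chosen one after the other.  Changing the coefficient at \<open>N\<close> by \<open>e = N y\<close> adds
  \<open>N y - [J, y]\<close> to the coefficient of \<open>B\<close> at \<open>N\<close> and leaves the lower ones alone, so \<open>lie_fitting\<close>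
  provides \<open>y\<close> with a resonant result.  The successive choices converge \<open>z\<close>-adically.\<close>

theorem resonant_normal_form:
  assumes J: "eigen_triangular n s (cf 0 A)" and A: "A \<in> carrier_mat n n" "\<And>m. cf m A \<in> \<gg>"
  shows "\<exists>Y g h B. gauged A Y g h B \<and> (\<forall>m. resonant s m (cf m B))"
proof -
  define P where "P = (\<lambda>N Y. \<exists>g h B. gauged A Y g h B \<and> (\<forall>m\<le>N. resonant s m (cf m B)))"
  define Q where "Q = (\<lambda>N (Y :: 'k fps mat) Y'. \<forall>m\<le>N. cf m Y' = cf m Y)"
  have "\<exists>f. \<forall>N. P N (f N) \<and> Q N (f N) (f (Suc N))"
  proof (rule dependent_nat_choice)
    have cf0: "cf m (0\<^sub>m n n) = (0\<^sub>m n n :: 'k mat)" for m by (intro eq_matI) auto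
    obtain g h B where gB: "gauged A (0\<^sub>m n n) g h B"
      using ex_gauged[OF A(1) zero_carrier_mat] by (auto simp: cf0 lie_0)
    have "resonant s 0 (cf 0 B)"
      unfolding gauged_0[OF gB] resonant_def using J by (auto simp: eigen_triangular_def)
    with gB show "\<exists>Y. P 0 Y" by (auto simp: P_def)
  next
    fix Y N assume "P N Y"
    then obtain g h B where gB: "gauged A Y g h B" and res: "\<And>m. m \<le> N \<Longrightarrow> resonant s m (cf m B)"
      by (auto simp: P_def)
    note a = gB[unfolded gauged_def flow_def]
    let ?\<nu> = "of_nat (Suc N) :: 'k"
    obtain y where y: "y \<in> \<gg>" "\<And>a b. a < n \<Longrightarrow> b < n \<Longrightarrow>
       cf (Suc N) B $$ (a, b) = (cf 0 A * y - y * cf 0 A) $$ (a, b) - ?\<nu> * y $$ (a, b) +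
         (if s a - s b = ?\<nu> then cf (Suc N) B $$ (a, b) else 0)"
      using lie_fitting[OF J A(2) gauged_lie[OF gB A(2)]] by blast
    have yc: "y \<in> carrier_mat n n" using lie_carrier[OF y(1)] .
    \<comment> \<open>chosen so that \<open>e + [e, J] / (N + 1)\<close> is \<open>(N + 1) y - [J, y]\<close>, which cancels the image part of \<open>y(2)\<close>\<close>
    define e where "e = ?\<nu> \<cdot>\<^sub>m y"
    have e: "e \<in> \<gg>" "e \<in> carrier_mat n n" using y yc by (auto simp: e_def intro: lie_smult)
    define Y' where "Y' = Y + map_mat (\<lambda>x. fps_const x * fps_X ^ Suc N) e"
    have Y'c: "Y' \<in> carrier_mat n n" using a e by (auto simp: Y'_def)
    have cfY': "cf m Y' = cf m Y + (if m = Suc N then e else 0\<^sub>m n n)" for m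
      unfolding Y'_def using a e by (intro eq_matI) (auto simp: fps_X_power_nth simp del: power_Suc)
    have Yc: "cf m Y \<in> carrier_mat n n" for m using a by auto
    have cfY'2: "cf m Y' = cf m Y" if "m \<noteq> Suc N" for m
      using that Yc[of m] by (simp add: cfY')
    have "\<exists>g h B. gauged A Y' g h B"
    proof (rule ex_gauged[OF A(1) Y'c])
      show "cf 0 Y' = 0\<^sub>m n n" using cfY'2[of 0] a by simp
      show "cf m Y' \<in> \<gg>" for m unfolding cfY' using a e lie_0 by (auto intro: lie_add)
    qed
    then obtain g' h' B' where gB': "gauged A Y' g' h' B'" by blast
    have agree: "cf m Y' = cf m Y" if "m < Suc N" for m using that by (intro cfY'2) auto
    have "resonant s m (cf m B')" if m: "m \<le> Suc N" for m
    proof (cases "m = Suc N")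
      case False
      hence "cf m B' = cf m B" using m by (intro gauged_agree(1)[OF gB' gB _ agree]) auto
      thus ?thesis using res[of m] m False by simp
    next
      case True
      show ?thesis
        unfolding resonant_def
      proof (intro allI impI)
        fix i j assume ij: "i < n" "j < n" and nz: "cf m B' $$ (i, j) \<noteq> 0"
        have "cf (Suc N) Y' - cf (Suc N) Y = e"
          using Yc[of "Suc N"] e by (intro eq_matI) (auto simp: cfY')
        from gauged_agree(2)[OF gB' gB _ agree this ij]
        have "cf (Suc N) B' $$ (i, j) = cf (Suc N) B $$ (i, j) + e $$ (i, j) + inverse ?\<nu> * (e * cf 0 A - cf 0 A * e) $$ (i, j)"
          by simp
        also have "e * cf 0 A = ?\<nu> \<cdot>\<^sub>m (y * cf 0 A)"
          unfolding e_def using yc A by (intro mult_smult_assoc_mat[of _ n n _ n]) auto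
        also have "cf 0 A * e = ?\<nu> \<cdot>\<^sub>m (cf 0 A * y)"
          unfolding e_def using yc A by (intro mult_smult_distrib[of _ n n _ n]) auto
        also have "inverse ?\<nu> * (?\<nu> \<cdot>\<^sub>m (y * cf 0 A) - ?\<nu> \<cdot>\<^sub>m (cf 0 A * y)) $$ (i, j) = - (cf 0 A * y - y * cf 0 A) $$ (i, j)"
        proof -
          have "?\<nu> \<noteq> 0" by (rule of_nat_neq_0)
          thus ?thesis using ij yc A(1) by (simp add: field_simps del: index_mult_mat(1) of_nat_Suc)
        qed
        also have "e $$ (i, j) = ?\<nu> * y $$ (i, j)" using ij yc by (simp add: e_def)
        also have "cf (Suc N) B $$ (i, j) + ?\<nu> * y $$ (i, j) + - (cf 0 A * y - y * cf 0 A) $$ (i, j) =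
            (if s i - s j = ?\<nu> then cf (Suc N) B $$ (i, j) else 0)"
        proof -
          have "x = p - q + r \<Longrightarrow> x + q + - p = r" for x p q r :: 'k by simp
          from this[OF y(2)[OF ij]] show ?thesis .
        qed
        finally have "cf (Suc N) B' $$ (i, j) = (if s i - s j = ?\<nu> then cf (Suc N) B $$ (i, j) else 0)" .
        with nz True show "s i - s j = of_nat m" by (auto split: if_splits)
      qed
    qed
    with gB' have "P (Suc N) Y'" by (auto simp: P_def)
    moreover have "Q N Y Y'" using agree by (auto simp: Q_def)
    ultimately show "\<exists>Y'. P (Suc N) Y' \<and> Q N Y Y'" by blast
  qed
  then obtain f where f: "\<And>N. P N (f N)" "\<And>N. Q N (f N) (f (Suc N))" by blast
  have stable: "cf m (f (m + k)) = cf m (f m)" for m k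
  proof (induction k)
    case (Suc k)
    have "cf m (f (Suc (m + k))) = cf m (f (m + k))" using f(2)[of "m + k"] by (auto simp: Q_def)
    with Suc show ?case by simp
  qed simp
  have fg: "\<exists>g h B. gauged A (f N) g h B" for N using f(1)[of N] by (auto simp: P_def)
  have fc: "f N \<in> carrier_mat n n" "cf 0 (f N) = 0\<^sub>m n n" "cf m (f N) \<in> \<gg>" for N m
    using fg[of N] by (auto simp: gauged_def flow_def)
  \<comment> \<open>the diagonal sequence: \<open>f m\<close> and all later terms have the same coefficient at \<open>m\<close>\<close>
  define Y where "Y = mat n n (\<lambda>ij. Abs_fps (\<lambda>m. fps_nth (f m $$ ij) m))"
  have Yc: "Y \<in> carrier_mat n n" by (simp add: Y_def)
  have cfY: "cf m Y = cf m (f m)" for m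
    using fc(1)[of m] by (intro eq_matI) (auto simp: Y_def)
  obtain g h B where gB: "gauged A Y g h B"
    using ex_gauged[OF A(1) Yc] fc by (auto simp: cfY)
  have "resonant s m (cf m B)" for m
  proof -
    from f(1)[of m] obtain g' h' B' where gB': "gauged A (f m) g' h' B'" "resonant s m (cf m B')"
      by (auto simp: P_def)
    have "cf m B = cf m B'"
    proof (rule gauged_agree(1)[OF gB gB'(1), of "Suc m"])
      fix l assume "l < Suc m"
      then obtain k where "m = l + k" using less_iff_Suc_add by (metis le_Suc_ex less_Suc_eq_le)
      thus "cf l Y = cf l (f m)" using stable[of l k] by (simp add: cfY)
    qed auto
    thus ?thesis using gB' by simp
  qed
  with gB show ?thesis by blast
qed

end

lemma diag_of_dim [simp]: "dim_row (diag_of n l) = n" "dim_col (diag_of n l) = n"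
  by (simp_all add: diag_of_def)

text \<open>The two demands on \<open>l\<close>: it satisfies the relations of \<open>s\<close> in degree at most \<open>d\<close>, as needed for
  \<open>diagonal_in_lie\<close>, and it equals \<open>m s\<close> on the differences that resonate.\<close>

definition compatible_cocharacter ::
    "nat \<Rightarrow> nat \<Rightarrow> nat \<Rightarrow> (nat \<Rightarrow> 'k::field_char_0) \<Rightarrow> (nat \<Rightarrow> int) \<Rightarrow> bool" where
  "compatible_cocharacter n d m s l \<longleftrightarrow>
     (\<forall>t t'. keys t \<subseteq> idx n \<longrightarrow> keys t' \<subseteq> idx n \<longrightarrow>
        tdeg t \<le> d \<longrightarrow> tdeg t' \<le> d \<longrightarrow> wt s t = wt s t' \<longrightarrow>
        wt (\<lambda>i. of_int (l i) :: 'k) t = wt (\<lambda>i. of_int (l i)) t') \<and>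
     (\<forall>a<n. \<forall>b<n. \<forall>j. s a - s b = of_nat j \<longrightarrow> l a - l b = int m * int j)"

section \<open>Gauge transformations and pull-back\<close>

definition Theta :: "'a::comm_ring_1 fls \<Rightarrow> 'a fls" where
  "Theta f = fls_X * fls_deriv f"

lemma Theta_nth: "fls_nth (Theta f) i = of_int i * fls_nth f i"
  by (simp add: Theta_def fls_X_times_conv_shift)

lemma Theta_add: "Theta (f + g) = Theta f + Theta g"
  and Theta_mult: "Theta (f * g) = Theta f * g + f * Theta g"
  by (simp_all add: Theta_def algebra_simps)

lemma Theta_const: "Theta (fls_const c) = 0"
  by (simp add: Theta_def)

lemma Theta_fps_to_fls: "Theta (fps_to_fls f) = fps_to_fls (theta f)"
  by (rule fls_eqI) (auto simp: Theta_nth theta_nth)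

lemma Theta_compose_power:
  assumes "m > 0"
  shows "Theta (fls_compose_power f m) = of_nat m * fls_compose_power (Theta f) m"
proof (rule fls_eqI)
  fix i
  have "fls_nth (of_nat m * fls_compose_power (Theta f) m) i = of_nat m * fls_nth (fls_compose_power (Theta f) m) i"
    by (metis fls_mult_of_nat_nth(1))
  thus "fls_nth (Theta (fls_compose_power f m)) i = fls_nth (of_nat m * fls_compose_power (Theta f) m) i"
    using assms by (auto simp: Theta_nth fls_nth_compose_power elim!: dvdE)
qed

lemma Theta_intpow: "Theta (fls_X_intpow k) = of_int k * fls_X_intpow k"
  by (rule fls_eqI) (auto simp: Theta_nth fls_mult_of_int_nth)

lemma map_mat_Theta_mult:
  assumes "A \<in> carrier_mat n n" "B \<in> carrier_mat n n"
  shows "map_mat Theta (A * B) = map_mat Theta A * B + A * map_mat Theta B"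
  by (rule map_mat_derivation[OF assms]) (simp_all add: Theta_add Theta_mult)

text \<open>In this form gauge transformations are composed and transported without computing inverses.\<close>

lemma gauge_iff:
  fixes g A B :: "'k::field fls mat"
  assumes g: "g \<in> carrier (GL n)" and A: "A \<in> carrier_mat n n" and B: "B \<in> carrier_mat n n"
  shows "B = gauge n g A \<longleftrightarrow> B * g = g * A + map_mat Theta g"
proof -
  define h where "h = inv\<^bsub>GL n\<^esub> g"
  have gc: "g \<in> carrier_mat n n" using g by (simp add: carrier_GL)
  have h: "h \<in> carrier_mat n n" "g * h = 1\<^sub>m n" "h * g = 1\<^sub>m n"
    using GL_inv_closed[OF g] by (simp_all add: h_def)
  have T: "map_mat Theta g \<in> carrier_mat n n" using gc by simp
  have gauge: "gauge n g A = (g * A + map_mat Theta g) * h"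
    unfolding gauge_def Theta_def[symmetric, abs_def] h_def[symmetric] using gc A h
    by (intro add_mult_distrib_mat[symmetric, of _ n n _ _ n]) auto
  have "g * A + map_mat Theta g \<in> carrier_mat n n" using gc A by auto
  hence 1: "(g * A + map_mat Theta g) * h * g = g * A + map_mat Theta g"
    using h gc by (simp add: assoc_mult_mat[of _ n n _ n _ n] right_mult_one_mat[of _ n n])
  have 2: "B * g * h = B"
    using h gc B by (simp add: assoc_mult_mat[of _ n n _ n _ n] right_mult_one_mat[of _ n n])
  show ?thesis unfolding gauge using 1 2 by metis
qed

lemma gauge_compose:
  fixes g k A B C :: "'k::field fls mat"
  assumes c: "g \<in> carrier_mat n n" "k \<in> carrier_mat n n" "A \<in> carrier_mat n n" "B \<in> carrier_mat n n" "C \<in> carrier_mat n n"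
    and 1: "B * g = g * A + map_mat Theta g" and 2: "C * k = k * B + map_mat Theta k"
  shows "C * (k * g) = (k * g) * A + map_mat Theta (k * g)"
proof -
  have T: "map_mat Theta g \<in> carrier_mat n n" "map_mat Theta k \<in> carrier_mat n n" using c by auto
  have "C * (k * g) = (C * k) * g" using c by simp
  also have "\<dots> = k * B * g + map_mat Theta k * g"
    unfolding 2 using c T by (intro add_mult_distrib_mat[of _ n n _ _ n]) auto
  also have "k * B * g = k * (B * g)" using c by simp
  also have "\<dots> = k * (g * A) + k * map_mat Theta g"
    unfolding 1 using c T by (intro mult_add_distrib_mat[of _ n n _ n]) auto
  also have "k * (g * A) + k * map_mat Theta g + map_mat Theta k * g = k * g * A + (map_mat Theta k * g + k * map_mat Theta g)"
    using c T by (intro eq_matI) (auto simp: algebra_simps simp del: index_mult_mat(1))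
  finally show ?thesis by (simp only: map_mat_Theta_mult[OF c(2,1)])
qed

lemma fls_compose_power_comm_ring_hom:
  "m > 0 \<Longrightarrow> comm_ring_hom (\<lambda>f :: 'k::field fls. fls_compose_power f m)"
  by unfold_locales simp_all

lemma of_nat_fls: "(of_nat m :: 'k::field fls) = fls_const (of_nat m)"
  by (rule fls_eqI) (simp add: fls_of_nat_nth)

lemma pullback_smult: "pullback m A = of_nat m \<cdot>\<^sub>m map_mat (\<lambda>f. fls_compose_power f m) A"
  by (rule eq_matI) (auto simp: pullback_def)

text \<open>The factor \<open>m\<close> in the pull-back is the one in \<open>z d/dz f (z\<^sup>m) = m (z f') (z\<^sup>m)\<close>.\<close>

lemma gauge_pullback:
  fixes g A B :: "'k::field fls mat"
  assumes m: "m > 0" and c: "g \<in> carrier_mat n n" "A \<in> carrier_mat n n" "B \<in> carrier_mat n n"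
    and 1: "B * g = g * A + map_mat Theta g"
  defines "cp \<equiv> map_mat (\<lambda>f. fls_compose_power f m)"
  shows "pullback m B * cp g = cp g * pullback m A + map_mat Theta (cp g)"
proof -
  interpret C: comm_ring_hom "\<lambda>f :: 'k fls. fls_compose_power f m"
    by (rule fls_compose_power_comm_ring_hom[OF m])
  have cc: "cp g \<in> carrier_mat n n" "cp A \<in> carrier_mat n n" "cp B \<in> carrier_mat n n" using c by (auto simp: cp_def)
  have "pullback m B * cp g = of_nat m \<cdot>\<^sub>m (cp B * cp g)"
    unfolding pullback_smult cp_def[symmetric] using cc by (intro mult_smult_assoc_mat[of _ n n _ n])
  also have "cp B * cp g = cp (B * g)" unfolding cp_def using c by (intro C.mat_hom_mult[symmetric])
  also have "\<dots> = cp (g * A) + cp (map_mat Theta g)"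
    unfolding 1 cp_def using c by (intro eq_matI) (auto simp: C.hom_add simp del: index_mult_mat(1))
  also have "cp (g * A) = cp g * cp A" unfolding cp_def using c by (intro C.mat_hom_mult)
  also have "of_nat m \<cdot>\<^sub>m (cp g * cp A + cp (map_mat Theta g)) = of_nat m \<cdot>\<^sub>m (cp g * cp A) + of_nat m \<cdot>\<^sub>m cp (map_mat Theta g)"
    using c by (intro eq_matI) (auto simp: cp_def algebra_simps simp del: index_mult_mat(1))
  also have "of_nat m \<cdot>\<^sub>m (cp g * cp A) = cp g * pullback m A"
    unfolding pullback_smult cp_def[symmetric] using cc by (intro mult_smult_distrib[symmetric, of _ n n _ n])
  also have "of_nat m \<cdot>\<^sub>m cp (map_mat Theta g) = map_mat Theta (cp g)"
    using c m by (intro eq_matI) (auto simp: cp_def Theta_compose_power)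
  finally show ?thesis .
qed

context matrix_group
begin

lemma loop_group_carrier: "g \<in> loop_group n G \<Longrightarrow> g \<in> carrier (GL n)" "g \<in> loop_group n G \<Longrightarrow> g \<in> carrier_mat n n"
  by (auto simp: points_iff carrier_GL)

lemma loop_group_pullback:
  assumes "m > 0" and g: "g \<in> loop_group n G"
  shows "map_mat (\<lambda>f. fls_compose_power f m) g \<in> loop_group n G"
proof -
  interpret C: comm_ring_hom "\<lambda>f :: 'k fls. fls_compose_power f m"
    by (rule fls_compose_power_comm_ring_hom[OF assms(1)])
  have "ev fls_const (\<lambda>ij. map_mat (\<lambda>f. fls_compose_power f m) g $$ ij) p = 0" if p: "p \<in> I" for p
  proof -
    have "ev fls_const (\<lambda>ij. map_mat (\<lambda>f. fls_compose_power f m) g $$ ij) p =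
        ev fls_const (\<lambda>ij. fls_compose_power (g $$ ij) m) p"
      using loop_group_carrier(2)[OF g] by (intro ev_cong[OF I_mat_polys[OF p]]) auto
    also have "\<dots> = fls_compose_power (ev fls_const (\<lambda>ij. g $$ ij) p) m"
      unfolding C.hom_ev using assms(1) by simp
    also have "\<dots> = 0" using g p by (simp add: points_iff)
    finally show ?thesis .
  qed
  thus ?thesis using C.GL_map_mat[OF loop_group_carrier(1)[OF g]] by (simp add: points_iff)
qed

lemma connections_pullback:
  assumes "m > 0" and A: "A \<in> connections n G"
  shows "pullback m A \<in> connections n G"
proof -
  have Ac: "A \<in> carrier_mat n n" using A by (simp add: connections_def)
  have "map_mat (\<lambda>f. fls_nth f i) (pullback m A) \<in> \<gg>" for i
  proof (cases "int m dvd i")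
    case True
    have "map_mat (\<lambda>f. fls_nth f i) (pullback m A) = of_nat m \<cdot>\<^sub>m map_mat (\<lambda>f. fls_nth f (i div int m)) A"
      using True assms(1) Ac by (intro eq_matI) (auto simp: pullback_def of_nat_fls fls_nth_compose_power)
    thus ?thesis using A by (auto simp: connections_def intro: lie_smult)
  next
    case False
    have "map_mat (\<lambda>f. fls_nth f i) (pullback m A) = 0\<^sub>m n n"
      using False assms(1) Ac by (intro eq_matI) (auto simp: pullback_def of_nat_fls fls_nth_compose_power)
    thus ?thesis using lie_0 by simp
  qed
  thus ?thesis using Ac by (simp add: connections_def pullback_def)
qed

lemma connections_const:
  assumes "X \<in> \<gg>" shows "map_mat fls_const X \<in> connections n G"
proof -
  note Xc = lie_carrier[OF assms]
  have "map_mat (\<lambda>f. fls_nth f i) (map_mat fls_const X) = (if i = 0 then X else 0\<^sub>m n n)" for i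
    using Xc by (intro eq_matI) auto
  thus ?thesis using Xc assms lie_0 by (auto simp: connections_def)
qed

lemma connections_fps:
  assumes "A \<in> carrier_mat n n" "\<And>m. cf m A \<in> \<gg>"
  shows "map_mat fps_to_fls A \<in> connections n G"
proof -
  have "map_mat (\<lambda>f. fls_nth f i) (map_mat fps_to_fls A) = (if i < 0 then 0\<^sub>m n n else cf (nat i) A)" for i
    using assms(1) by (intro eq_matI) auto
  thus ?thesis using assms lie_0 by (auto simp: connections_def)
qed

text \<open>An entry \<open>c z\<^sup>j\<close> of the normal form at \<open>(a, b)\<close> becomes \<open>m c z^(m j)\<close> under the pull-back, and \<open>m j = l a - l b\<close>.  The
  gauge transformation by the powers \<open>z^(-l a)\<close> turns it into the constant \<open>m c\<close> and adds \<open>- diag l\<close>.\<close>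

theorem resonant_pullback_constant:
  assumes J: "eigen_triangular n s (cf 0 A)" and A: "A \<in> carrier_mat n n" "\<And>j. cf j A \<in> \<gg>"
    and d: "lie_degree n G d" and m: "m > 0" and l: "compatible_cocharacter n d m s l"
  shows "\<exists>X\<in>\<gg>. gauge_equivalent n G (pullback m (map_mat fps_to_fls A)) (map_mat fls_const X)"
proof -
  interpret F: comm_ring_hom "fps_to_fls :: 'k fps \<Rightarrow> 'k fls" by (rule fps_to_fls_comm_ring_hom)
  note l1 = l[unfolded compatible_cocharacter_def, THEN conjunct1, rule_format]
    and l2 = l[unfolded compatible_cocharacter_def, THEN conjunct2, rule_format]
  from resonant_normal_form[OF J A] obtain Y g h B where gB: "gauged A Y g h B"
    and res: "\<And>j. resonant s j (cf j B)" by blast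
  note a = gB[unfolded gauged_def flow_def]
  have c: "Y \<in> carrier_mat n n" "g \<in> carrier_mat n n" "h \<in> carrier_mat n n" "B \<in> carrier_mat n n"
    and gh: "g * h = 1\<^sub>m n" "h * g = 1\<^sub>m n" and ode: "map_mat theta g = Y * g" and B: "B = g * A * h + Y"
    using a by auto
  have Blie: "cf j B \<in> \<gg>" for j using gauged_lie[OF gB A(2)] .
  define x1 where "x1 = map_mat fps_to_fls g"
  define A1 where "A1 = map_mat fps_to_fls A"
  define B1 where "B1 = map_mat fps_to_fls B"
  have c1: "x1 \<in> carrier_mat n n" "A1 \<in> carrier_mat n n" "B1 \<in> carrier_mat n n"
    using c A by (auto simp: x1_def A1_def B1_def)
  have x1: "x1 \<in> loop_group n G"
  proof -
    have "ev fls_const (\<lambda>ij. x1 $$ ij) p = 0" if p: "p \<in> I" for p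
    proof -
      have "ev fls_const (\<lambda>ij. x1 $$ ij) p = ev fls_const (\<lambda>ij. fps_to_fls (g $$ ij)) p"
        using c by (intro ev_cong[OF I_mat_polys[OF p]]) (auto simp: x1_def)
      also have "\<dots> = fps_to_fls (ev fps_const (\<lambda>ij. g $$ ij) p)"
        unfolding F.hom_ev by simp
      also have "ev fps_const (\<lambda>ij. g $$ ij) p = 0"
        using gB p by (intro flow_in_group[of Y g h]) (auto simp: gauged_def)
      finally show ?thesis by simp
    qed
    moreover have "g \<in> carrier (GL n)" using c gh by (auto simp: carrier_GL)
    ultimately show ?thesis using F.GL_map_mat by (auto simp: points_iff x1_def)
  qed
  have rel1: "B1 * x1 = x1 * A1 + map_mat Theta x1"
  proof -
    have "B * g = g * A * h * g + Y * g"
      unfolding B using A c by (intro add_mult_distrib_mat[of _ n n _ _ n]) auto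
    also have "g * A * h * g = g * A * (h * g)"
      using A c by (intro assoc_mult_mat[of _ n n _ n _ n]) auto
    also have "\<dots> = g * A" unfolding gh using A c by (intro right_mult_one_mat[of _ n n]) auto
    finally have Bg: "B * g = g * A + map_mat theta g" by (simp only: ode)
    have "B1 * x1 = map_mat fps_to_fls (B * g)"
      unfolding B1_def x1_def using c by (intro F.mat_hom_mult[symmetric])
    also have "\<dots> = map_mat fps_to_fls (g * A) + map_mat fps_to_fls (map_mat theta g)"
      unfolding Bg using A c by (intro eq_matI) (auto simp del: index_mult_mat(1))
    also have "map_mat fps_to_fls (g * A) = x1 * A1"
      unfolding A1_def x1_def using A c by (intro F.mat_hom_mult)
    also have "map_mat fps_to_fls (map_mat theta g) = map_mat Theta x1"
      unfolding x1_def by (intro eq_matI) (auto simp: Theta_fps_to_fls)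
    finally show ?thesis .
  qed
  define x2 where "x2 = map_mat (\<lambda>f. fls_compose_power f m) x1"
  have x2: "x2 \<in> loop_group n G" unfolding x2_def by (rule loop_group_pullback[OF m x1])
  have rel2: "pullback m B1 * x2 = x2 * pullback m A1 + map_mat Theta x2"
    unfolding x2_def by (rule gauge_pullback[OF m c1 rel1])
  have dgl: "diag_of n (\<lambda>i. of_int (l i)) \<in> \<gg>"
  proof (rule diagonal_in_lie[OF J A(2) d])
    fix t t' :: "(nat \<times> nat) \<Rightarrow>\<^sub>0 nat"
    assume "keys t \<subseteq> idx n" "keys t' \<subseteq> idx n" "tdeg t \<le> d" "tdeg t' \<le> d" "wt s t = wt s t'"
    thus "wt (\<lambda>i. of_int (l i) :: 'k) t = wt (\<lambda>i. of_int (l i)) t'" by (rule l1)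
  qed
  have "(- 1) \<cdot>\<^sub>m diag_of n (\<lambda>i. of_int (l i)) = diag_of n (\<lambda>i. of_int (- l i) :: 'k)"
    by (intro eq_matI) (auto simp: diag_of_def)
  hence dgl': "diag_of n (\<lambda>i. of_int (- l i)) \<in> \<gg>"
    using lie_smult[OF dgl, of "- 1"] by simp
  define z :: "int \<Rightarrow> 'k fls" where "z = (\<lambda>k. fls_X_intpow k)"
  have z_mult: "z a * z b = z (a + b)" for a b by (simp add: z_def fls_X_intpow_times_fls_X_intpow)
  define x3 where "x3 = diag_of n (\<lambda>i. z (- l i))"
  have x3: "x3 \<in> loop_group n G"
    unfolding x3_def z_def by (rule cocharacter_in_loop_group[OF dgl'])
  have coeff: "s i - s j = of_nat k" if "i < n" "j < n" "fps_nth (B $$ (i, j)) k \<noteq> 0" for i j k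
    using res[of k] that c by (auto simp: resonant_def)
  \<comment> \<open>each entry of \<open>B\<close> has at most one exponent, so \<open>B\<close> is a polynomial in \<open>z\<close>\<close>
  define K where "K = {k. \<exists>i<n. \<exists>j<n. fps_nth (B $$ (i, j)) k \<noteq> 0}"
  have "finite K"
  proof (rule finite_subset)
    show "K \<subseteq> (\<Union>(i, j)\<in>idx n. {k. of_nat k = s i - s j})"
      using coeff by (force simp: K_def)
    show "finite (\<Union>(i, j)\<in>idx n. {k. of_nat k = s i - s j})"
    proof (intro finite_UN_I)
      fix ij :: "nat \<times> nat"
      obtain i j where [simp]: "ij = (i, j)" by force
      have "k = k'" if "of_nat k = s i - s j" "of_nat k' = s i - s j" for k k'
        using that by (metis of_nat_eq_iff)
      hence "\<exists>k0. {k. of_nat k = s i - s j} \<subseteq> {k0}" by blast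
      thus "finite (case ij of (i, j) \<Rightarrow> {k. of_nat k = s i - s j})"
        by (auto intro: finite_subset)
    qed auto
  qed
  then obtain N where N: "\<And>k. k \<in> K \<Longrightarrow> k \<le> N" by (metis finite_nat_set_iff_bounded_le)
  define C where "C = mat n n (\<lambda>ij. \<Sum>k\<in>{..N}. 1 * cf k B $$ ij)"
  define X where "X = of_nat m \<cdot>\<^sub>m C + diag_of n (\<lambda>i. of_int (- l i))"
  have C: "C \<in> \<gg>" unfolding C_def by (intro lie_sum Blie)
  hence X: "X \<in> \<gg>" unfolding X_def by (intro lie_add lie_smult dgl')
  have Xc: "map_mat fls_const X \<in> carrier_mat n n" using lie_carrier[OF X] by simp
  have key: "fls_const (C $$ (i, j)) * z (- l j) = z (- l i) * fls_compose_power (fps_to_fls (B $$ (i, j))) m"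
    if ij: "i < n" "j < n" for i j
  proof (cases "\<exists>k. fps_nth (B $$ (i, j)) k \<noteq> 0")
    case False
    hence "B $$ (i, j) = 0" by (intro fps_ext) simp
    moreover have "C $$ (i, j) = 0" using ij c False by (simp add: C_def)
    ultimately show ?thesis by simp
  next
    case True
    then obtain k where k: "fps_nth (B $$ (i, j)) k \<noteq> 0" by blast
    define b where "b = fps_nth (B $$ (i, j)) k"
    have k': "fps_nth (B $$ (i, j)) k' = (if k' = k then b else 0)" for k'
      unfolding b_def using coeff[OF ij k] coeff[OF ij, of k'] by (metis of_nat_eq_iff)
    have "k \<le> N" using k ij by (intro N) (auto simp: K_def)
    hence Cc: "C $$ (i, j) = b" using ij c by (simp add: C_def k')
    have "fps_to_fls (B $$ (i, j)) = fls_const b * z (int k)"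
    proof (rule fls_eqI)
      fix q
      show "fls_nth (fps_to_fls (B $$ (i, j))) q = fls_nth (fls_const b * z (int k)) q"
        by (auto simp: z_def k' split: if_splits)
    qed
    hence "fls_compose_power (fps_to_fls (B $$ (i, j))) m = fls_const b * z (int m * int k)"
      using m by (simp add: z_def del: fls_compose_power_shift)
    moreover have "z (- l i) * z (int m * int k) = z (- l j)"
    proof -
      have "- l i + int m * int k = - l j" using l2[OF ij coeff[OF ij k]] by linarith
      thus ?thesis by (simp only: z_mult)
    qed
    ultimately show ?thesis unfolding Cc by (simp add: mult.left_commute)
  qed
  have rel3: "map_mat fls_const X * x3 = x3 * pullback m B1 + map_mat Theta x3"
  proof (rule eq_mat_square)
    have pB: "pullback m B1 \<in> carrier_mat n n" using c1 by (simp add: pullback_def)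
    have x3c: "x3 \<in> carrier_mat n n" by (simp add: x3_def)
    fix i j assume ij: "i < n" "j < n"
    have Cc: "C \<in> carrier_mat n n" by (simp add: C_def)
    have "(map_mat fls_const X * x3) $$ (i, j) = (\<Sum>q<n. if q = j then fls_const (X $$ (i, j)) * z (- l j) else 0)"
      unfolding index_mult_mat_sum[OF Xc x3c ij] using ij lie_carrier[OF X] by (intro sum.cong refl) (auto simp: x3_def)
    also have "\<dots> = fls_const (X $$ (i, j)) * z (- l j)" using ij by simp
    also have "X $$ (i, j) = of_nat m * C $$ (i, j) + (if i = j then - of_int (l i) else 0)"
      using ij Cc by (auto simp: X_def diag_of_def)
    also have "fls_const \<dots> = of_nat m * fls_const (C $$ (i, j)) + (if i = j then of_int (- l i) else 0)"
      by (rule fls_eqI) (auto simp: of_nat_fls fls_of_int_nth)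
    also have "\<dots> * z (- l j) = of_nat m * (fls_const (C $$ (i, j)) * z (- l j)) + (if i = j then of_int (- l i) * z (- l i) else 0)"
      by (simp add: algebra_simps)
    also have "\<dots> = z (- l i) * pullback m B1 $$ (i, j) + map_mat Theta x3 $$ (i, j)"
    proof -
      have "pullback m B1 $$ (i, j) = of_nat m * fls_compose_power (fps_to_fls (B $$ (i, j))) m"
        using ij c by (simp add: pullback_def B1_def)
      moreover have "map_mat Theta x3 $$ (i, j) = (if i = j then of_int (- l i) * z (- l i) else 0)"
        using ij Theta_intpow[of "- l i"] Theta_const[of "0::'k"] by (auto simp add: x3_def z_def)
      ultimately show ?thesis unfolding key[OF ij] by (simp only: mult.left_commute)
    qed
    also have "z (- l i) * pullback m B1 $$ (i, j) = (\<Sum>q<n. if q = i then z (- l i) * pullback m B1 $$ (i, j) else 0)"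
      using ij by simp
    also have "\<dots> = (x3 * pullback m B1) $$ (i, j)"
      unfolding index_mult_mat_sum[OF x3c pB ij] using ij by (intro sum.cong refl) (auto simp: x3_def)
    finally show "(map_mat fls_const X * x3) $$ (i, j) = (x3 * pullback m B1 + map_mat Theta x3) $$ (i, j)"
      using ij x3c pB by (simp del: index_mult_mat(1))
  qed (use Xc c1 in \<open>auto simp: x3_def\<close>)
  have cc: "pullback m A1 \<in> carrier_mat n n" "pullback m B1 \<in> carrier_mat n n" using c1 by (auto simp: pullback_def)
  have "map_mat fls_const X * (x3 * x2) = (x3 * x2) * pullback m A1 + map_mat Theta (x3 * x2)"
    by (rule gauge_compose[OF loop_group_carrier(2)[OF x2] loop_group_carrier(2)[OF x3] cc Xc rel2 rel3])
  moreover have x32: "x3 * x2 \<in> loop_group n G" by (rule loop_group_mult[OF x3 x2])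
  ultimately have "map_mat fls_const X = gauge n (x3 * x2) (pullback m A1)"
    using gauge_iff[OF loop_group_carrier(1)[OF x32] cc(1) Xc] by simp
  moreover have "pullback m A1 \<in> connections n G"
    unfolding A1_def by (intro connections_pullback m connections_fps A)
  ultimately have "gauge_equivalent n G (pullback m A1) (map_mat fls_const X)"
    using x32 connections_const[OF X] by (auto simp: gauge_equivalent_def)
  with X show ?thesis unfolding A1_def by blast
qed

end

section \<open>Change of basis\<close>

text \<open>A change of basis, from a group \<open>H\<close> to a group \<open>G\<close>.  The situation is symmetric; see \<open>swap\<close>.\<close>

locale conjugate_groups = G: matrix_group n G + H: matrix_group n H
  for n and G H :: "'k::field_char_0 mat set" +
  fixes P Q :: "'k mat"
  assumes P: "P \<in> carrier_mat n n" and Q: "Q \<in> carrier_mat n n" and PQ: "P * Q = 1\<^sub>m n" "Q * P = 1\<^sub>m n"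
    and HG: "\<And>h. h \<in> H \<Longrightarrow> P * h * Q \<in> G" and GH: "\<And>g. g \<in> G \<Longrightarrow> Q * g * P \<in> H"
begin

lemma swap: "conjugate_groups n H G Q P"
  by unfold_locales (fact P Q PQ HG GH)+

lemma tr_vanishing_ideal: "p \<in> vanishing_ideal n G \<Longrightarrow> tr n P Q p \<in> vanishing_ideal n H"
  using P Q HG H.G_carrier by (intro tr_vanishing) auto

lemma lie_conjugate:
  assumes X: "X \<in> lie_algebra n H"
  shows "P * X * Q \<in> lie_algebra n G"
proof -
  note Xc = H.lie_carrier[OF X]
  have "ev_one n (lder n (P * X * Q) p) = 0" if p: "p \<in> vanishing_ideal n G" for p
  proof -
    from tr_vanishing_ideal[OF p]
    have "ev_one n (lder n X (tr n P Q p)) = 0"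
      using X by (auto simp: H.lie_iff_lder)
    thus ?thesis unfolding ev_one_lder_conjugate[OF G.I_mat_polys[OF p] Xc P Q PQ(1)] .
  qed
  thus ?thesis using P Xc Q by (auto simp: G.lie_iff_lder)
qed

lemma loop_group_conjugate:
  assumes x: "x \<in> loop_group n H"
  shows "map_mat fls_const P * x * map_mat fls_const Q \<in> loop_group n G"
proof -
  interpret C: comm_ring_hom "fls_const :: 'k \<Rightarrow> 'k fls" by (rule fls_const_comm_ring_hom)
  have PQ': "P \<in> carrier (GL n)" "Q \<in> carrier (GL n)" using P Q PQ by (auto simp: carrier_GL)
  have "ev fls_const (\<lambda>ij. (map_mat fls_const P * x * map_mat fls_const Q) $$ ij) p = 0"
    if p: "p \<in> vanishing_ideal n G" for p
  proof -
    from tr_vanishing_ideal[OF p]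
    have "ev fls_const (\<lambda>ij. x $$ ij) (tr n P Q p) = 0"
      using x by (auto simp: points_iff)
    thus ?thesis unfolding C.ev_tr[OF G.I_mat_polys[OF p] P Q H.loop_group_carrier(2)[OF x]] .
  qed
  thus ?thesis
    using GL_mult_closed[OF GL_mult_closed[OF C.GL_map_mat[OF PQ'(1)] H.loop_group_carrier(1)[OF x]] C.GL_map_mat[OF PQ'(2)]]
    by (simp add: points_iff)
qed

text \<open>Linear substitutions do not raise degrees.\<close>

lemma lie_degree_conjugate:
  assumes d: "lie_degree n G d"
  shows "lie_degree n H d"
  unfolding lie_degree_def
proof (intro ballI impI)
  fix X :: "'k mat" assume X: "X \<in> carrier_mat n n"
    "\<forall>p\<in>vanishing_ideal n H. deg_le d p \<longrightarrow> ev_one n (lder n X p) = 0"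
  have "ev_one n (lder n (P * X * Q) p) = 0" if p: "p \<in> vanishing_ideal n G" "deg_le d p" for p
  proof -
    from tr_vanishing_ideal[OF p(1)]
    have "ev_one n (lder n X (tr n P Q p)) = 0"
      using X(2) deg_le_tr[OF p(2)] by blast
    thus ?thesis unfolding ev_one_lder_conjugate[OF G.I_mat_polys[OF p(1)] X(1) P Q PQ(1)] .
  qed
  moreover have "P * X * Q \<in> carrier_mat n n" using P X Q by auto
  ultimately have "P * X * Q \<in> lie_algebra n G"
    using d unfolding lie_degree_def by blast
  from conjugate_groups.lie_conjugate[OF swap this]
  show "X \<in> lie_algebra n H" using conj_inverse[OF Q P X(1) PQ(2)] by simp
qed

text \<open>A constant matrix is killed by \<open>z d/dz\<close>, so the equation of \<open>gauge_iff\<close> may be conjugated term by term.\<close>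

lemma gauge_equivalent_conjugate:
  assumes A: "A \<in> carrier_mat n n" and X: "X \<in> carrier_mat n n"
    and eq: "gauge_equivalent n H (map_mat fls_const Q * A * map_mat fls_const P) (map_mat fls_const X)"
  shows "\<exists>g\<in>loop_group n G. map_mat fls_const (P * X * Q) * g = g * A + map_mat Theta g"
proof -
  interpret C: comm_ring_hom "fls_const :: 'k \<Rightarrow> 'k fls" by (rule fls_const_comm_ring_hom)
  define p where "p = map_mat fls_const P"
  define q where "q = map_mat fls_const Q"
  define x where "x = map_mat fls_const X"
  have c: "p \<in> carrier_mat n n" "q \<in> carrier_mat n n" "x \<in> carrier_mat n n" using P Q X by (auto simp: p_def q_def x_def)
  have pq: "p * q = 1\<^sub>m n" "q * p = 1\<^sub>m n"
    using C.mat_hom_mult[OF P Q] C.mat_hom_mult[OF Q P] PQ by (simp_all add: p_def q_def C.mat_hom_one)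
  from eq obtain g where g: "g \<in> loop_group n H" "x = gauge n g (q * A * p)"
    by (auto simp: gauge_equivalent_def p_def q_def x_def)
  note gc = H.loop_group_carrier(2)[OF g(1)]
  have qAp: "q * A * p \<in> carrier_mat n n" using c A by auto
  have rel: "x * g = g * (q * A * p) + map_mat Theta g"
    using gauge_iff[OF H.loop_group_carrier(1)[OF g(1)] qAp c(3)] g(2) by simp
  have Tg: "map_mat Theta g \<in> carrier_mat n n" using gc by simp
  have cancel: "(p * M * q) * (p * N * q) = p * (M * N) * q" if "M \<in> carrier_mat n n" "N \<in> carrier_mat n n" for M N
  proof -
    have "(p * M * q) * (p * N * q) = p * M * (q * (p * N * q))"
      using that c by (intro assoc_mult_mat[of _ n n _ n _ n]) auto
    also have "q * (p * N * q) = (q * p) * (N * q)"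
      using that c by (simp add: assoc_mult_mat[of _ n n _ n _ n])
    also have "\<dots> = N * q" unfolding pq using that c by (intro left_mult_one_mat[of _ n n]) auto
    finally show ?thesis using that c by (simp add: assoc_mult_mat[of _ n n _ n _ n])
  qed
  have T0: "map_mat Theta p = 0\<^sub>m n n" "map_mat Theta q = 0\<^sub>m n n"
    using P Q by (auto intro!: eq_matI simp: p_def q_def Theta_const)
  have Tpgq: "map_mat Theta (p * g * q) = p * map_mat Theta g * q"
  proof -
    have pg: "p * g \<in> carrier_mat n n" using c gc by auto
    have "map_mat Theta (p * g) = p * map_mat Theta g"
      unfolding map_mat_Theta_mult[OF c(1) gc] T0 using c gc Tg by simp
    thus ?thesis unfolding map_mat_Theta_mult[OF pg c(2)] T0 using c gc Tg by simp
  qed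
  have "(p * x * q) * (p * g * q) = p * (g * (q * A * p) + map_mat Theta g) * q"
    unfolding cancel[OF c(3) gc] rel ..
  also have "p * (g * (q * A * p) + map_mat Theta g) = p * (g * (q * A * p)) + p * map_mat Theta g"
    using c gc Tg qAp by (intro mult_add_distrib_mat[of _ n n _ n]) auto
  also have "(p * (g * (q * A * p)) + p * map_mat Theta g) * q = p * (g * (q * A * p)) * q + p * map_mat Theta g * q"
    using c gc Tg qAp by (intro add_mult_distrib_mat[of _ n n _ _ n]) auto
  also have "p * (g * (q * A * p)) * q = (p * g * q) * (p * (q * A * p) * q)"
    using cancel[OF gc qAp] by simp
  also have "p * (q * A * p) * q = A" by (rule conj_inverse[OF c(1,2) A pq(1)])
  finally have "(p * x * q) * (p * g * q) = (p * g * q) * A + map_mat Theta (p * g * q)"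
    by (simp only: Tpgq)
  moreover have "p * x * q = map_mat fls_const (P * X * Q)"
    unfolding p_def q_def x_def using C.mat_hom_mult[OF mult_carrier_mat[OF P X] Q] C.mat_hom_mult[OF P X] by simp
  moreover have "p * g * q \<in> loop_group n G"
    unfolding p_def q_def by (rule loop_group_conjugate[OF g(1)])
  ultimately show ?thesis by auto
qed

end

lemma conjugate_subgroup:
  fixes G :: "'k::field_char_0 mat set"
  assumes G: "matrix_group n G" and P: "P \<in> carrier_mat n n" and Q: "Q \<in> carrier_mat n n"
    and PQ: "P * Q = 1\<^sub>m n" "Q * P = 1\<^sub>m n"
  shows "matrix_group n ((\<lambda>g. Q * g * P) ` G)"
proof (rule matrix_group.intro)
  interpret G: matrix_group n G by (rule G)
  have PQ': "P \<in> carrier (GL n)" "Q \<in> carrier (GL n)" using P Q PQ by (auto simp: carrier_GL)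
  have mult: "(Q * g * P) * (Q * h * P) = Q * (g * h) * P" if "g \<in> carrier_mat n n" "h \<in> carrier_mat n n" for g h
  proof -
    have "(Q * g * P) * (Q * h * P) = Q * g * (P * (Q * h * P))"
      using that P Q by (intro assoc_mult_mat[of _ n n _ n _ n]) auto
    also have "P * (Q * h * P) = (P * Q) * (h * P)"
      using that P Q by (simp add: assoc_mult_mat[of _ n n _ n _ n] del: PQ)
    also have "\<dots> = h * P" unfolding PQ using that P by (intro left_mult_one_mat[of _ n n]) auto
    finally show ?thesis using that P Q by (simp add: assoc_mult_mat[of _ n n _ n _ n])
  qed
  have M: "monoid (ring_mat TYPE('k) n ())" by (rule ring.is_monoid[OF ring_mat])
  interpret GL: group "GL n :: 'k mat monoid"
    unfolding GL_def by (rule monoid.units_group[OF M])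
  show "subgroup ((\<lambda>g. Q * g * P) ` G) (GL n)"
  proof (rule GL.subgroupI)
    show "(\<lambda>g. Q * g * P) ` G \<subseteq> carrier (GL n)"
      using subgroup.subset[OF G.G] PQ' by (auto intro!: GL_mult_closed)
    show "(\<lambda>g. Q * g * P) ` G \<noteq> {}" using G.G_one by auto
    fix x assume "x \<in> (\<lambda>g. Q * g * P) ` G"
    then obtain g where g: "g \<in> G" "x = Q * g * P" by auto
    define h where "h = inv\<^bsub>GL n\<^esub> g"
    have h: "h \<in> G" unfolding h_def using subgroup.m_inv_closed[OF G.G g(1)] .
    have gh: "g * h = 1\<^sub>m n" "h * g = 1\<^sub>m n"
      using GL_inv_closed(2,3)[of g n] subgroup.subset[OF G.G] g(1) unfolding h_def by auto
    have one: "Q * 1\<^sub>m n * P = 1\<^sub>m n" using P Q PQ by simp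
    note gc = G.G_carrier[OF g(1)] G.G_carrier[OF h]
    have "inv\<^bsub>GL n\<^esub> x = Q * h * P"
      unfolding g(2) by (rule inv_GL) (use mult[OF gc(1,2)] mult[OF gc(2,1)] gh one P Q gc in auto)
    thus "inv\<^bsub>GL n\<^esub> x \<in> (\<lambda>g. Q * g * P) ` G" using h by auto
  next
    fix x y assume "x \<in> (\<lambda>g. Q * g * P) ` G" "y \<in> (\<lambda>g. Q * g * P) ` G"
    then obtain g k where g: "g \<in> G" "x = Q * g * P" and k: "k \<in> G" "y = Q * k * P" by auto
    show "x \<otimes>\<^bsub>GL n\<^esub> y \<in> (\<lambda>g. Q * g * P) ` G"
      using mult[OF G.G_carrier[OF g(1)] G.G_carrier[OF k(1)]] G.G_mult[OF g(1) k(1)] g k by auto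
  qed
qed

lemma cf_conjugate:
  fixes A :: "'k::field fps mat"
  assumes A: "A \<in> carrier_mat n n" and P: "P \<in> carrier_mat n n" and Q: "Q \<in> carrier_mat n n"
  shows "cf m (map_mat fps_const Q * A * map_mat fps_const P) = Q * cf m A * P"
proof (rule eq_mat_square)
  fix i j assume ij: "i < n" "j < n"
  let ?Q = "map_mat fps_const Q" and ?P = "map_mat fps_const P"
  have c: "?Q \<in> carrier_mat n n" "?P \<in> carrier_mat n n" "?Q * A \<in> carrier_mat n n" "Q * cf m A \<in> carrier_mat n n" "cf m A \<in> carrier_mat n n"
    using A P Q by auto
  have 1: "fps_nth ((?Q * A) $$ (i, d)) m = (Q * cf m A) $$ (i, d)" if d: "d < n" for d
    unfolding index_mult_mat_sum[OF c(1) A ij(1) d] index_mult_mat_sum[OF Q c(5) ij(1) d] fps_sum_nth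
    using ij d Q A by (intro sum.cong refl) auto
  have "fps_nth ((?Q * A * ?P) $$ (i, j)) m = (Q * cf m A * P) $$ (i, j)"
    unfolding index_mult_mat_sum[OF c(3,2) ij] index_mult_mat_sum[OF c(4) P ij] fps_sum_nth
    using ij P by (intro sum.cong refl) (auto simp: 1 simp del: index_mult_mat(1))
  thus "cf m (?Q * A * ?P) $$ (i, j) = (Q * cf m A * P) $$ (i, j)"
    using ij P Q by (simp del: index_mult_mat(1))
qed (use P Q in auto)

section \<open>A uniform exponent\<close>

text \<open>A finite set that contains all differences of row degrees of monomials of degree at most \<open>d\<close> and all
  differences of two unit vectors; the successor is needed for the latter when \<open>d = 0\<close>.\<close>

definition bounded_vectors :: "nat \<Rightarrow> nat \<Rightarrow> (nat \<Rightarrow> int) set" where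
  "bounded_vectors n d = {c. \<forall>i. (i \<in> {..<n} \<longrightarrow> c i \<in> {- int (Suc d)..int (Suc d)}) \<and> (i \<notin> {..<n} \<longrightarrow> c i = 0)}"

lemma finite_bounded_vectors: "finite (bounded_vectors n d)"
  unfolding bounded_vectors_def by (rule finite_set_of_finite_funs) auto

definition row_degree :: "nat \<Rightarrow> ((nat \<times> nat) \<Rightarrow>\<^sub>0 nat) \<Rightarrow> nat \<Rightarrow> int" where
  "row_degree n t i = (if i < n then \<Sum>j<n. int (lookup t (i, j)) else 0)"

lemma wt_row_degree:
  assumes "keys t \<subseteq> idx n"
  shows "wt s t = dot n (row_degree n t) s"
proof -
  have "wt s t = (\<Sum>ij\<in>idx n. of_nat (lookup t ij) * s (fst ij))"
    unfolding wt_def by (rule sum.mono_neutral_left) (use assms in \<open>auto simp: in_keys_iff\<close>)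
  also have "\<dots> = dot n (row_degree n t) s"
    by (simp add: sum_square dot_def row_degree_def sum_distrib_right)
  finally show ?thesis .
qed

lemma row_degree_bounded:
  assumes "keys t \<subseteq> idx n" "tdeg t \<le> d"
  shows "0 \<le> row_degree n t i" "row_degree n t i \<le> int d"
proof -
  show "0 \<le> row_degree n t i" by (auto simp: row_degree_def intro: sum_nonneg)
  show "row_degree n t i \<le> int d"
  proof (cases "i < n")
    case True
    have "(\<Sum>j<n. lookup t (i, j)) \<le> (\<Sum>i<n. \<Sum>j<n. lookup t (i, j))"
      using True by (intro member_le_sum[of i "{..<n}" "\<lambda>i. \<Sum>j<n. lookup t (i, j)"]) auto
    also have "\<dots> = tdeg t"
      using tdeg_superset[OF _ assms(1)] by (simp add: sum_square)
    finally have "(\<Sum>j<n. lookup t (i, j)) \<le> d" using assms(2) by simp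
    thus ?thesis using True by (simp add: row_degree_def flip: of_nat_sum)
  qed (simp add: row_degree_def)
qed

text \<open>A relation of \<open>s\<close> between monomials is a linear form that vanishes at \<open>s\<close>, and a resonance is a linear form
  that is a natural number at \<open>s\<close>; both are covered by \<open>integral_point\<close>.\<close>

lemma uniform_exponent:
  obtains m :: nat where "m > 0"
    "\<And>s :: nat \<Rightarrow> 'k::field_char_0. \<exists>l. compatible_cocharacter n d m s l"
proof -
  from integral_point[OF finite_bounded_vectors[of n d], of n]
  obtain m :: nat where m: "m > 0"
    "\<And>s :: nat \<Rightarrow> 'k. \<exists>l :: nat \<Rightarrow> int. \<forall>c\<in>bounded_vectors n d. dot n c s \<in> \<int> \<longrightarrow>
       of_int (dot n c l) = of_nat m * dot n c s" by metis
  show ?thesis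
  proof (rule that[OF m(1)])
    fix s :: "nat \<Rightarrow> 'k"
    from m(2)[of s] obtain l :: "nat \<Rightarrow> int" where l: "\<And>c. c \<in> bounded_vectors n d \<Longrightarrow> dot n c s \<in> \<int> \<Longrightarrow>
       of_int (dot n c l) = of_nat m * dot n c s" by blast
    have 1: "wt (\<lambda>i. of_int (l i) :: 'k) t = wt (\<lambda>i. of_int (l i)) t'"
      if t: "keys t \<subseteq> idx n" "keys t' \<subseteq> idx n"
        "tdeg t \<le> d" "tdeg t' \<le> d" "wt s t = wt s t'" for t t'
    proof -
      define c where "c = (\<lambda>i. 1 * row_degree n t i + (- 1) * row_degree n t' i)"
      have "- int (Suc d) \<le> c i \<and> c i \<le> int (Suc d)" for i
        using row_degree_bounded[OF t(1,3), of i] row_degree_bounded[OF t(2,4), of i] by (auto simp: c_def)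
      moreover have "c i = 0" if "i \<notin> {..<n}" for i using that by (simp add: c_def row_degree_def)
      ultimately have "c \<in> bounded_vectors n d" unfolding bounded_vectors_def by simp
      moreover have "dot n c s = 0"
        using t unfolding c_def dot_lin_left by (simp add: wt_row_degree[of _ n])
      ultimately have "dot n c l = 0" using l[of c] by simp
      hence "(of_int (dot n c l) :: 'k) = 0" by simp
      hence "dot n c (\<lambda>i. of_int (l i) :: 'k) = 0" by (simp only: dot_of_int)
      thus ?thesis
        unfolding c_def dot_lin_left using t by (simp add: wt_row_degree[of _ n])
    qed
    have 2: "l a - l b = int m * int j" if ab: "a < n" "b < n" "s a - s b = of_nat j" for a b j
    proof -
      define c :: "nat \<Rightarrow> int" where "c = (\<lambda>i. (if i = a then 1 else 0) - (if i = b then 1 else 0))"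
      have cd: "dot n c x = x a - x b" for x :: "nat \<Rightarrow> 'b::comm_ring_1"
      proof -
        have "dot n c x = (\<Sum>i<n. (if i = a then x a else 0) - (if i = b then x b else 0))"
          unfolding dot_def by (intro sum.cong) (auto simp: c_def)
        thus ?thesis using ab by (simp add: sum_subtractf)
      qed
      have "c \<in> bounded_vectors n d" using ab by (auto simp: bounded_vectors_def c_def)
      moreover have "dot n c s \<in> \<int>" unfolding cd ab by simp
      ultimately have "of_int (dot n c l) = of_nat m * dot n c s" by (rule l)
      hence "(of_int (l a - l b) :: 'k) = of_int (int m * int j)" unfolding cd ab by simp
      thus ?thesis by (simp only: of_int_eq_iff)
    qed
    show "\<exists>l. compatible_cocharacter n d m s l"
      unfolding compatible_cocharacter_def using 1 2 by (intro exI[of _ l]) blast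
  qed
qed

theorem theorem4p2:
  fixes n :: nat and G :: "'k::{alg_closed_field, field_char_0} mat set"
  assumes "connected_reductive n G"
  shows "\<exists>m>0. \<forall>A. regular_connection n G A \<longrightarrow>
    (\<exists>X \<in> lie_algebra n G. gauge_equivalent n G (pullback m A) (map_mat fls_const X))"
proof -
  have G: "matrix_group n G"
    using assms by (simp add: connected_reductive_def linear_algebraic_group_def matrix_group_def)
  interpret G: matrix_group n G by (rule G)
  obtain d where d: "lie_degree n G d" using G.ex_lie_degree by blast
  obtain m :: nat where m: "m > 0" "\<And>s :: nat \<Rightarrow> 'k. \<exists>l. compatible_cocharacter n d m s l"
    using uniform_exponent[of n d] by blast
  have "\<exists>X \<in> lie_algebra n G. gauge_equivalent n G (pullback m A) (map_mat fls_const X)"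
    if "regular_connection n G A" for A
  proof -
    from that obtain B g where B: "B \<in> power_series_connections n G" and A: "A \<in> connections n G"
      and g: "g \<in> loop_group n G" "B = gauge n g A"
      by (auto simp: regular_connection_def gauge_equivalent_def)
    have Ac: "A \<in> carrier_mat n n" and Bc: "B \<in> carrier_mat n n"
      using A B by (auto simp: connections_def power_series_connections_def)
    note gc = G.loop_group_carrier[OF g(1)]
    have rel1: "B * g = g * A + map_mat Theta g"
      using gauge_iff[OF gc(1) Ac Bc] g(2) by simp
    define B1 where "B1 = map_mat fls_regpart B"
    have B1c: "B1 \<in> carrier_mat n n" using Bc by (simp add: B1_def)
    have B_fps: "B = map_mat fps_to_fls B1"
    proof (rule eq_mat_square)
      fix i j assume ij: "i < n" "j < n"
      have "fls_nth (B $$ (i, j)) k = 0" if "k < 0" for k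
      proof -
        have "map_mat (\<lambda>f. fls_nth f k) B = 0\<^sub>m n n"
          using B that by (auto simp: power_series_connections_def)
        from arg_cong[OF this, of "\<lambda>M. M $$ (i, j)"] show ?thesis using ij Bc by simp
      qed
      hence "B $$ (i, j) = fps_to_fls (fls_regpart (B $$ (i, j)))"
        by (intro fls_eqI) auto
      thus "B $$ (i, j) = map_mat fps_to_fls B1 $$ (i, j)" using ij Bc by (simp add: B1_def)
    qed (use Bc in \<open>auto simp: B1_def\<close>)
    have B1lie: "cf k B1 \<in> lie_algebra n G" for k
    proof -
      have "cf k B1 = map_mat (\<lambda>f. fls_nth f (int k)) B" by (auto simp: B1_def)
      thus ?thesis using B by (auto simp: power_series_connections_def connections_def)
    qed
    obtain P Q J s where pq: "P \<in> carrier_mat n n" "Q \<in> carrier_mat n n" "P * Q = 1\<^sub>m n" "Q * P = 1\<^sub>m n"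
      and J: "cf 0 B1 = P * J * Q" "eigen_triangular n s J"
    proof (rule ex_eigen_triangular)
      show "cf 0 B1 \<in> carrier_mat n n" using B1c by simp
    qed
    \<comment> \<open>in the basis given by \<open>P\<close>, the group becomes \<open>H\<close> and the leading coefficient becomes \<open>J\<close>\<close>
    define H where "H = (\<lambda>g. Q * g * P) ` G"
    have H: "matrix_group n H" unfolding H_def by (rule conjugate_subgroup[OF G pq])
    interpret H: matrix_group n H by (rule H)
    have GH: "Q * g * P \<in> H" if "g \<in> G" for g using that by (auto simp: H_def)
    have HG: "P * h * Q \<in> G" if "h \<in> H" for h
      using that conj_inverse[OF pq(1,2) G.G_carrier pq(3)] by (auto simp: H_def)
    interpret conjugate_groups n G H P Q
      by unfold_locales (use pq GH HG in auto)
    define B2 where "B2 = map_mat fps_const Q * B1 * map_mat fps_const P"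
    have B2c: "B2 \<in> carrier_mat n n" using pq B1c by (auto simp: B2_def)
    have cfB2: "cf k B2 = Q * cf k B1 * P" for k
      unfolding B2_def by (rule cf_conjugate[OF B1c pq(1,2)])
    have B2lie: "cf k B2 \<in> lie_algebra n H" for k
      unfolding cfB2 by (rule conjugate_groups.lie_conjugate[OF swap B1lie])
    have Jc: "J \<in> carrier_mat n n" using J(2) by (simp add: eigen_triangular_def)
    have J2: "eigen_triangular n s (cf 0 B2)"
      unfolding cfB2 J(1) using conj_inverse[OF pq(2,1) Jc pq(4)] J(2) by simp
    have dH: "lie_degree n H d"
      by (rule lie_degree_conjugate[OF d])
    obtain l where l: "compatible_cocharacter n d m s l" using m(2)[of s] by blast
    from H.resonant_pullback_constant[OF J2 B2c B2lie dH m(1) l]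
    obtain X where X: "X \<in> lie_algebra n H"
      "gauge_equivalent n H (pullback m (map_mat fps_to_fls B2)) (map_mat fls_const X)" by blast
    have pB: "pullback m B \<in> carrier_mat n n" and pA: "pullback m A \<in> carrier_mat n n"
      using Ac Bc by (auto simp: pullback_def)
    have "pullback m (map_mat fps_to_fls B2) = map_mat fls_const Q * pullback m B * map_mat fls_const P"
    proof -
      interpret F: comm_ring_hom "fps_to_fls :: 'k fps \<Rightarrow> 'k fls" by (rule fps_to_fls_comm_ring_hom)
      interpret C: comm_ring_hom "\<lambda>f :: 'k fls. fls_compose_power f m"
        by (rule fls_compose_power_comm_ring_hom[OF m(1)])
      let ?q = "map_mat fls_const Q" and ?p = "map_mat fls_const P"
      let ?c = "map_mat (\<lambda>f. fls_compose_power f m)"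
      have c: "?q \<in> carrier_mat n n" "?p \<in> carrier_mat n n" "?q * B \<in> carrier_mat n n" "?c B \<in> carrier_mat n n"
        using pq Bc by auto
      have fc: "map_mat fps_to_fls (map_mat fps_const M) = map_mat fls_const M" for M :: "'k mat"
        by (intro eq_matI) auto
      have Qc: "map_mat fps_const Q \<in> carrier_mat n n" "map_mat fps_const P \<in> carrier_mat n n" using pq by auto
      have "map_mat fps_to_fls B2 = ?q * B * ?p"
        unfolding B2_def B_fps using F.mat_hom_mult[OF mult_carrier_mat[OF Qc(1) B1c] Qc(2)]
          F.mat_hom_mult[OF Qc(1) B1c] by (simp add: fc)
      moreover have "?c (?q * B * ?p) = ?q * ?c B * ?p"
      proof -
        have cc: "?c (map_mat fls_const M) = map_mat fls_const M" for M :: "'k mat"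
          using m(1) by (intro eq_matI) auto
        show ?thesis
          using C.mat_hom_mult[OF c(3,2)] C.mat_hom_mult[OF c(1) Bc] by (simp add: cc)
      qed
      moreover have "of_nat m \<cdot>\<^sub>m (?q * ?c B * ?p) = ?q * (of_nat m \<cdot>\<^sub>m ?c B) * ?p"
      proof -
        have "?q * (of_nat m \<cdot>\<^sub>m ?c B) = of_nat m \<cdot>\<^sub>m (?q * ?c B)"
          using c by (intro mult_smult_distrib[of _ n n _ n]) auto
        moreover have "(of_nat m \<cdot>\<^sub>m (?q * ?c B)) * ?p = of_nat m \<cdot>\<^sub>m (?q * ?c B * ?p)"
          using c by (intro mult_smult_assoc_mat[of _ n n _ n]) auto
        ultimately show ?thesis by simp
      qed
      ultimately show ?thesis unfolding pullback_smult by simp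
    qed
    with X(2) have X2: "gauge_equivalent n H (map_mat fls_const Q * pullback m B * map_mat fls_const P) (map_mat fls_const X)"
      by simp
    obtain k where k: "k \<in> loop_group n G" "map_mat fls_const (P * X * Q) * k = k * pullback m B + map_mat Theta k"
      using gauge_equivalent_conjugate[OF pB H.lie_carrier[OF X(1)] X2] by blast
    define g' where "g' = map_mat (\<lambda>f. fls_compose_power f m) g"
    have g': "g' \<in> loop_group n G" unfolding g'_def by (rule G.loop_group_pullback[OF m(1) g(1)])
    have rel2: "pullback m B * g' = g' * pullback m A + map_mat Theta g'"
      unfolding g'_def by (rule gauge_pullback[OF m(1) gc(2) Ac Bc rel1])
    have PXQ: "P * X * Q \<in> lie_algebra n G"
      by (rule lie_conjugate[OF X(1)])
    have PXQc: "map_mat fls_const (P * X * Q) \<in> carrier_mat n n" using G.lie_carrier[OF PXQ] by simp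
    have kg: "k * g' \<in> loop_group n G" by (rule G.loop_group_mult[OF k(1) g'])
    have "map_mat fls_const (P * X * Q) * (k * g') = (k * g') * pullback m A + map_mat Theta (k * g')"
      by (rule gauge_compose[OF G.loop_group_carrier(2)[OF g'] G.loop_group_carrier(2)[OF k(1)] pA pB PXQc rel2 k(2)])
    hence "map_mat fls_const (P * X * Q) = gauge n (k * g') (pullback m A)"
      using gauge_iff[OF G.loop_group_carrier(1)[OF kg] pA PXQc] by simp
    hence "gauge_equivalent n G (pullback m A) (map_mat fls_const (P * X * Q))"
      using kg G.connections_pullback[OF m(1) A] G.connections_const[OF PXQ] by (auto simp: gauge_equivalent_def)
    with PXQ show ?thesis by blast
  qed
  with m(1) show ?thesis by blast
qed

end
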